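(* Consider the many-server system described in the context, operated under any load balancing policy in LB-zero. Let $\mathcal W$ be the event that an incoming job is routed to a busy server, with $\mathbb P(\mathcal W)$ its probability in steady state. If $N$ satisfies $$\min\left\{\frac{1}{2k},\ \sum_{m=1}^M\theta_m,\ \frac{C(1-\xi)}{2\mu_1 C_M}\right\} N^{0.5-\alpha} \geq \log N \geq \max\left\{\log\frac{1}{\xi},\ \frac{2\mu_1}{1-\xi},\ \frac{4b}{w_l \zeta},\ \frac{C}{\mu_1},\ 2\right\},$$ then $$\mathbb P(\mathcal W)\leq \frac{1}{\sqrt{N}} + \frac{10\mu_{\max}+4}{N^{0.5-\alpha}\log N}.$$
   Context: System: $N$ identical servers, each able to hold at most $b$ jobs ($b\ge1$ finite), served FIFO; a job routed to a server already holding $b$ jobs is discarded. Poisson arrivals of rate $\lambda N$, $\lambda=1-N^{-\alpha}$, $0<\alpha<1/2$. Service times i.i.d. Coxian with $M$ phases: phase $m$ is exponential with rate $\mu_m>0$; after phase $m<M$ the job enters phase $m+1$ with probability $p_m\in[0,1)$, otherwise departs; after phase $M$ it departs. $v_m=\prod_{i=1}^{m-1}p_i/\mu_m$, normalized so $\sum_m v_m=1$; $\bar v=\min_m v_m$. State: $S_{i,m}(t)$ = fraction of servers with at least $i$ jobs whose job in service is in phase $m$; $S_i=\sum_m S_{i,m}$. The policy routes arrivals based on the current state, the resulting finite CTMC is irreducible, and $S$ denotes the stationary state. $A_1(s)$ = probability an arrival is routed to a busy server in state $s$; LB-zero = policies with $A_1(s)\le 1/\sqrt N$ whenever $s_1=\sum_m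 s_{1,m}\le 1-\frac1{N^\alpha\log N}$. Constants: for $2\le m\le M$, $a_m=\frac{\mu_m}{p_1\mu_1+\mu_m}$, $b_m=(1-a_m)(1+\sum_{r=m+1}^M\frac{v_r}{v_1})-\frac{a_mv_m}{v_1}$, $c_m = 5(1-a_m)\sum_{r=m+1}^M (r-1)v_r + 5a_m \sum_{r=2}^{m-1} \frac{\mu_r v_r}{\mu_m} + 5(m-2)a_m v_m + 5 - a_m$; $\xi=\sum_{m=2}^Mb_m\prod_{j=m+1}^Ma_j$ (asserted $0<\xi<1$), $C_M=\sum_{m=2}^Mc_m\prod_{j=m+1}^Ma_j$, $C=\sqrt{\frac{2\bar v^2\log(1/\xi)}{3M+(3M+4)\log(1/\xi)}}$, $\theta_m=\frac{6\mu_1v_m+5(m-1)v_m}{C}$. Departure rates: $w_m=(1-p_m)\mu_m$ for $m<M$ and $w_M=\mu_M$; $w_u=\max_m w_m$, $w_l=\min_m w_m$, $\mu_{\max}=\max_m\mu_m$, $\zeta=\frac{4w_ub}{w_l}\bigl[(\frac1{w_l}-\frac1{w_u})\sum_m\theta_mw_m+\frac1{w_l}+6\bigr]$, $k=\frac{\sum_m\theta_mw_m}{w_u}+(1+\frac{w_l}{4w_ub})\zeta-\sum_m\theta_m$. *)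

theory Defs
  imports Complex_Main
begin

text \<open>
  Aggregated state of the N-server system.  A state is a function
  x :: nat => nat => nat, where x q m (1 <= q <= b, 1 <= m <= M) is the number of
  servers holding exactly q jobs whose job in service is in phase m.  The number of
  idle servers is N minus the total.  The paper's S_{i,m} is (sum over q >= i of x q m)/N,
  a bijective image of x, so a policy depending on S is the same as one depending on x.
\<close>

type_synonym cstate = "nat \<Rightarrow> nat \<Rightarrow> nat"

definition busy :: "nat \<Rightarrow> nat \<Rightarrow> cstate \<Rightarrow> nat" where
  "busy b M x = (\<Sum>q\<in>{1..b}. \<Sum>m\<in>{1..M}. x q m)"

definition states :: "nat \<Rightarrow> nat \<Rightarrow> nat \<Rightarrow> cstate set" where
  "states N b M = {x. (\<forall>q m. x q m \<noteq> 0 \<longrightarrow> 1 \<le> q \<and> q \<le> b \<and> 1 \<le> m \<and> m \<le> M)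
                      \<and> busy b M x \<le> N}"

definition Sfrac :: "nat \<Rightarrow> nat \<Rightarrow> cstate \<Rightarrow> nat \<Rightarrow> nat \<Rightarrow> real" where
  "Sfrac N b x i m = (\<Sum>q\<in>{i..b}. real (x q m)) / real N"

definition S1 :: "nat \<Rightarrow> nat \<Rightarrow> nat \<Rightarrow> cstate \<Rightarrow> real" where
  "S1 N b M x = (\<Sum>m\<in>{1..M}. Sfrac N b x 1 m)"

definition inc :: "cstate \<Rightarrow> nat \<Rightarrow> nat \<Rightarrow> cstate" where
  "inc x q m = (\<lambda>i j. if i = q \<and> j = m then x i j + 1 else x i j)"

definition dec :: "cstate \<Rightarrow> nat \<Rightarrow> nat \<Rightarrow> cstate" where
  "dec x q m = (\<lambda>i j. if i = q \<and> j = m then x i j - 1 else x i j)"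

text \<open>
  Routing policy rho: rho x 0 0 = probability that an arrival in state x is routed to an
  idle server; rho x q m (1 <= q <= b, 1 <= m <= M) = probability that it is routed to a
  server with exactly q jobs whose job in service is in phase m.
\<close>
definition valid_policy ::
  "nat \<Rightarrow> nat \<Rightarrow> nat \<Rightarrow> (cstate \<Rightarrow> nat \<Rightarrow> nat \<Rightarrow> real) \<Rightarrow> bool" where
  "valid_policy N b M rho \<longleftrightarrow>
     (\<forall>x\<in>states N b M.
        (\<forall>q m. rho x q m \<ge> 0) \<and>
        (\<forall>q m. rho x q m \<noteq> 0 \<longrightarrow>
            (q = 0 \<and> m = 0 \<and> busy b M x < N) \<or>
            (1 \<le> q \<and> q \<le> b \<and> 1 \<le> m \<and> m \<le> M \<and> x q m > 0)) \<and>
        rho x 0 0 + (\<Sum>q\<in>{1..b}. \<Sum>m\<in>{1..M}. rho x q m) = 1)"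

definition A1 :: "nat \<Rightarrow> nat \<Rightarrow> (cstate \<Rightarrow> nat \<Rightarrow> nat \<Rightarrow> real) \<Rightarrow> cstate \<Rightarrow> real" where
  "A1 b M rho x = (\<Sum>q\<in>{1..b}. \<Sum>m\<in>{1..M}. rho x q m)"

definition LB_zero ::
  "nat \<Rightarrow> nat \<Rightarrow> nat \<Rightarrow> real \<Rightarrow> (cstate \<Rightarrow> nat \<Rightarrow> nat \<Rightarrow> real) \<Rightarrow> bool" where
  "LB_zero N b M \<alpha> rho \<longleftrightarrow>
     (\<forall>x\<in>states N b M. S1 N b M x \<le> 1 - 1 / (real N powr \<alpha> * ln (real N))
                        \<longrightarrow> A1 b M rho x \<le> 1 / sqrt (real N))"

definition wrate :: "nat \<Rightarrow> (nat \<Rightarrow> real) \<Rightarrow> (nat \<Rightarrow> real) \<Rightarrow> nat \<Rightarrow> real" where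
  "wrate M \<mu> p m = (if m < M then (1 - p m) * \<mu> m else \<mu> M)"

text \<open>
  Transition rate from x to y of the aggregated CTMC (arrival rate lam*N, Coxian service,
  FIFO, buffer b; an arrival routed to a server with b jobs is discarded, i.e. causes no
  state change).  A new job always starts in phase 1.
\<close>
definition rate ::
  "nat \<Rightarrow> nat \<Rightarrow> nat \<Rightarrow> (nat \<Rightarrow> real) \<Rightarrow> (nat \<Rightarrow> real) \<Rightarrow> real
   \<Rightarrow> (cstate \<Rightarrow> nat \<Rightarrow> nat \<Rightarrow> real) \<Rightarrow> cstate \<Rightarrow> cstate \<Rightarrow> real" where
  "rate N b M \<mu> p lam rho x y =
     (if y = inc x 1 1 then lam * real N * rho x 0 0 else 0)
   + (\<Sum>q\<in>{1..<b}. \<Sum>m\<in>{1..M}.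
        if y = inc (dec x q m) (q + 1) m then lam * real N * rho x q m else 0)
   + (\<Sum>q\<in>{1..b}. \<Sum>m\<in>{1..<M}.
        if y = inc (dec x q m) q (m + 1) then real (x q m) * \<mu> m * p m else 0)
   + (\<Sum>q\<in>{1..b}. \<Sum>m\<in>{1..M}.
        if y = (if q = 1 then dec x q m else inc (dec x q m) (q - 1) 1)
        then real (x q m) * wrate M \<mu> p m else 0)"

definition irreducible ::
  "nat \<Rightarrow> nat \<Rightarrow> nat \<Rightarrow> (nat \<Rightarrow> real) \<Rightarrow> (nat \<Rightarrow> real) \<Rightarrow> real
   \<Rightarrow> (cstate \<Rightarrow> nat \<Rightarrow> nat \<Rightarrow> real) \<Rightarrow> bool" where
  "irreducible N b M \<mu> p lam rho \<longleftrightarrow>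
     (\<forall>x\<in>states N b M. \<forall>y\<in>states N b M.
        (\<lambda>u v. u \<in> states N b M \<and> v \<in> states N b M \<and> u \<noteq> v
               \<and> rate N b M \<mu> p lam rho u v > 0)\<^sup>*\<^sup>* x y)"

definition stationary ::
  "nat \<Rightarrow> nat \<Rightarrow> nat \<Rightarrow> (nat \<Rightarrow> real) \<Rightarrow> (nat \<Rightarrow> real) \<Rightarrow> real
   \<Rightarrow> (cstate \<Rightarrow> nat \<Rightarrow> nat \<Rightarrow> real) \<Rightarrow> (cstate \<Rightarrow> real) \<Rightarrow> bool" where
  "stationary N b M \<mu> p lam rho \<pi> \<longleftrightarrow>
     (\<forall>x\<in>states N b M. \<pi> x \<ge> 0) \<and> (\<Sum>x\<in>states N b M. \<pi> x) = 1 \<and>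
     (\<forall>y\<in>states N b M.
        (\<Sum>x\<in>states N b M - {y}. \<pi> x * rate N b M \<mu> p lam rho x y)
        = \<pi> y * (\<Sum>z\<in>states N b M - {y}. rate N b M \<mu> p lam rho y z))"

definition vv :: "(nat \<Rightarrow> real) \<Rightarrow> (nat \<Rightarrow> real) \<Rightarrow> nat \<Rightarrow> real" where
  "vv \<mu> p m = (\<Prod>i\<in>{1..<m}. p i) / \<mu> m"

definition vbar :: "nat \<Rightarrow> (nat \<Rightarrow> real) \<Rightarrow> (nat \<Rightarrow> real) \<Rightarrow> real" where
  "vbar M \<mu> p = Min (vv \<mu> p ` {1..M})"

definition aa :: "(nat \<Rightarrow> real) \<Rightarrow> (nat \<Rightarrow> real) \<Rightarrow> nat \<Rightarrow> real" where
  "aa \<mu> p m = \<mu> m / (p 1 * \<mu> 1 + \<mu> m)"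

definition bb :: "nat \<Rightarrow> (nat \<Rightarrow> real) \<Rightarrow> (nat \<Rightarrow> real) \<Rightarrow> nat \<Rightarrow> real" where
  "bb M \<mu> p m = (1 - aa \<mu> p m) * (1 + (\<Sum>r\<in>{m+1..M}. vv \<mu> p r / vv \<mu> p 1))
                 - aa \<mu> p m * vv \<mu> p m / vv \<mu> p 1"

definition cc :: "nat \<Rightarrow> (nat \<Rightarrow> real) \<Rightarrow> (nat \<Rightarrow> real) \<Rightarrow> nat \<Rightarrow> real" where
  "cc M \<mu> p m = 5 * (1 - aa \<mu> p m) * (\<Sum>r\<in>{m+1..M}. (real r - 1) * vv \<mu> p r)
                + 5 * aa \<mu> p m * (\<Sum>r\<in>{2..m-1}. \<mu> r * vv \<mu> p r / \<mu> m)
                + 5 * (real m - 2) * aa \<mu> p m * vv \<mu> p m + 5 - aa \<mu> p m"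

definition xi :: "nat \<Rightarrow> (nat \<Rightarrow> real) \<Rightarrow> (nat \<Rightarrow> real) \<Rightarrow> real" where
  "xi M \<mu> p = (\<Sum>m\<in>{2..M}. bb M \<mu> p m * (\<Prod>j\<in>{m+1..M}. aa \<mu> p j))"

definition CM :: "nat \<Rightarrow> (nat \<Rightarrow> real) \<Rightarrow> (nat \<Rightarrow> real) \<Rightarrow> real" where
  "CM M \<mu> p = (\<Sum>m\<in>{2..M}. cc M \<mu> p m * (\<Prod>j\<in>{m+1..M}. aa \<mu> p j))"

definition Cc :: "nat \<Rightarrow> (nat \<Rightarrow> real) \<Rightarrow> (nat \<Rightarrow> real) \<Rightarrow> real" where
  "Cc M \<mu> p = sqrt (2 * (vbar M \<mu> p)\<^sup>2 * ln (1 / xi M \<mu> p)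
                   / (3 * real M + (3 * real M + 4) * ln (1 / xi M \<mu> p)))"

definition theta :: "nat \<Rightarrow> (nat \<Rightarrow> real) \<Rightarrow> (nat \<Rightarrow> real) \<Rightarrow> nat \<Rightarrow> real" where
  "theta M \<mu> p m = (6 * \<mu> 1 * vv \<mu> p m + 5 * (real m - 1) * vv \<mu> p m) / Cc M \<mu> p"

definition wu :: "nat \<Rightarrow> (nat \<Rightarrow> real) \<Rightarrow> (nat \<Rightarrow> real) \<Rightarrow> real" where
  "wu M \<mu> p = Max (wrate M \<mu> p ` {1..M})"

definition wl :: "nat \<Rightarrow> (nat \<Rightarrow> real) \<Rightarrow> (nat \<Rightarrow> real) \<Rightarrow> real" where
  "wl M \<mu> p = Min (wrate M \<mu> p ` {1..M})"

definition mumax :: "nat \<Rightarrow> (nat \<Rightarrow> real) \<Rightarrow> real" where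
  "mumax M \<mu> = Max (\<mu> ` {1..M})"

definition thw :: "nat \<Rightarrow> (nat \<Rightarrow> real) \<Rightarrow> (nat \<Rightarrow> real) \<Rightarrow> real" where
  "thw M \<mu> p = (\<Sum>m\<in>{1..M}. theta M \<mu> p m * wrate M \<mu> p m)"

definition zeta :: "nat \<Rightarrow> nat \<Rightarrow> (nat \<Rightarrow> real) \<Rightarrow> (nat \<Rightarrow> real) \<Rightarrow> real" where
  "zeta b M \<mu> p = 4 * wu M \<mu> p * real b / wl M \<mu> p *
     ((1 / wl M \<mu> p - 1 / wu M \<mu> p) * thw M \<mu> p + 1 / wl M \<mu> p + 6)"

definition kk :: "nat \<Rightarrow> nat \<Rightarrow> (nat \<Rightarrow> real) \<Rightarrow> (nat \<Rightarrow> real) \<Rightarrow> real" where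
  "kk b M \<mu> p = thw M \<mu> p / wu M \<mu> p
     + (1 + wl M \<mu> p / (4 * wu M \<mu> p * real b)) * zeta b M \<mu> p
     - (\<Sum>m\<in>{1..M}. theta M \<mu> p m)"

end

theory Submission
  imports Defs
begin

text \<open>
  Test functions of the state have zero mean drift in steady state; everything is obtained by
  choosing them well.  Put \<open>z\<^sub>m = S\<^bsub>1,m\<^esub>\<close>, \<open>\<ell>\<^sub>m = z\<^sub>m / v\<^sub>m\<close>.

  Phase lower bounds.  Exponential test functions \<open>exp (- \<beta> h)\<close> with \<open>h\<close> linear behave in steady state like
  the fluid limit: if the drift of \<open>h\<close> pulls it towards a convex combination of other functionals, then the
  level \<open>- ln E exp (- \<beta> h) / \<beta>\<close> of \<open>h\<close> is at least that combination of their levels, up to a noise term.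
  The functional \<open>\<ell>\<^sub>m\<close> is pulled towards \<open>\<ell>\<^bsub>m-1\<^esub>\<close>, and \<open>\<ell>\<^sub>1\<close> towards \<open>\<lambda>\<close> as long as some servers are idle.
  When almost all servers are busy, \<open>\<ell>\<^sub>1\<close> is bounded below algebraically by \<open>1 - z\<^sub>2 - \<dots> - z\<^sub>M\<close>, whose shortfall is
  at most \<open>\<xi>\<close> times the shortfall of the \<open>\<ell>\<^sub>m\<close>.  Since \<open>\<xi> < 1\<close> the resulting inequality for the level of \<open>\<ell>\<^sub>1\<close> is
  solved at once, without iterating, and Markov's inequality gives
  \<open>z\<^sub>m \<ge> \<lambda> v\<^sub>m - \<theta>\<^sub>m ln N / sqrt N\<close> outside an event of probability \<open>sqrt N exp (- 2 (ln N)\<^sup>2)\<close>.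

  Queue collapse.  Off this exceptional event the minimum of the queue excess and the deficit of busy servers has
  negative drift whenever it is positive, so it rarely exceeds \<open>ln N / sqrt N\<close>.

  Conclusion.  Outside these rare events the total number of jobs has drift at most \<open>- ln N / sqrt N\<close> when it exceeds
  \<open>\<lambda> + k ln N / sqrt N\<close>; a quadratic test function bounds the mean excess, and an arrival
  can meet a busy server with probability above \<open>1 / sqrt N\<close> only if this excess is of order \<open>N powr (- \<alpha>)\<close>.
\<close>

section \<open>Stationary expectations and drifts\<close>

definition lin :: "nat \<Rightarrow> nat \<Rightarrow> (nat \<Rightarrow> nat \<Rightarrow> real) \<Rightarrow> cstate \<Rightarrow> real" where
  "lin b M c x = (\<Sum>q\<in>{1..b}. \<Sum>m\<in>{1..M}. c q m * real (x q m))"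

text \<open>The increment \<open>d\<close> is real, so the truncated subtraction in
  \<open>dec\<close> is covered by \<open>d = -1\<close> once the cell is known to be
  nonempty.\<close>

lemma lin_update:
  assumes "q \<in> {1..b}" "m \<in> {1..M}"
    and "\<And>i j. (i, j) \<noteq> (q, m) \<Longrightarrow> y i j = x i j" and "real (y q m) = real (x q m) + d"
  shows "lin b M c y = lin b M c x + c q m * d"
proof -
  have "lin b M c y = (\<Sum>i\<in>{1..b}. \<Sum>j\<in>{1..M}. c i j * real (x i j) + (if i = q then if j = m then c q m * d else 0 else 0))"
    unfolding lin_def
  proof (intro sum.cong refl)
    fix i j
    show "c i j * real (y i j) = c i j * real (x i j) + (if i = q then if j = m then c q m * d else 0 else 0)"
      using assms(3)[of i j] assms(4) by (cases "(i, j) = (q, m)") (auto simp: algebra_simps)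
  qed
  also have "\<dots> = lin b M c x + (\<Sum>i\<in>{1..b}. if i = q then c q m * d else 0)"
    unfolding lin_def sum.distrib[symmetric]
    using assms(2) by (intro sum.cong refl) (auto simp: sum.distrib sum.delta)
  finally show ?thesis using assms(1) by simp
qed

lemma lin_inc:
  "q \<in> {1..b} \<Longrightarrow> m \<in> {1..M} \<Longrightarrow> lin b M c (inc x q m) = lin b M c x + c q m"
  using lin_update[where x = x and y = "inc x q m" and d = 1] by (auto simp: inc_def)

lemma lin_dec:
  "q \<in> {1..b} \<Longrightarrow> m \<in> {1..M} \<Longrightarrow> x q m > 0 \<Longrightarrow> lin b M c (dec x q m) = lin b M c x - c q m"
  using lin_update[of q b m M "dec x q m" x "-1" c] by (simp add: dec_def) (metis (no_types, lifting) One_nat_def)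

lemma busy_lin: "real (busy b M x) = lin b M (\<lambda>_ _. 1) x"
  by (simp add: busy_def lin_def)

lemma lin_nonneg: "(\<And>q m. q \<in> {1..b} \<Longrightarrow> m \<in> {1..M} \<Longrightarrow> 0 \<le> c q m) \<Longrightarrow> 0 \<le> lin b M c x"
  unfolding lin_def by (intro sum_nonneg mult_nonneg_nonneg) auto

lemma lin_mono:
  "(\<And>q m. q \<in> {1..b} \<Longrightarrow> m \<in> {1..M} \<Longrightarrow> c q m \<le> d q m) \<Longrightarrow> lin b M c x \<le> lin b M d x"
  unfolding lin_def by (intro sum_mono mult_right_mono) auto

lemma lin_scale: "a * lin b M c x = lin b M (\<lambda>q m. a * c q m) x"
  by (simp add: lin_def sum_distrib_left algebra_simps)

section \<open>The stationary chain, its transitions and its generator\<close>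

locale lb_chain =
  fixes N b M :: nat and lam :: real and \<mu> p :: "nat \<Rightarrow> real"
    and rho :: "cstate \<Rightarrow> nat \<Rightarrow> nat \<Rightarrow> real" and \<pi> :: "cstate \<Rightarrow> real"
  assumes b_pos: "1 \<le> b" and M_pos: "1 \<le> M" and N_pos: "0 < N"
    and mu_pos: "m \<in> {1..M} \<Longrightarrow> 0 < \<mu> m"
    and p_range: "m \<in> {1..<M} \<Longrightarrow> 0 \<le> p m \<and> p m < 1"
    and lam: "0 \<le> lam" "lam \<le> 1"
    and policy: "valid_policy N b M rho"
    and stat: "stationary N b M \<mu> p lam rho \<pi>"
begin

abbreviation "\<Omega> \<equiv> states N b M"
abbreviation "w \<equiv> wrate M \<mu> p"

lemma w_pos: "m \<in> {1..M} \<Longrightarrow> 0 < w m"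
  using mu_pos[of m] p_range[of m] by (auto simp: wrate_def)

definition expect :: "(cstate \<Rightarrow> real) \<Rightarrow> real" where
  "expect f = (\<Sum>x\<in>\<Omega>. \<pi> x * f x)"

lemma pi_nonneg: "x \<in> \<Omega> \<Longrightarrow> 0 \<le> \<pi> x"
  using stat by (auto simp: stationary_def)

lemma pi_sum: "sum \<pi> \<Omega> = 1"
  using stat by (auto simp: stationary_def)

text \<open>A sum over an infinite set is 0 by convention, so total mass 1 forces the state space to
  be finite.\<close>

lemma fin: "finite \<Omega>"
  using pi_sum by (metis sum.infinite zero_neq_one)

lemma expect_const: "expect (\<lambda>_. c) = c"
  by (simp add: expect_def sum_distrib_right[symmetric] pi_sum)

lemma expect_add: "expect (\<lambda>x. f x + g x) = expect f + expect g"
  by (simp add: expect_def sum.distrib algebra_simps)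

lemma expect_diff: "expect (\<lambda>x. f x - g x) = expect f - expect g"
  by (simp add: expect_def sum_subtractf algebra_simps)

lemma expect_cmult: "expect (\<lambda>x. c * f x) = c * expect f"
  by (simp add: expect_def sum_distrib_left algebra_simps)

lemma expect_sum: "expect (\<lambda>x. \<Sum>i\<in>I. f i x) = (\<Sum>i\<in>I. expect (f i))"
  unfolding expect_def by (subst sum.swap) (simp add: sum_distrib_left)

lemma expect_mono: "(\<And>x. x \<in> \<Omega> \<Longrightarrow> f x \<le> g x) \<Longrightarrow> expect f \<le> expect g"
  unfolding expect_def by (intro sum_mono mult_left_mono pi_nonneg)

lemma expect_nonneg: "(\<And>x. x \<in> \<Omega> \<Longrightarrow> 0 \<le> f x) \<Longrightarrow> 0 \<le> expect f"
  using expect_mono[of "\<lambda>_. 0" f] by (simp add: expect_const)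

definition arr :: "cstate \<Rightarrow> nat \<Rightarrow> nat \<Rightarrow> cstate" where
  "arr x q m = inc (dec x q m) (q + 1) m"

definition adv :: "cstate \<Rightarrow> nat \<Rightarrow> nat \<Rightarrow> cstate" where
  "adv x q m = inc (dec x q m) q (m + 1)"

definition dep :: "cstate \<Rightarrow> nat \<Rightarrow> nat \<Rightarrow> cstate" where
  "dep x q m = (if q = 1 then dec x q m else inc (dec x q m) (q - 1) 1)"

text \<open>The generator of the chain, summed over events instead of target states. The arrival sum
  stops below \<open>b\<close>: a job sent to a full server is discarded and changes nothing. The
  target of an event of rate 0 may be meaningless, but is multiplied by 0.\<close>

definition gen :: "(cstate \<Rightarrow> real) \<Rightarrow> cstate \<Rightarrow> real" where
  "gen F x =
     lam * real N * rho x 0 0 * (F (inc x 1 1) - F x)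
   + (\<Sum>q\<in>{1..<b}. \<Sum>m\<in>{1..M}. lam * real N * rho x q m * (F (arr x q m) - F x))
   + (\<Sum>q\<in>{1..b}. \<Sum>m\<in>{1..<M}. real (x q m) * \<mu> m * p m * (F (adv x q m) - F x))
   + (\<Sum>q\<in>{1..b}. \<Sum>m\<in>{1..M}. real (x q m) * w m * (F (dep x q m) - F x))"

lemma rho_nonneg: "x \<in> \<Omega> \<Longrightarrow> 0 \<le> rho x q m"
  using policy by (auto simp: valid_policy_def)

lemma rho_supp:
  "x \<in> \<Omega> \<Longrightarrow> rho x q m \<noteq> 0 \<Longrightarrow>
    (q = 0 \<and> m = 0 \<and> busy b M x < N) \<or> (1 \<le> q \<and> q \<le> b \<and> 1 \<le> m \<and> m \<le> M \<and> x q m > 0)"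
  using policy unfolding valid_policy_def by blast

lemma rho_00: "x \<in> \<Omega> \<Longrightarrow> rho x 0 0 = 1 - A1 b M rho x"
  using policy by (auto simp: valid_policy_def A1_def)

lemma A1_nonneg: "x \<in> \<Omega> \<Longrightarrow> 0 \<le> A1 b M rho x"
  unfolding A1_def by (intro sum_nonneg rho_nonneg)

lemma A1_le_1: "x \<in> \<Omega> \<Longrightarrow> A1 b M rho x \<le> 1"
  using rho_00[of x] rho_nonneg[of x 0 0] by simp

lemma statesI:
  assumes "\<And>i j. y i j \<noteq> 0 \<Longrightarrow> 1 \<le> i \<and> i \<le> b \<and> 1 \<le> j \<and> j \<le> M" and "lin b M (\<lambda>_ _. 1) y \<le> real N"
  shows "y \<in> \<Omega>"
proof -
  have "busy b M y \<le> N" using assms(2) busy_lin[of b M y] by linarith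
  then show ?thesis using assms(1) unfolding states_def by blast
qed

lemma states_supp: "x \<in> \<Omega> \<Longrightarrow> x i j \<noteq> 0 \<Longrightarrow> 1 \<le> i \<and> i \<le> b \<and> 1 \<le> j \<and> j \<le> M"
  by (auto simp: states_def)

lemma states_lin: "x \<in> \<Omega> \<Longrightarrow> lin b M (\<lambda>_ _. 1) x \<le> real N"
  unfolding busy_lin[symmetric] by (auto simp: states_def)

lemma arr0_in: assumes "x \<in> \<Omega>" "rho x 0 0 \<noteq> 0" shows "inc x 1 1 \<in> \<Omega>"
proof (rule statesI)
  fix i j assume "inc x 1 1 i j \<noteq> 0"
  then show "1 \<le> i \<and> i \<le> b \<and> 1 \<le> j \<and> j \<le> M"
    using states_supp[OF assms(1), of i j] b_pos M_pos by (auto simp: inc_def split: if_splits)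
next
  have "busy b M x < N" using rho_supp[OF assms] by auto
  then show "lin b M (\<lambda>_ _. 1) (inc x 1 1) \<le> real N"
    using b_pos M_pos by (subst lin_inc) (auto simp: busy_lin[symmetric])
qed

lemma move_lin:
  assumes "q \<in> {1..b}" "m \<in> {1..M}" "q' \<in> {1..b}" "m' \<in> {1..M}" "x q m > 0"
  shows "lin b M c (inc (dec x q m) q' m') = lin b M c x - c q m + c q' m'"
  using assms by (simp only: lin_inc lin_dec)

lemma move_in:
  assumes "x \<in> \<Omega>" "q \<in> {1..b}" "m \<in> {1..M}" "q' \<in> {1..b}" "m' \<in> {1..M}" "x q m > 0"
  shows "inc (dec x q m) q' m' \<in> \<Omega>"
proof (rule statesI)
  fix i j assume "inc (dec x q m) q' m' i j \<noteq> 0"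
  then show "1 \<le> i \<and> i \<le> b \<and> 1 \<le> j \<and> j \<le> M"
    using states_supp[OF assms(1), of i j] assms by (auto simp: inc_def dec_def split: if_splits)
next
  show "lin b M (\<lambda>_ _. 1) (inc (dec x q m) q' m') \<le> real N"
    using states_lin[OF assms(1)] assms by (simp only: move_lin)
qed

lemma dec_in:
  assumes "x \<in> \<Omega>" "q \<in> {1..b}" "m \<in> {1..M}" "x q m > 0"
  shows "dec x q m \<in> \<Omega>"
proof (rule statesI)
  fix i j assume "dec x q m i j \<noteq> 0"
  then show "1 \<le> i \<and> i \<le> b \<and> 1 \<le> j \<and> j \<le> M"
    using states_supp[OF assms(1), of i j] by (auto simp: dec_def split: if_splits)
next
  show "lin b M (\<lambda>_ _. 1) (dec x q m) \<le> real N"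
    using states_lin[OF assms(1)] lin_dec[of q b m M x "\<lambda>_ _. 1"] assms by simp
qed

lemma arr_in: "x \<in> \<Omega> \<Longrightarrow> q \<in> {1..<b} \<Longrightarrow> m \<in> {1..M} \<Longrightarrow> x q m > 0 \<Longrightarrow> arr x q m \<in> \<Omega>"
  unfolding arr_def by (rule move_in) auto

lemma adv_in: "x \<in> \<Omega> \<Longrightarrow> q \<in> {1..b} \<Longrightarrow> m \<in> {1..<M} \<Longrightarrow> x q m > 0 \<Longrightarrow> adv x q m \<in> \<Omega>"
  unfolding adv_def by (rule move_in) auto

lemma dep_in: "x \<in> \<Omega> \<Longrightarrow> q \<in> {1..b} \<Longrightarrow> m \<in> {1..M} \<Longrightarrow> x q m > 0 \<Longrightarrow> dep x q m \<in> \<Omega>"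
proof (cases "q = 1")
  case False
  moreover assume "x \<in> \<Omega>" "q \<in> {1..b}" "m \<in> {1..M}" "x q m > 0"
  moreover from this False have "q - 1 \<in> {1..b}" "1 \<in> {1..M}" using M_pos by auto
  ultimately show ?thesis unfolding dep_def using move_in by simp
qed (simp add: dep_def dec_in)

text \<open>\<open>rate\<close> is a sum of indicators of the target. Every event of nonzero rate
  leads back into \<open>\<Omega>\<close>, so summing its indicator over \<open>\<Omega>\<close>
  picks out exactly that target.\<close>

lemma rate_sum:
  assumes x: "x \<in> \<Omega>"
  shows "(\<Sum>y\<in>\<Omega>. rate N b M \<mu> p lam rho x y * g y) =
     lam * real N * rho x 0 0 * g (inc x 1 1)
   + (\<Sum>q\<in>{1..<b}. \<Sum>m\<in>{1..M}. lam * real N * rho x q m * g (arr x q m))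
   + (\<Sum>q\<in>{1..b}. \<Sum>m\<in>{1..<M}. real (x q m) * \<mu> m * p m * g (adv x q m))
   + (\<Sum>q\<in>{1..b}. \<Sum>m\<in>{1..M}. real (x q m) * w m * g (dep x q m))"
proof -
  have delta: "(\<Sum>y\<in>\<Omega>. (if y = t then c else 0) * g y) = c * g t" if "c \<noteq> 0 \<Longrightarrow> t \<in> \<Omega>" for t c
  proof (cases "c = 0")
    case False
    have "(\<Sum>y\<in>\<Omega>. (if y = t then c else 0) * g y) = (\<Sum>y\<in>\<Omega>. if y = t then c * g t else 0)"
      by (intro sum.cong) auto
    also have "\<dots> = c * g t" using that[OF False] fin by simp
    finally show ?thesis .
  qed (auto intro!: sum.neutral)
  have delta2: "(\<Sum>y\<in>\<Omega>. (\<Sum>q\<in>A. \<Sum>m\<in>B. if y = t q m then c q m else 0) * g y)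
      = (\<Sum>q\<in>A. \<Sum>m\<in>B. c q m * g (t q m))"
    if "\<And>q m. q \<in> A \<Longrightarrow> m \<in> B \<Longrightarrow> c q m \<noteq> 0 \<Longrightarrow> t q m \<in> \<Omega>" for A B :: "nat set" and t c
  proof -
    have "(\<Sum>y\<in>\<Omega>. (\<Sum>q\<in>A. \<Sum>m\<in>B. if y = t q m then c q m else 0) * g y)
        = (\<Sum>y\<in>\<Omega>. \<Sum>q\<in>A. \<Sum>m\<in>B. (if y = t q m then c q m else 0) * g y)"
      by (simp only: sum_distrib_right)
    also have "\<dots> = (\<Sum>q\<in>A. \<Sum>y\<in>\<Omega>. \<Sum>m\<in>B. (if y = t q m then c q m else 0) * g y)"
      by (rule sum.swap)
    also have "\<dots> = (\<Sum>q\<in>A. \<Sum>m\<in>B. \<Sum>y\<in>\<Omega>. (if y = t q m then c q m else 0) * g y)"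
      by (intro sum.cong refl sum.swap)
    also have "\<dots> = (\<Sum>q\<in>A. \<Sum>m\<in>B. c q m * g (t q m))"
      by (intro sum.cong refl delta that) auto
    finally show ?thesis .
  qed
  show ?thesis
    unfolding rate_def distrib_right sum.distrib
    unfolding arr_def[symmetric] adv_def[symmetric] dep_def[symmetric]
    apply (subst delta)
    subgoal using arr0_in[OF x] by auto
    apply (subst delta2)
    subgoal for q m using arr_in[OF x, of q m] rho_supp[OF x, of q m] by auto
    apply (subst delta2)
    subgoal for q m using adv_in[OF x, of q m] by (cases "x q m") auto
    apply (subst delta2)
    subgoal for q m using dep_in[OF x, of q m] by (cases "x q m") auto
    apply (rule refl)
    done
qed

text \<open>Global balance makes the inflow and outflow sums of \<open>F\<close> coincide once the
  order of summation is exchanged. All later estimates are bounds on \<open>gen F\<close> integrated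
  against \<open>\<pi>\<close>.\<close>

lemma expect_gen: "expect (gen F) = 0"
proof -
  let ?r = "rate N b M \<mu> p lam rho"
  have gen: "gen F x = (\<Sum>y\<in>\<Omega>. ?r x y * (F y - F x))" if "x \<in> \<Omega>" for x
    unfolding gen_def rate_sum[OF that, of "\<lambda>y. F y - F x"] ..
  \<comment> \<open>\<open>stationary\<close> leaves out the diagonal on both sides; adding
    \<open>\<pi> y\<close> times the diagonal rate to both restores the full sums.\<close>
  have bal: "(\<Sum>x\<in>\<Omega>. \<pi> x * ?r x y) = \<pi> y * (\<Sum>z\<in>\<Omega>. ?r y z)" if y: "y \<in> \<Omega>" for y
    using stat y fin unfolding stationary_def
    by (simp add: sum.remove[OF fin y] algebra_simps)
  have "expect (gen F) = (\<Sum>x\<in>\<Omega>. \<Sum>y\<in>\<Omega>. \<pi> x * ?r x y * F y) - (\<Sum>x\<in>\<Omega>. \<Sum>y\<in>\<Omega>. \<pi> x * ?r x y * F x)"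
    unfolding expect_def by (simp add: gen sum_distrib_left sum_subtractf algebra_simps)
  also have "(\<Sum>x\<in>\<Omega>. \<Sum>y\<in>\<Omega>. \<pi> x * ?r x y * F y) = (\<Sum>y\<in>\<Omega>. (\<Sum>x\<in>\<Omega>. \<pi> x * ?r x y) * F y)"
    by (subst sum.swap) (simp add: sum_distrib_right)
  also have "\<dots> = (\<Sum>y\<in>\<Omega>. \<pi> y * (\<Sum>z\<in>\<Omega>. ?r y z) * F y)"
    by (intro sum.cong) (auto simp: bal)
  also have "\<dots> = (\<Sum>x\<in>\<Omega>. \<Sum>y\<in>\<Omega>. \<pi> x * ?r x y * F x)"
    by (simp add: sum_distrib_left sum_distrib_right algebra_simps)
  finally show ?thesis by simp
qed

text \<open>Each event shifts a linear functional by a fixed amount, so only shifted arguments of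
  \<open>\<phi>\<close> occur. The shift is wrong for an empty cell, where \<open>dec\<close>
  truncates, but then the rate is 0; hence the case splits on the rate factors.\<close>

lemma gen_lin:
  assumes x: "x \<in> \<Omega>"
  shows "gen (\<lambda>x. \<phi> (lin b M c x)) x =
     lam * real N * rho x 0 0 * (\<phi> (lin b M c x + c 1 1) - \<phi> (lin b M c x))
   + (\<Sum>q\<in>{1..<b}. \<Sum>m\<in>{1..M}. lam * real N * rho x q m * (\<phi> (lin b M c x - c q m + c (q + 1) m) - \<phi> (lin b M c x)))
   + (\<Sum>q\<in>{1..b}. \<Sum>m\<in>{1..<M}. real (x q m) * \<mu> m * p m * (\<phi> (lin b M c x - c q m + c q (m + 1)) - \<phi> (lin b M c x)))
   + (\<Sum>q\<in>{1..b}. \<Sum>m\<in>{1..M}. real (x q m) * w m * (\<phi> (lin b M c x - c q m + (if q = 1 then 0 else c (q - 1) 1)) - \<phi> (lin b M c x)))"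
proof -
  have 1: "lin b M c (inc x 1 1) = lin b M c x + c 1 1"
    using b_pos M_pos by (intro lin_inc) auto
  have 2: "lam * real N * rho x q m * (\<phi> (lin b M c (arr x q m)) - \<phi> (lin b M c x)) =
     lam * real N * rho x q m * (\<phi> (lin b M c x - c q m + c (q + 1) m) - \<phi> (lin b M c x))"
    if "q \<in> {1..<b}" "m \<in> {1..M}" for q m
  proof (cases "rho x q m = 0")
    case False
    then have "lin b M c (arr x q m) = lin b M c x - c q m + c (q + 1) m"
      unfolding arr_def using that rho_supp[OF x False] by (intro move_lin) auto
    then show ?thesis by simp
  qed simp
  have 3: "real (x q m) * \<mu> m * p m * (\<phi> (lin b M c (adv x q m)) - \<phi> (lin b M c x)) =
     real (x q m) * \<mu> m * p m * (\<phi> (lin b M c x - c q m + c q (m + 1)) - \<phi> (lin b M c x))"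
    if "q \<in> {1..b}" "m \<in> {1..<M}" for q m
  proof (cases "x q m = 0")
    case False
    then have "lin b M c (adv x q m) = lin b M c x - c q m + c q (m + 1)"
      unfolding adv_def using that by (intro move_lin) auto
    then show ?thesis by simp
  qed simp
  have 4: "real (x q m) * w m * (\<phi> (lin b M c (dep x q m)) - \<phi> (lin b M c x)) =
     real (x q m) * w m * (\<phi> (lin b M c x - c q m + (if q = 1 then 0 else c (q - 1) 1)) - \<phi> (lin b M c x))"
    if "q \<in> {1..b}" "m \<in> {1..M}" for q m
  proof (cases "x q m = 0")
    case False
    show ?thesis
    proof (cases "q = 1")
      case True
      then show ?thesis using that False lin_dec[of q b m M x c] by (simp add: dep_def)
    next
      case q: False
      then have "lin b M c (dep x q m) = lin b M c x - c q m + c (q - 1) 1"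
      proof -
        have "q - 1 \<in> {1..b}" "1 \<in> {1..M}" using that q M_pos by auto
        then show ?thesis
          unfolding dep_def using that False q move_lin[of q m "q - 1" 1 x c] by simp
      qed
      then show ?thesis using q by simp
    qed
  qed simp
  show ?thesis
    unfolding gen_def 1
    by (intro arg_cong2[where f = "(+)"] refl sum.cong) (use 2 3 4 in blast)+
qed

end

section \<open>Exponential test functions\<close>

lemma exp_tangent: "exp a * (y - a) \<le> exp y - exp (a::real)"
proof -
  have "exp a * (1 + (y - a)) \<le> exp a * exp (y - a)"
    by (intro mult_left_mono exp_ge_add_one_self) auto
  then show ?thesis by (simp add: exp_add[symmetric] algebra_simps)
qed

text \<open>From \<open>(1 - s + s^2) * (1 + s) = 1 + s^3\<close> and
  \<open>1 + s \<le> exp s\<close>.\<close>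

lemma exp_minus_bound: "0 \<le> s \<Longrightarrow> exp (- s) \<le> 1 - s + s\<^sup>2" for s :: real
proof -
  assume s: "0 \<le> s"
  have "1 \<le> (1 - s + s\<^sup>2) * (1 + s)" using s by (simp add: algebra_simps power2_eq_square)
  also have "\<dots> \<le> (1 - s + s\<^sup>2) * exp s"
  proof (intro mult_left_mono exp_ge_add_one_self)
    have "0 \<le> (1 - s)\<^sup>2" by simp
    then show "0 \<le> 1 - s + s\<^sup>2" using s by (simp add: power2_eq_square algebra_simps)
  qed
  finally show ?thesis by (simp add: exp_minus field_simps)
qed

context lb_chain begin

text \<open>The form in which drift bounds are used: the mean of the left side vanishes and the
  positive factor is divided out.\<close>

lemma expect_gen_le:
  assumes "0 < c" and le: "\<And>x. x \<in> \<Omega> \<Longrightarrow> gen F x \<le> c * g x"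
  shows "0 \<le> expect g"
proof -
  have "expect (gen F) \<le> expect (\<lambda>x. c * g x)" using le by (rule expect_mono)
  then have "0 \<le> c * expect g" unfolding expect_gen expect_cmult .
  then show ?thesis using assms(1) by (simp add: zero_le_mult_iff)
qed

definition Z :: "nat \<Rightarrow> cstate \<Rightarrow> real" where
  "Z m x = (\<Sum>q\<in>{1..b}. real (x q m))"

lemma Z_nonneg: "0 \<le> Z m x"
  unfolding Z_def by (intro sum_nonneg) auto

lemma lin_Z: "lin b M (\<lambda>_. \<kappa>) x = (\<Sum>m\<in>{1..M}. \<kappa> m * Z m x)"
  unfolding lin_def Z_def by (subst sum.swap) (simp add: sum_distrib_left)

lemma Z_sum_le: assumes "x \<in> \<Omega>" shows "(\<Sum>m\<in>{1..M}. Z m x) \<le> real N"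
  using states_lin[OF assms] lin_Z[of "\<lambda>_. 1" x] by simp

text \<open>A jump of the exponent multiplies the exponential by a constant, so it factors out.
  Weights independent of \<open>q\<close> ignore arrivals at busy servers. A departure from a server
  with one job leaves it idle; otherwise the next job enters phase 1, hence the split of
  \<open>Z m\<close> at \<open>x 1 m\<close>.\<close>

lemma gen_exp:
  assumes x: "x \<in> \<Omega>"
  shows "gen (\<lambda>x. exp (lin b M (\<lambda>_. \<kappa>) x)) x = exp (lin b M (\<lambda>_. \<kappa>) x) *
     (lam * real N * rho x 0 0 * (exp (\<kappa> 1) - 1)
    + (\<Sum>m\<in>{1..<M}. \<mu> m * p m * Z m x * (exp (\<kappa> (m + 1) - \<kappa> m) - 1))
    + (\<Sum>m\<in>{1..M}. w m * (real (x 1 m) * (exp (- \<kappa> m) - 1) + (Z m x - real (x 1 m)) * (exp (\<kappa> 1 - \<kappa> m) - 1))))"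
proof -
  let ?L = "lin b M (\<lambda>_. \<kappa>) x"
  have e: "exp (?L - u + u') - exp ?L = exp ?L * (exp (u' - u) - 1)" for u u'
    by (simp add: exp_add exp_diff algebra_simps)
  have e0: "exp (?L + u) - exp ?L = exp ?L * (exp u - 1)" for u
    by (simp add: exp_add algebra_simps)
  have 2: "(\<Sum>q\<in>{1..b}. \<Sum>m\<in>{1..<M}. real (x q m) * \<mu> m * p m * (exp (?L - \<kappa> m + \<kappa> (m + 1)) - exp ?L))
    = exp ?L * (\<Sum>m\<in>{1..<M}. \<mu> m * p m * Z m x * (exp (\<kappa> (m + 1) - \<kappa> m) - 1))"
    unfolding e Z_def by (subst sum.swap) (simp add: sum_distrib_left sum_distrib_right ac_simps)
  have 3: "(\<Sum>q\<in>{1..b}. real (x q m) * w m * (exp (?L - \<kappa> m + (if q = 1 then 0 else \<kappa> 1)) - exp ?L))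
    = exp ?L * (w m * (real (x 1 m) * (exp (- \<kappa> m) - 1) + (Z m x - real (x 1 m)) * (exp (\<kappa> 1 - \<kappa> m) - 1)))"
    for m
  proof -
    have s: "{1..b} = insert 1 {2..b}" using b_pos by auto
    have Zs: "Z m x - real (x 1 m) = (\<Sum>q\<in>{2..b}. real (x q m))"
      unfolding Z_def s by simp
    have "(\<Sum>q\<in>{1..b}. real (x q m) * w m * (exp (?L - \<kappa> m + (if q = 1 then 0 else \<kappa> 1)) - exp ?L))
      = real (x 1 m) * w m * (exp ?L * (exp (- \<kappa> m) - 1)) + (\<Sum>q\<in>{2..b}. real (x q m) * w m * (exp ?L * (exp (\<kappa> 1 - \<kappa> m) - 1)))"
      unfolding s e by (simp add: e)
    then show ?thesis unfolding Zs by (simp add: sum_distrib_left sum_distrib_right algebra_simps)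
  qed
  have 4: "(\<Sum>q\<in>{1..b}. \<Sum>m\<in>{1..M}. real (x q m) * w m * (exp (?L - \<kappa> m + (if q = 1 then 0 else \<kappa> 1)) - exp ?L))
    = exp ?L * (\<Sum>m\<in>{1..M}. w m * (real (x 1 m) * (exp (- \<kappa> m) - 1) + (Z m x - real (x 1 m)) * (exp (\<kappa> 1 - \<kappa> m) - 1)))"
    by (subst sum.swap) (simp only: 3 sum_distrib_left)
  show ?thesis
    unfolding gen_lin[OF x] 2 4 e0 by (simp add: distrib_left)
qed

lemma w_split:
  "m \<in> {1..M} \<Longrightarrow> w m + (if m < M then \<mu> m * p m else 0) = \<mu> m"
  by (auto simp: wrate_def algebra_simps)

text \<open>A phase beyond the first is fed only by its predecessor, and is left at total rate
  \<open>\<mu> m\<close>, by departure or by advance (\<open>w_split\<close>).\<close>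

lemma gen_exp_Z:
  assumes x: "x \<in> \<Omega>" and m: "m \<in> {2..M}"
  shows "gen (\<lambda>x. exp (- (s * Z m x))) x = exp (- (s * Z m x)) *
     (p (m - 1) * \<mu> (m - 1) * Z (m - 1) x * (exp (- s) - 1) + \<mu> m * Z m x * (exp s - 1))"
proof -
  let ?k = "\<lambda>r. if r = m then - s else 0"
  have l: "lin b M (\<lambda>_. ?k) x = - (s * Z m x)" for x
    unfolding lin_Z using m by (simp add: if_distrib[of "\<lambda>u. u * _"] cong: if_cong)
  have a: "(\<Sum>r\<in>{1..<M}. \<mu> r * p r * Z r x * (exp (?k (r + 1) - ?k r) - 1))
      = (\<Sum>r\<in>{1..<M}. (if r = m - 1 then p (m - 1) * \<mu> (m - 1) * Z (m - 1) x * (exp (- s) - 1) else 0)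
          + (if r = m then \<mu> m * p m * Z m x * (exp s - 1) else 0))"
    using m by (intro sum.cong) (auto simp: algebra_simps)
  have d: "(\<Sum>r\<in>{1..M}. w r * (real (x 1 r) * (exp (- ?k r) - 1) + (Z r x - real (x 1 r)) * (exp (?k 1 - ?k r) - 1)))
      = (\<Sum>r\<in>{1..M}. if r = m then w m * Z m x * (exp s - 1) else 0)"
    using m by (intro sum.cong) (auto simp: algebra_simps)
  have wm: "w m * Z m x * (exp s - 1) + (if m < M then \<mu> m * p m * Z m x * (exp s - 1) else 0) = \<mu> m * Z m x * (exp s - 1)"
    using arg_cong[OF w_split[of m], of "\<lambda>u. u * (Z m x * (exp s - 1))"] m
    by (auto simp: distrib_right mult.assoc)
  show ?thesis
    using gen_exp[OF x, of ?k] m unfolding l a d sum.distrib wm[symmetric] distrib_right[of "\<mu> m * Z m x"]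
    by (auto simp: sum.delta algebra_simps split: if_splits)
qed

definition T :: "nat \<Rightarrow> cstate \<Rightarrow> real" where
  "T m x = (\<Sum>r\<in>{2..m}. Z r x)"

text \<open>Moves inside phases \<open>2..m\<close> cancel. The block is entered only from phase 1;
  it is left from phase \<open>m\<close> at full rate and from earlier phases only by
  departure.\<close>

lemma gen_exp_T:
  assumes x: "x \<in> \<Omega>" and m: "m \<in> {2..M}"
  shows "gen (\<lambda>x. exp (s * T m x)) x = exp (s * T m x) *
     (p 1 * \<mu> 1 * Z 1 x * (exp s - 1)
      + (\<mu> m * Z m x + (\<Sum>r\<in>{2..m-1}. w r * Z r x)) * (exp (- s) - 1))"
proof -
  let ?k = "\<lambda>r. if 2 \<le> r \<and> r \<le> m then s else 0"
  have l: "lin b M (\<lambda>_. ?k) x = s * T m x" for x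
  proof -
    have "lin b M (\<lambda>_. ?k) x = (\<Sum>r\<in>{1..M}. if r \<in> {2..m} then s * Z r x else 0)"
      unfolding lin_Z by (intro sum.cong) auto
    also have "\<dots> = (\<Sum>r\<in>{1..M} \<inter> {2..m}. s * Z r x)" by (rule sum.inter_restrict[symmetric]) simp
    also have "{1..M} \<inter> {2..m} = {2..m}" using m by auto
    finally show ?thesis by (simp add: T_def sum_distrib_left)
  qed
  have a: "(\<Sum>r\<in>{1..<M}. \<mu> r * p r * Z r x * (exp (?k (r + 1) - ?k r) - 1))
      = (\<Sum>r\<in>{1..<M}. (if r = 1 then p 1 * \<mu> 1 * Z 1 x * (exp s - 1) else 0)
          + (if r = m then \<mu> m * p m * Z m x * (exp (- s) - 1) else 0))"
    using m by (intro sum.cong) (auto simp: algebra_simps)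
  have "(\<Sum>r\<in>{1..M}. w r * (real (x 1 r) * (exp (- ?k r) - 1) + (Z r x - real (x 1 r)) * (exp (?k 1 - ?k r) - 1)))
      = (\<Sum>r\<in>{1..M}. if r \<in> {2..m} then w r * Z r x * (exp (- s) - 1) else 0)"
    using m by (intro sum.cong) (auto simp: algebra_simps)
  also have "\<dots> = (\<Sum>r\<in>{1..M} \<inter> {2..m}. w r * Z r x * (exp (- s) - 1))"
    by (rule sum.inter_restrict[symmetric]) simp
  also have "{1..M} \<inter> {2..m} = insert m {2..m-1}" using m by auto
  also have "(\<Sum>r\<in>insert m {2..m-1}. w r * Z r x * (exp (- s) - 1)) =
      w m * Z m x * (exp (- s) - 1) + (\<Sum>r\<in>{2..m-1}. w r * Z r x) * (exp (- s) - 1)"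
    using m by (subst sum.insert) (auto simp: sum_distrib_right)
  finally have d: "(\<Sum>r\<in>{1..M}. w r * (real (x 1 r) * (exp (- ?k r) - 1) + (Z r x - real (x 1 r)) * (exp (?k 1 - ?k r) - 1)))
     = w m * Z m x * (exp (- s) - 1) + (\<Sum>r\<in>{2..m-1}. w r * Z r x) * (exp (- s) - 1)" .
  have wm: "w m * Z m x * (exp (- s) - 1) + (if m < M then \<mu> m * p m * Z m x * (exp (- s) - 1) else 0) = \<mu> m * Z m x * (exp (- s) - 1)"
    using arg_cong[OF w_split[of m], of "\<lambda>u. u * (Z m x * (exp (- s) - 1))"] m
    by (auto simp: distrib_right mult.assoc)
  show ?thesis
    using gen_exp[OF x, of ?k] m unfolding l a d sum.distrib wm[symmetric] distrib_right[of "\<mu> m * Z m x"]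
    by (auto simp: sum.delta algebra_simps split: if_splits)
qed

text \<open>Only an inequality: a waiting job that starts service raises \<open>Z 1\<close> and thus
  lowers the exponential, so these terms are dropped and arrivals at idle servers are the only
  inflow kept.\<close>

lemma gen_exp_Z_1:
  assumes x: "x \<in> \<Omega>" and s: "0 \<le> s"
  shows "gen (\<lambda>x. exp (- (s * Z 1 x))) x \<le> exp (- (s * Z 1 x)) *
     (lam * real N * rho x 0 0 * (exp (- s) - 1) + \<mu> 1 * Z 1 x * (exp s - 1))"
proof -
  let ?k = "\<lambda>r. if r = 1 then - s else (0::real)"
  have l: "lin b M (\<lambda>_. ?k) x = - (s * Z 1 x)" for x
    unfolding lin_Z using M_pos by (simp add: if_distrib[of "\<lambda>u. u * _"] cong: if_cong)
  have a: "(\<Sum>r\<in>{1..<M}. \<mu> r * p r * Z r x * (exp (?k (r + 1) - ?k r) - 1))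
      = (\<Sum>r\<in>{1..<M}. if r = 1 then \<mu> 1 * p 1 * Z 1 x * (exp s - 1) else 0)"
    by (intro sum.cong) (auto simp: algebra_simps)
  have xZ: "real (x 1 r) \<le> Z r x" for r
    unfolding Z_def using b_pos by (intro member_le_sum) auto
  have d: "(\<Sum>r\<in>{1..M}. w r * (real (x 1 r) * (exp (- ?k r) - 1) + (Z r x - real (x 1 r)) * (exp (?k 1 - ?k r) - 1)))
      \<le> (\<Sum>r\<in>{1..M}. if r = 1 then w 1 * Z 1 x * (exp s - 1) else 0)"
  proof (intro sum_mono)
    fix r assume r: "r \<in> {1..M}"
    show "w r * (real (x 1 r) * (exp (- ?k r) - 1) + (Z r x - real (x 1 r)) * (exp (?k 1 - ?k r) - 1))
      \<le> (if r = 1 then w 1 * Z 1 x * (exp s - 1) else 0)"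
    proof (cases "r = 1")
      case True
      have "w 1 * (real (x 1 1) * (exp s - 1)) \<le> w 1 * (Z 1 x * (exp s - 1))"
        using xZ[of 1] w_pos[of 1] M_pos s by (intro mult_left_mono mult_right_mono) auto
      then show ?thesis using True by (simp add: ac_simps)
    next
      case False
      have "(Z r x - real (x 1 r)) * (exp (- s) - 1) \<le> 0"
        using xZ[of r] s by (intro mult_nonneg_nonpos) auto
      then show ?thesis using False w_pos[OF r] by (simp add: mult_nonneg_nonpos)
    qed
  qed
  have w1: "w 1 * Z 1 x * (exp s - 1) + (if 1 < M then \<mu> 1 * p 1 * Z 1 x * (exp s - 1) else 0) = \<mu> 1 * Z 1 x * (exp s - 1)"
    using arg_cong[OF w_split[of 1], of "\<lambda>u. u * (Z 1 x * (exp s - 1))"] M_pos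
    by (auto simp: distrib_right mult.assoc)
  have "gen (\<lambda>x. exp (- (s * Z 1 x))) x \<le> exp (- (s * Z 1 x)) *
     (lam * real N * rho x 0 0 * (exp (- s) - 1)
      + (\<Sum>r\<in>{1..<M}. if r = 1 then \<mu> 1 * p 1 * Z 1 x * (exp s - 1) else 0)
      + (\<Sum>r\<in>{1..M}. if r = 1 then w 1 * Z 1 x * (exp s - 1) else 0))"
    using gen_exp[OF x, of ?k] d unfolding l a by simp
  also have "\<dots> = exp (- (s * Z 1 x)) *
     (lam * real N * rho x 0 0 * (exp (- s) - 1) + \<mu> 1 * Z 1 x * (exp s - 1))"
    using w1 M_pos by (simp add: sum.delta split: if_splits)
  finally show ?thesis .
qed

text \<open>Convexity of \<open>exp\<close> is what allows levels to be averaged as in the fluid limit.\<close>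
lemma exp_level:
  assumes J: "finite J" and c: "\<And>r. r \<in> J \<Longrightarrow> 0 \<le> c r" and G: "sum c J = G" "0 < G" and \<beta>: "0 < \<beta>"
    and base: "0 \<le> expect (\<lambda>x. exp (- \<beta> * h0 x) * (G * h0 x - (\<Sum>r\<in>J. c r * h r x) + \<kappa>))"
    and lev: "\<And>r. r \<in> J \<Longrightarrow> expect (\<lambda>x. exp (- \<beta> * h r x)) \<le> exp (- \<beta> * g r)"
  shows "expect (\<lambda>x. exp (- \<beta> * h0 x)) \<le> exp (- \<beta> * (((\<Sum>r\<in>J. c r * g r) - \<kappa>) / G))"
proof -
  define gb where "gb = ((\<Sum>r\<in>J. c r * g r) - \<kappa>) / G"
  have Ggb: "G * gb = (\<Sum>r\<in>J. c r * g r) - \<kappa>" using G by (simp add: gb_def)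
  \<comment> \<open>Shifting each \<open>h r\<close> by \<open>gb - g r\<close> brings all levels to
    the common value \<open>gb\<close>; the tangent inequality at \<open>- \<beta> * h0 x\<close>
    then separates \<open>h0\<close> from the \<open>h r\<close>.\<close>
  have pt: "\<beta> * (exp (- \<beta> * h0 x) * (G * h0 x - (\<Sum>r\<in>J. c r * h r x) + \<kappa>))
     \<le> (\<Sum>r\<in>J. c r * exp (\<beta> * (g r - gb)) * exp (- \<beta> * h r x)) - G * exp (- \<beta> * h0 x)" for x
  proof -
    have "\<beta> * (exp (- \<beta> * h0 x) * (G * h0 x - (\<Sum>r\<in>J. c r * h r x) + \<kappa>))
        = \<beta> * exp (- \<beta> * h0 x) * (\<Sum>r\<in>J. c r * (h0 x - (h r x - g r + gb)))"
    proof -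
      have "(\<Sum>r\<in>J. c r * (h0 x - (h r x - g r + gb)))
          = (\<Sum>r\<in>J. c r * h0 x - c r * h r x + c r * g r - c r * gb)"
        by (intro sum.cong) (auto simp: algebra_simps)
      also have "\<dots> = G * h0 x - (\<Sum>r\<in>J. c r * h r x) + (\<Sum>r\<in>J. c r * g r) - G * gb"
        unfolding G(1)[symmetric] by (simp add: sum.distrib sum_subtractf sum_distrib_right)
      finally show ?thesis using Ggb by simp
    qed
    also have "\<dots> = (\<Sum>r\<in>J. c r * (exp (- \<beta> * h0 x) * (- \<beta> * (h r x - g r + gb) - (- \<beta> * h0 x))))"
      by (simp add: sum_distrib_left algebra_simps)
    also have "\<dots> \<le> (\<Sum>r\<in>J. c r * (exp (- \<beta> * (h r x - g r + gb)) - exp (- \<beta> * h0 x)))"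
      by (intro sum_mono mult_left_mono exp_tangent c)
    also have "\<dots> = (\<Sum>r\<in>J. c r * exp (\<beta> * (g r - gb)) * exp (- \<beta> * h r x)) - G * exp (- \<beta> * h0 x)"
      using G(1)[symmetric]
      by (simp add: sum_subtractf sum_distrib_right right_diff_distrib mult.assoc exp_add[symmetric])
         (simp add: algebra_simps)
    finally show ?thesis .
  qed
  have "0 \<le> \<beta> * expect (\<lambda>x. exp (- \<beta> * h0 x) * (G * h0 x - (\<Sum>r\<in>J. c r * h r x) + \<kappa>))"
    using base \<beta> by simp
  also have "\<dots> \<le> expect (\<lambda>x. (\<Sum>r\<in>J. c r * exp (\<beta> * (g r - gb)) * exp (- \<beta> * h r x)) - G * exp (- \<beta> * h0 x))"
    unfolding expect_cmult[symmetric] by (intro expect_mono pt)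
  also have "\<dots> = (\<Sum>r\<in>J. c r * exp (\<beta> * (g r - gb)) * expect (\<lambda>x. exp (- \<beta> * h r x))) - G * expect (\<lambda>x. exp (- \<beta> * h0 x))"
    by (simp only: expect_diff expect_sum expect_cmult)
  also have "\<dots> \<le> (\<Sum>r\<in>J. c r * exp (\<beta> * (g r - gb)) * exp (- \<beta> * g r)) - G * expect (\<lambda>x. exp (- \<beta> * h0 x))"
    by (intro diff_mono sum_mono mult_left_mono lev order_refl) (auto simp: c)
  also have "(\<Sum>r\<in>J. c r * exp (\<beta> * (g r - gb)) * exp (- \<beta> * g r)) = G * exp (- \<beta> * gb)"
    unfolding G(1)[symmetric] sum_distrib_right
    by (intro sum.cong) (auto simp: mult.assoc exp_add[symmetric] algebra_simps)
  finally show ?thesis using G(2) by (simp add: gb_def)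
qed

end

text \<open>Second-order expansion for flows that raise (\<open>A\<close>) and lower
  (\<open>B\<close>) the exponent: the net flow, plus a noise term
  \<open>s * (A + B)\<close>.\<close>

lemma exp_drift_bounds:
  fixes s A B :: real
  assumes "0 \<le> s" "s \<le> 1" "0 \<le> A" "0 \<le> B"
  shows "A * (exp s - 1) + B * (exp (- s) - 1) \<le> s * (A - B + s * (A + B))"
proof -
  have "A * (exp s - 1) \<le> A * (s + s\<^sup>2)"
    using exp_bound[of s] assms by (intro mult_left_mono) auto
  moreover have "B * (exp (- s) - 1) \<le> B * (- s + s\<^sup>2)"
    using exp_minus_bound[of s] assms by (intro mult_left_mono) auto
  ultimately show ?thesis by (simp add: algebra_simps power2_eq_square)
qed

lemma sum_last: "2 \<le> m \<Longrightarrow> sum f {2..m} = f m + (sum f {2..m-1} :: real)" for m :: nat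
  by (cases m) (auto simp: add.commute)

lemma sum_first_split:
  "1 \<le> m \<Longrightarrow> m \<le> M \<Longrightarrow> sum f {1..M} = f 1 + sum f {2..m} + (sum f {m+1..M} :: real)" for m M :: nat
proof -
  assume "1 \<le> m" "m \<le> M"
  then have "{1..M} = insert 1 ({2..m} \<union> {m+1..M})" by auto
  moreover have "1 \<notin> {2..m} \<union> {m+1..M}" using \<open>1 \<le> m\<close> by simp
  moreover have "sum f ({2..m} \<union> {m+1..M}) = sum f {2..m} + sum f {m+1..M}"
    by (intro sum.union_disjoint) auto
  ultimately show ?thesis by (metis (no_types, lifting) add.assoc finite_UnI finite_atLeastAtMost sum.insert)
qed

section \<open>Flow identities of the Coxian law and normalised functionals\<close>

locale lb_phases = lb_chain +
  assumes v_norm: "(\<Sum>m\<in>{1..M}. vv \<mu> p m) = 1" and M2: "2 \<le> M"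
    and vbar_pos: "0 < vbar M \<mu> p"
begin

abbreviation "v \<equiv> vv \<mu> p"
abbreviation "vb \<equiv> vbar M \<mu> p"
lemma vb_le: "m \<in> {1..M} \<Longrightarrow> vb \<le> v m"
  unfolding vbar_def by (intro Min_le) auto

lemma v_pos: "m \<in> {1..M} \<Longrightarrow> 0 < v m"
  using vb_le[of m] vbar_pos by linarith

lemma v_le_1: assumes "m \<in> {1..M}" shows "v m \<le> 1"
proof -
  have "v m \<le> sum v {1..M}"
    using assms v_pos by (intro member_le_sum) (auto intro: less_imp_le)
  then show ?thesis using v_norm by simp
qed

lemma one_in: "1 \<in> {1..M}" using M_pos by auto

lemma vb_le_1: "vb \<le> 1"
  using vb_le[OF one_in] v_le_1[OF one_in] by linarith

lemma v1: "v 1 = 1 / \<mu> 1" by (simp add: vv_def)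

lemma mu1_v1: "\<mu> 1 * v 1 = 1" using mu_pos[OF one_in] by (simp add: v1 del: One_nat_def)

lemma mu1_ge_1: "1 \<le> \<mu> 1"
  using v_le_1[OF one_in] mu_pos[OF one_in] by (simp add: v1 field_simps del: One_nat_def)

lemma p1: "0 \<le> p 1" "p 1 < 1" using p_range[of 1] M2 by auto

text \<open>The throughput of phase \<open>m\<close> is the probability that a job ever reaches
  it.\<close>

lemma muv: "m \<in> {1..M} \<Longrightarrow> \<mu> m * v m = (\<Prod>i\<in>{1..<m}. p i)"
  using mu_pos[of m] by (simp add: vv_def)

lemma muv_step: "m \<in> {2..M} \<Longrightarrow> p (m - 1) * \<mu> (m - 1) * v (m - 1) = \<mu> m * v m"
proof -
  assume m: "m \<in> {2..M}"
  then have "{1..<m} = insert (m - 1) {1..<m - 1}" by auto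
  then have "(\<Prod>i\<in>{1..<m}. p i) = p (m - 1) * (\<Prod>i\<in>{1..<m - 1}. p i)" by simp
  moreover have "\<mu> (m - 1) * v (m - 1) = (\<Prod>i\<in>{1..<m - 1}. p i)" using m by (intro muv) auto
  ultimately show ?thesis using muv[of m] m by (simp add: mult.assoc)
qed

lemma muv_2: "\<mu> 2 * v 2 = p 1"
  using muv_step[of 2] M2 mu1_v1 by (simp add: mult.assoc)

lemma wv: "r \<in> {1..<M} \<Longrightarrow> w r * v r = \<mu> r * v r - \<mu> (r + 1) * v (r + 1)"
  using muv_step[of "r + 1"] by (simp add: wrate_def algebra_simps)

text \<open>\<open>w r * v r\<close> is the probability of leaving from phase \<open>r\<close>, and
  \<open>wv\<close> telescopes.\<close>

lemma sum_wv: "m \<in> {2..M} \<Longrightarrow> (\<Sum>r\<in>{2..m-1}. w r * v r) = p 1 - \<mu> m * v m"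
proof (induction m)
  case (Suc m)
  show ?case
  proof (cases "m = 1")
    case True then show ?thesis using muv_2 by (simp add: numeral_2_eq_2)
  next
    case False
    then have m: "m \<in> {2..M}" using Suc.prems by auto
    have "(\<Sum>r\<in>{2..Suc m - 1}. w r * v r) = w m * v m + (\<Sum>r\<in>{2..m-1}. w r * v r)"
      using m sum_last[of m "\<lambda>r. w r * v r"] by simp
    then show ?thesis using Suc.IH[OF m] wv[of m] m Suc.prems by simp
  qed
qed simp

text \<open>Summation by parts in \<open>wv\<close>. It converts the noise accumulated along the
  phases into the sum that appears in \<open>cc\<close>.\<close>

lemma sum_rwv:
  "m \<in> {2..M} \<Longrightarrow> (\<Sum>r\<in>{2..m-1}. (real r - 1) * (w r * v r)) + (real m - 2) * (\<mu> m * v m) = (\<Sum>r\<in>{2..m-1}. \<mu> r * v r)"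
proof (induction m)
  case (Suc m)
  show ?case
  proof (cases "m = 1")
    case True then show ?thesis by simp
  next
    case False
    then have m: "m \<in> {2..M}" using Suc.prems by auto
    have "(\<Sum>r\<in>{2..Suc m - 1}. (real r - 1) * (w r * v r)) = (real m - 1) * (w m * v m) + (\<Sum>r\<in>{2..m-1}. (real r - 1) * (w r * v r))"
      using m sum_last[of m "\<lambda>r. (real r - 1) * (w r * v r)"] by simp
    moreover have "(\<Sum>r\<in>{2..Suc m - 1}. \<mu> r * v r) = \<mu> m * v m + (\<Sum>r\<in>{2..m-1}. \<mu> r * v r)"
      using m sum_last[of m "\<lambda>r. \<mu> r * v r"] by simp
    moreover have "(real m - 1) * (w m * v m) = (real m - 1) * (\<mu> m * v m - \<mu> (Suc m) * v (Suc m))"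
      using wv[of m] m Suc.prems by simp
    ultimately show ?thesis using Suc.IH[OF m] by (simp add: algebra_simps)
  qed
qed simp

lemma sum_wv_all: "(\<Sum>r\<in>{1..M}. w r * v r) = 1"
proof -
  have "(\<Sum>r\<in>{1..M}. w r * v r) = w 1 * v 1 + (w M * v M + (\<Sum>r\<in>{2..M-1}. w r * v r))"
    using sum_first_split[of M M "\<lambda>r. w r * v r"] sum_last[of M "\<lambda>r. w r * v r"] M2 by simp
  also have "\<dots> = 1"
  proof -
    have "w 1 * v 1 = 1 - p 1"
      using wv[of 1] M2 mu1_v1 muv_2 by (simp add: one_add_one del: One_nat_def)
    moreover have "w M * v M = \<mu> M * v M" by (simp add: wrate_def)
    ultimately show ?thesis using sum_wv[of M] M2 by simp
  qed
  finally show ?thesis .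
qed

text \<open>The fraction of servers outside phases \<open>2..m\<close> at the profile
  \<open>v\<close>; thus \<open>Rs 1 = 1\<close> and \<open>Rs M = v 1\<close>.\<close>

definition Rs :: "nat \<Rightarrow> real" where "Rs m = 1 - (\<Sum>r\<in>{2..m}. v r)"

lemma Rs_eq: assumes "m \<in> {1..M}" shows "Rs m = v 1 + (\<Sum>r\<in>{m+1..M}. v r)"
  using sum_first_split[of m M v] assms v_norm by (simp add: Rs_def)

lemma Rs_ge: assumes "m \<in> {1..M}" shows "v 1 \<le> Rs m"
  unfolding Rs_eq[OF assms] using assms sum_nonneg[of "{m+1..M}" v] v_pos by (force intro: less_imp_le)

lemma Rs_pos: "m \<in> {1..M} \<Longrightarrow> 0 < Rs m"
  using Rs_ge[of m] v_pos[OF one_in] by linarith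

lemma Rs_step: "m \<in> {2..M} \<Longrightarrow> Rs (m - 1) = Rs m + v m"
  using sum_last[of m v] by (simp add: Rs_def)

definition ell :: "nat \<Rightarrow> cstate \<Rightarrow> real" where
  "ell m x = Z m x / (real N * v m)"

text \<open>If all \<open>z\<^sub>m\<close> equal \<open>v\<^sub>m\<close>, then \<open>rr m\<close> is 1.  The contraction comes from \<open>rr 1 = 1\<close> holding in every state.\<close>
definition rr :: "nat \<Rightarrow> cstate \<Rightarrow> real" where
  "rr m x = (1 - T m x / real N) / Rs m"

lemma Z_ell: "m \<in> {1..M} \<Longrightarrow> Z m x = real N * v m * ell m x"
  using N_pos v_pos[of m] by (simp add: ell_def)

lemma ell_nonneg: "m \<in> {1..M} \<Longrightarrow> 0 \<le> ell m x"
  using v_pos[of m] Z_nonneg by (auto simp: ell_def intro!: divide_nonneg_nonneg)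

lemma Z_le_N: assumes "x \<in> \<Omega>" "m \<in> {1..M}" shows "Z m x \<le> real N"
proof -
  have "Z m x \<le> (\<Sum>m\<in>{1..M}. Z m x)"
    using assms(2) Z_nonneg by (intro member_le_sum) auto
  then show ?thesis using Z_sum_le[OF assms(1)] by linarith
qed

text \<open>The uniform bound behind every noise estimate; it explains why \<open>vb\<close> enters
  the exponential scale.\<close>

lemma vb_ell: assumes "x \<in> \<Omega>" "m \<in> {1..M}" shows "vb * ell m x \<le> 1"
proof -
  have "vb * ell m x \<le> v m * ell m x"
    using assms vb_le ell_nonneg by (intro mult_right_mono) auto
  also have "\<dots> = Z m x / real N" using Z_ell[OF assms(2)] N_pos by (simp add: field_simps)
  also have "\<dots> \<le> 1" using Z_le_N[OF assms] N_pos by simp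
  finally show ?thesis .
qed

definition Gm :: "nat \<Rightarrow> real" where "Gm m = p 1 * \<mu> 1 + \<mu> m"

lemma Gm_pos: "m \<in> {1..M} \<Longrightarrow> 0 < Gm m"
  using mu_pos[of m] mu_pos[OF one_in] p1 by (auto simp: Gm_def intro!: add_nonneg_pos)

text \<open>Weights of the functionals that pull \<open>rr m\<close>. Slot \<open>r = m\<close>
  belongs to \<open>rr (m - 1)\<close>, not to \<open>ell m\<close>. Smaller \<open>r\<close> come
  from departures out of the block; larger \<open>r\<close> occur because servers in later phases
  cannot be in phase 1.\<close>

definition cw :: "nat \<Rightarrow> nat \<Rightarrow> real" where
  "cw m r = (if r = m then \<mu> m * Rs (m - 1) else if r < m then w r * v r else p 1 * \<mu> 1 * v r)"

lemma split_m: assumes "m \<in> {2..M}"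
  shows "(\<Sum>r\<in>{2..M}. f r) = f m + (\<Sum>r\<in>{2..m-1}. f r) + (\<Sum>r\<in>{m+1..M}. (f r :: real))"
  using sum_first_split[of m M f] sum_first_split[of M M f] sum_last[of m f] assms by simp

lemma cw_sum: assumes m: "m \<in> {2..M}"
  shows "(\<Sum>r\<in>{2..M}. cw m r * (if r = m then a else h r)) =
    \<mu> m * Rs (m - 1) * a + (\<Sum>r\<in>{2..m-1}. w r * v r * h r) + p 1 * \<mu> 1 * (\<Sum>r\<in>{m+1..M}. v r * h r)"
  unfolding split_m[OF m] cw_def sum_distrib_left using m
  by (intro arg_cong2[where f = "(+)"] sum.cong) auto

text \<open>Flow balance at the profile \<open>v\<close>. It makes the pull on \<open>rr m\<close> a
  convex combination, as \<open>exp_level\<close> requires.\<close>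

lemma cw_total: assumes m: "m \<in> {2..M}" shows "sum (cw m) {2..M} = Gm m * Rs m"
proof -
  have "sum (cw m) {2..M} = \<mu> m * Rs (m - 1) + (\<Sum>r\<in>{2..m-1}. w r * v r) + p 1 * \<mu> 1 * (\<Sum>r\<in>{m+1..M}. v r)"
    using cw_sum[OF m, of 1 "\<lambda>_. 1"] by simp
  also have "(\<Sum>r\<in>{m+1..M}. v r) = Rs m - v 1" using Rs_eq[of m] m by simp
  also have "(\<Sum>r\<in>{2..m-1}. w r * v r) = p 1 - \<mu> m * v m" by (rule sum_wv[OF m])
  finally have tot: "sum (cw m) {2..M} = \<mu> m * Rs (m - 1) + (p 1 - \<mu> m * v m) + p 1 * \<mu> 1 * (Rs m - v 1)" .
  have "p 1 * \<mu> 1 * v 1 = p 1" using mu1_v1 by (simp add: mult.assoc)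
  then show ?thesis unfolding tot Gm_def Rs_step[OF m] by (simp add: algebra_simps)
qed

lemma cw_nonneg: assumes "m \<in> {2..M}" "r \<in> {2..M}" shows "0 \<le> cw m r"
proof -
  have "m - 1 \<in> {1..M}" using assms by auto
  then have "0 \<le> \<mu> m" "0 \<le> \<mu> 1" "0 \<le> w r" "0 \<le> v r" "0 \<le> Rs (m - 1)"
    using assms mu_pos[of m] mu_pos[OF one_in] w_pos[of r] v_pos[of r] Rs_pos[of "m - 1"] by simp_all
  then have "0 \<le> \<mu> m * Rs (m - 1)" "0 \<le> w r * v r" "0 \<le> p 1 * \<mu> 1 * v r"
    using p1 by auto
  then show ?thesis by (simp add: cw_def)
qed

end

section \<open>Level inequalities for a single phase\<close>

locale lb_coxian = lb_phases +
  fixes e1 :: real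
  assumes e1: "0 < e1" "e1 \<le> 1"
begin

text \<open>Scaled so that a jump changes the exponent by at most \<open>e1 * vb\<close>; with
  \<open>vb * ell m x \<le> 1\<close> the second-order noise is then of order
  \<open>e1\<close>.\<close>

definition "\<beta> = e1 * real N * vb\<^sup>2"

lemma \<beta>_pos: "0 < \<beta>"
  using N_pos e1 vbar_pos by (simp add: \<beta>_def)

text \<open>\<open>exp_level\<close> with a single attractor: the drift of \<open>ell m\<close> is
  proportional to \<open>ell (m - 1) - ell m\<close>, and each of the two flows contributes noise at
  most \<open>e1\<close>.\<close>

lemma ell_level_step:
  assumes m: "m \<in> {2..M}"
    and lev: "expect (\<lambda>x. exp (- \<beta> * ell (m - 1) x)) \<le> exp (- \<beta> * g)"
  shows "expect (\<lambda>x. exp (- \<beta> * ell m x)) \<le> exp (- \<beta> * (g - 2 * e1))"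
proof -
  have m1: "m \<in> {1..M}" "m - 1 \<in> {1..M}" using m by auto
  define s where "s = \<beta> / (real N * v m)"
  have s_pos: "0 < s" using \<beta>_pos N_pos v_pos[OF m1(1)] by (simp add: s_def)
  have s_eq: "s = e1 * vb * (vb / v m)" using N_pos by (simp add: s_def \<beta>_def power2_eq_square)
  have "vb / v m \<le> 1" using vb_le[OF m1(1)] v_pos[OF m1(1)] by simp
  then have s_le: "s \<le> e1 * vb"
    unfolding s_eq using e1 vbar_pos by (intro mult_left_le) auto
  have s_le1: "s \<le> 1"
    using s_le mult_mono[of e1 1 vb 1] e1 vb_le_1 vbar_pos by simp
  let ?K = "\<mu> m * real N * v m"
  have K: "0 < ?K" using mu_pos[OF m1(1)] N_pos v_pos[OF m1(1)] by simp
  have pt: "gen (\<lambda>x. exp (- (s * Z m x))) x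
     \<le> ?K * s * (exp (- \<beta> * ell m x) * (1 * ell m x - (\<Sum>r\<in>{m-1}. 1 * ell r x) + 2 * e1))"
    if x: "x \<in> \<Omega>" for x
  proof -
    have e: "- (s * Z m x) = - \<beta> * ell m x" by (simp add: s_def ell_def)
    have A: "\<mu> m * Z m x = ?K * ell m x" using Z_ell[OF m1(1)] by simp
    have B: "p (m - 1) * \<mu> (m - 1) * Z (m - 1) x = ?K * ell (m - 1) x"
      using Z_ell[OF m1(2)] muv_step[OF m] by (simp add: algebra_simps)
    have l0: "0 \<le> ell m x" "0 \<le> ell (m - 1) x" using ell_nonneg m1 by auto
    have n: "s * (ell m x + ell (m - 1) x) \<le> 2 * e1"
    proof -
      have "s * (ell m x + ell (m - 1) x) \<le> e1 * vb * (ell m x + ell (m - 1) x)"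
        using s_le l0 by (intro mult_right_mono) auto
      also have "\<dots> = e1 * (vb * ell m x + vb * ell (m - 1) x)" by (simp add: algebra_simps)
      also have "\<dots> \<le> e1 * (1 + 1)"
        using vb_ell[OF x] m1 e1 by (intro mult_left_mono add_mono) auto
      finally show ?thesis by simp
    qed
    have "?K * ell m x * (exp s - 1) + ?K * ell (m - 1) x * (exp (- s) - 1)
        \<le> s * (?K * ell m x - ?K * ell (m - 1) x + s * (?K * ell m x + ?K * ell (m - 1) x))"
      using s_pos s_le1 mult_nonneg_nonneg[OF less_imp_le[OF K] l0(1)] mult_nonneg_nonneg[OF less_imp_le[OF K] l0(2)]
      by (intro exp_drift_bounds) auto
    also have "\<dots> = ?K * s * (ell m x - ell (m - 1) x + s * (ell m x + ell (m - 1) x))"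
      by (simp add: algebra_simps)
    also have "\<dots> \<le> ?K * s * (ell m x - ell (m - 1) x + 2 * e1)"
      using n K s_pos by (intro mult_left_mono) auto
    finally have "exp (- \<beta> * ell m x) * (?K * ell m x * (exp s - 1) + ?K * ell (m - 1) x * (exp (- s) - 1))
       \<le> exp (- \<beta> * ell m x) * (?K * s * (ell m x - ell (m - 1) x + 2 * e1))"
      by (intro mult_left_mono) auto
    then show ?thesis
      unfolding gen_exp_Z[OF x m] e A B by (simp add: algebra_simps)
  qed
  have "0 \<le> expect (\<lambda>x. exp (- \<beta> * ell m x) * (1 * ell m x - (\<Sum>r\<in>{m-1}. 1 * ell r x) + 2 * e1))"
    by (rule expect_gen_le[OF _ pt]) (use K s_pos in simp)
  from exp_level[OF _ _ _ _ \<beta>_pos this, of "\<lambda>_. g"] lev show ?thesis by simp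
qed

lemma rr_level_step:
  assumes m: "m \<in> {2..M}"
    and lev: "expect (\<lambda>x. exp (- \<beta> * rr (m - 1) x)) \<le> exp (- \<beta> * g0)"
    and levs: "\<And>r. r \<in> {2..M} \<Longrightarrow> expect (\<lambda>x. exp (- \<beta> * ell r x)) \<le> exp (- \<beta> * g r)"
  shows "expect (\<lambda>x. exp (- \<beta> * rr m x)) \<le> exp (- \<beta> * ((\<mu> m * Rs (m - 1) * g0 + (\<Sum>r\<in>{2..m-1}. w r * v r * g r)
     + p 1 * \<mu> 1 * (\<Sum>r\<in>{m+1..M}. v r * g r) - 2 * e1 * Gm m) / (Gm m * Rs m)))"
proof -
  have m1: "m \<in> {1..M}" "m - 1 \<in> {1..M}" using m by auto
  have Rp: "0 < Rs m" "0 < Rs (m - 1)" using Rs_pos m1 by auto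
  have vbR: "vb \<le> Rs m" using Rs_ge[OF m1(1)] vb_le[OF one_in] by linarith
  define s where "s = \<beta> / (real N * Rs m)"
  have s_pos: "0 < s" using \<beta>_pos N_pos Rp by (simp add: s_def)
  have s_eq: "s = e1 * vb * (vb / Rs m)" using N_pos by (simp add: s_def \<beta>_def power2_eq_square)
  have "vb / Rs m \<le> 1" using vbR Rp by simp
  then have s_le: "s \<le> e1 * vb"
    unfolding s_eq using e1 vbar_pos by (intro mult_left_le) auto
  have s_le_e: "s \<le> e1"
    using s_le mult_left_le[of vb e1] e1 vb_le_1 by linarith
  have s_le1: "s \<le> 1" using s_le_e e1 by simp
  define h where "h r x = (if r = m then rr (m - 1) x else ell r x)" for r x
  let ?H = "\<lambda>x. Gm m * Rs m * rr m x - (\<Sum>r\<in>{2..M}. cw m r * h r x) + 2 * e1 * Gm m"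
  let ?E = "exp (\<beta> / Rs m)"
  have pt: "gen (\<lambda>x. exp (s * T m x)) x \<le> ?E * s * real N * (exp (- \<beta> * rr m x) * ?H x)"
    if x: "x \<in> \<Omega>" for x
  proof -
    let ?n = "real N"
    \<comment> \<open>\<open>rr m\<close> is a decreasing affine function of \<open>T m\<close>, so
      both exponentials agree up to a constant, which goes into the factor of the drift
      bound.\<close>
    have e: "exp (s * T m x) = ?E * exp (- \<beta> * rr m x)"
      using Rp N_pos unfolding exp_add[symmetric] s_def rr_def by (simp add: field_simps)
    define A where "A = p 1 * \<mu> 1 * Z 1 x"
    define W where "W = (\<Sum>r\<in>{2..m-1}. w r * Z r x)"
    have A0: "0 \<le> A" using p1 mu_pos[OF one_in] Z_nonneg by (simp add: A_def)
    have W0: "0 \<le> W" unfolding W_def using m w_pos Z_nonneg by (intro sum_nonneg mult_nonneg_nonneg) (auto intro: less_imp_le)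
    have B0: "0 \<le> \<mu> m * Z m x" using mu_pos[OF m1(1)] Z_nonneg by simp
    have Wv: "W = ?n * (\<Sum>r\<in>{2..m-1}. w r * v r * ell r x)"
      unfolding W_def sum_distrib_left using m Z_ell by (intro sum.cong) auto
    have T1: "T m x = ?n - ?n * Rs m * rr m x" using Rp N_pos by (simp add: rr_def field_simps)
    have T2: "T (m - 1) x = ?n - ?n * Rs (m - 1) * rr (m - 1) x" using Rp N_pos by (simp add: rr_def field_simps)
    have T3: "T m x = Z m x + T (m - 1) x" using m sum_last[of m "\<lambda>r. Z r x"] by (simp add: T_def)
    \<comment> \<open>Phase 1 is eliminated here: it has at most the servers that are left over by
      phases \<open>2..M\<close>, so lower bounds for later phases limit the inflow.\<close>
    have tail: "Z 1 x + T m x + ?n * (\<Sum>r\<in>{m+1..M}. v r * ell r x) \<le> ?n"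
    proof -
      have "(\<Sum>r\<in>{1..M}. Z r x) = Z 1 x + T m x + (\<Sum>r\<in>{m+1..M}. Z r x)"
        unfolding T_def using m by (intro sum_first_split) auto
      also have "(\<Sum>r\<in>{m+1..M}. Z r x) = ?n * (\<Sum>r\<in>{m+1..M}. v r * ell r x)"
        unfolding sum_distrib_left using m Z_ell by (intro sum.cong) auto
      finally show ?thesis using Z_sum_le[OF x] by simp
    qed
    have drift: "A - (\<mu> m * Z m x + W) \<le> ?n * (Gm m * Rs m * rr m x - (\<Sum>r\<in>{2..M}. cw m r * h r x))"
    proof -
      have "A \<le> p 1 * \<mu> 1 * (?n * Rs m * rr m x - ?n * (\<Sum>r\<in>{m+1..M}. v r * ell r x))"
        unfolding A_def using tail T1 p1 mu_pos[OF one_in] by (intro mult_left_mono) auto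
      moreover have "\<mu> m * Z m x = \<mu> m * (?n * Rs (m - 1) * rr (m - 1) x - ?n * Rs m * rr m x)"
        using T1 T2 T3 by simp
      ultimately show ?thesis
        unfolding h_def cw_sum[OF m] Wv Gm_def by (simp add: algebra_simps)
    qed
    \<comment> \<open>The flows through phases 1 and \<open>m\<close> are at most
      \<open>real N * Gm m\<close>. The inner departures cost another such term, by
      \<open>vb_ell\<close> and \<open>sum_wv\<close>; hence the factor 2.\<close>
    have noise: "s * (A + (\<mu> m * Z m x + W)) \<le> ?n * (2 * e1 * Gm m)"
    proof -
      have "A + \<mu> m * Z m x \<le> p 1 * \<mu> 1 * ?n + \<mu> m * ?n"
        unfolding A_def using p1 mu_pos[OF one_in] mu_pos[OF m1(1)] Z_le_N[OF x] one_in m1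
        by (intro add_mono mult_left_mono) auto
      then have 1: "s * (A + \<mu> m * Z m x) \<le> e1 * (?n * Gm m)"
        using s_le_e s_pos A0 B0 by (intro mult_mono) (auto simp: Gm_def algebra_simps)
      have "vb * W = ?n * (\<Sum>r\<in>{2..m-1}. w r * v r * (vb * ell r x))"
        by (simp add: Wv sum_distrib_left algebra_simps)
      also have "\<dots> \<le> ?n * (\<Sum>r\<in>{2..m-1}. w r * v r)"
      proof (intro mult_left_mono sum_mono mult_left_le)
        fix r assume "r \<in> {2..m-1}"
        then have r: "r \<in> {1..M}" using m by auto
        show "vb * ell r x \<le> 1" by (rule vb_ell[OF x r])
        show "0 \<le> w r * v r" using w_pos[OF r] v_pos[OF r] by simp
      qed simp
      also have "\<dots> \<le> ?n * p 1"
        unfolding sum_wv[OF m] using mu_pos[OF m1(1)] v_pos[OF m1(1)] by (intro mult_left_mono) auto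
      also have "\<dots> \<le> ?n * Gm m"
        using p1 mu1_ge_1 mu_pos[OF m1(1)] mult_left_mono[of 1 "\<mu> 1" "p 1"]
        by (intro mult_left_mono) (auto simp: Gm_def)
      finally have "e1 * (vb * W) \<le> e1 * (?n * Gm m)" using e1 by simp
      moreover have "s * W \<le> e1 * vb * W" using s_le W0 by (intro mult_right_mono)
      ultimately show ?thesis using 1 by (simp add: algebra_simps)
    qed
    have "A * (exp s - 1) + (\<mu> m * Z m x + W) * (exp (- s) - 1)
       \<le> s * (A - (\<mu> m * Z m x + W) + s * (A + (\<mu> m * Z m x + W)))"
      using s_pos s_le1 A0 B0 W0 by (intro exp_drift_bounds) auto
    also have "\<dots> \<le> s * (?n * (Gm m * Rs m * rr m x - (\<Sum>r\<in>{2..M}. cw m r * h r x)) + ?n * (2 * e1 * Gm m))"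
      using drift noise s_pos by (intro mult_left_mono add_mono) auto
    also have "\<dots> = s * ?n * ?H x" by (simp add: algebra_simps)
    finally have "exp (s * T m x) * (A * (exp s - 1) + (\<mu> m * Z m x + W) * (exp (- s) - 1))
       \<le> exp (s * T m x) * (s * ?n * ?H x)"
      by (intro mult_left_mono) auto
    then show ?thesis
      unfolding gen_exp_T[OF x m] A_def[symmetric] W_def[symmetric]
      by (simp add: e mult_ac)
  qed
  have base: "0 \<le> expect (\<lambda>x. exp (- \<beta> * rr m x) * ?H x)"
    by (rule expect_gen_le[OF _ pt]) (use s_pos N_pos in simp)
  have "expect (\<lambda>x. exp (- \<beta> * rr m x)) \<le> exp (- \<beta> * (((\<Sum>r\<in>{2..M}. cw m r * (if r = m then g0 else g r)) - 2 * e1 * Gm m) / (Gm m * Rs m)))"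
    by (rule exp_level[OF _ cw_nonneg[OF m] cw_total[OF m] _ \<beta>_pos base])
       (use Gm_pos[OF m1(1)] Rp lev levs in \<open>auto simp: h_def\<close>)
  then show ?thesis unfolding cw_sum[OF m] .
qed

end

section \<open>Lower bounds for the phases\<close>

text \<open>\<open>xi\<close> and \<open>CM\<close> are the values at \<open>M\<close> of \<open>wprod (aa \<mu> p)\<close> applied to \<open>bb M \<mu> p\<close> and \<open>cc M \<mu> p\<close>; the
  intermediate values appear in the induction over the phases.\<close>
definition wprod :: "(nat \<Rightarrow> real) \<Rightarrow> (nat \<Rightarrow> real) \<Rightarrow> nat \<Rightarrow> real" where
  "wprod a f m = (\<Sum>r\<in>{2..m}. f r * (\<Prod>j\<in>{r+1..m}. a j))"

lemma wprod_1: "wprod a f 1 = 0" by (simp add: wprod_def)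

lemma wprod_step: assumes "2 \<le> m" shows "wprod a f m = a m * wprod a f (m - 1) + f m"
proof -
  have "wprod a f m = f m + (\<Sum>r\<in>{2..m-1}. f r * (\<Prod>j\<in>{r+1..m}. a j))"
    unfolding wprod_def using assms by (subst sum_last) auto
  also have "(\<Sum>r\<in>{2..m-1}. f r * (\<Prod>j\<in>{r+1..m}. a j)) = (\<Sum>r\<in>{2..m-1}. a m * (f r * (\<Prod>j\<in>{r+1..m-1}. a j)))"
  proof (intro sum.cong refl)
    fix r assume r: "r \<in> {2..m-1}"
    then have "{r+1..m} = insert m {r+1..m-1}" using assms by auto
    moreover have "m \<notin> {r+1..m-1}" using assms by auto
    ultimately have "(\<Prod>j\<in>{r+1..m}. a j) = a m * (\<Prod>j\<in>{r+1..m-1}. a j)"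
      by (metis finite_atLeastAtMost prod.insert)
    then show "f r * (\<Prod>j\<in>{r+1..m}. a j) = a m * (f r * (\<Prod>j\<in>{r+1..m-1}. a j))" by simp
  qed
  finally show ?thesis by (simp add: wprod_def sum_distrib_left)
qed

context lb_phases begin

abbreviation "xi_m \<equiv> wprod (aa \<mu> p) (bb M \<mu> p)"
abbreviation "C_m \<equiv> wprod (aa \<mu> p) (cc M \<mu> p)"

lemma Gm_aa: "m \<in> {2..M} \<Longrightarrow> Gm m * aa \<mu> p m = \<mu> m" "m \<in> {2..M} \<Longrightarrow> Gm m * (1 - aa \<mu> p m) = p 1 * \<mu> 1"
  using Gm_pos[of m] by (auto simp: aa_def Gm_def field_simps)

text \<open>Clearing the denominators of \<open>aa\<close> turns the coefficient into a balance of
  flows, the form needed for comparison with the level step; likewise in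
  \<open>Gm_cc\<close>.\<close>

lemma Gm_bb:
  assumes m: "m \<in> {2..M}"
  shows "Gm m * (v 1 * bb M \<mu> p m) = p 1 + p 1 * \<mu> 1 * (\<Sum>r\<in>{m+1..M}. v r) - \<mu> m * v m"
proof -
  have "v 1 * bb M \<mu> p m = (1 - aa \<mu> p m) * (v 1 + (\<Sum>r\<in>{m+1..M}. v r)) - aa \<mu> p m * v m"
    using v_pos[OF one_in] unfolding bb_def sum_divide_distrib[symmetric] by (simp add: field_simps)
  then have "Gm m * (v 1 * bb M \<mu> p m)
      = Gm m * ((1 - aa \<mu> p m) * (v 1 + (\<Sum>r\<in>{m+1..M}. v r)) - aa \<mu> p m * v m)"
    by (simp only:)
  also have "\<dots>
      = (Gm m * (1 - aa \<mu> p m)) * (v 1 + (\<Sum>r\<in>{m+1..M}. v r)) - (Gm m * aa \<mu> p m) * v m"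
    by (simp add: algebra_simps)
  also have "\<dots> = p 1 * (\<mu> 1 * v 1) + p 1 * \<mu> 1 * (\<Sum>r\<in>{m+1..M}. v r) - \<mu> m * v m"
    unfolding Gm_aa[OF m] by (simp add: algebra_simps)
  finally show ?thesis using mu1_v1 by simp
qed

lemma Gm_cc:
  assumes m: "m \<in> {2..M}"
  shows "Gm m * cc M \<mu> p m = 5 * (p 1 * \<mu> 1) * (\<Sum>r\<in>{m+1..M}. (real r - 1) * v r)
    + 5 * (\<Sum>r\<in>{2..m-1}. \<mu> r * v r) + 5 * (real m - 2) * (\<mu> m * v m) + 5 * Gm m - \<mu> m"
proof -
  have "\<mu> m * (\<Sum>r\<in>{2..m-1}. \<mu> r * v r / \<mu> m) = (\<Sum>r\<in>{2..m-1}. \<mu> r * v r)"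
    using mu_pos[of m] m by (simp add: sum_divide_distrib[symmetric])
  moreover have "Gm m * cc M \<mu> p m = 5 * (Gm m * (1 - aa \<mu> p m)) * (\<Sum>r\<in>{m+1..M}. (real r - 1) * v r)
    + 5 * ((Gm m * aa \<mu> p m) * (\<Sum>r\<in>{2..m-1}. \<mu> r * v r / \<mu> m))
    + 5 * (real m - 2) * ((Gm m * aa \<mu> p m) * v m) + 5 * Gm m - Gm m * aa \<mu> p m"
    unfolding cc_def by (simp add: algebra_simps)
  ultimately show ?thesis unfolding Gm_aa[OF m] by simp
qed

lemma aa_nonneg: "m \<in> {2..M} \<Longrightarrow> 0 \<le> aa \<mu> p m"
  using Gm_pos[of m] mu_pos[of m] unfolding aa_def Gm_def by (intro divide_nonneg_nonneg) auto

lemma cc_ge: assumes m: "m \<in> {2..M}" shows "4 \<le> cc M \<mu> p m"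
proof -
  have m1: "m \<in> {1..M}" using m by auto
  have mv: "0 \<le> \<mu> r * v r" if "r \<in> {1..M}" for r using mu_pos[OF that] v_pos[OF that] by simp
  have "0 \<le> (\<Sum>r\<in>{m+1..M}. (real r - 1) * v r)"
    using v_pos by (intro sum_nonneg mult_nonneg_nonneg) (auto intro: less_imp_le)
  then have 1: "0 \<le> 5 * (p 1 * \<mu> 1) * (\<Sum>r\<in>{m+1..M}. (real r - 1) * v r)"
    using p1 mu_pos[OF one_in] by simp
  have 2: "0 \<le> (\<Sum>r\<in>{2..m-1}. \<mu> r * v r)" using mv m by (intro sum_nonneg) auto
  have 3: "0 \<le> 5 * (real m - 2) * (\<mu> m * v m)" using mv[OF m1] m mult_nonneg_nonneg[of "5 * (real m - 2)"] by simp
  have "\<mu> m \<le> Gm m" using p1 mu_pos[OF one_in] by (simp add: Gm_def)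
  then have "Gm m * 4 \<le> Gm m * cc M \<mu> p m" using 1 2 3 unfolding Gm_cc[OF m] by linarith
  then show ?thesis using Gm_pos[OF m1] by simp
qed

text \<open>The last summand alone is at least 4 and the others are nonnegative. This permits
  division by \<open>CM\<close> and later forces \<open>e1 \<le> 1\<close>.\<close>

lemma CM_ge: "4 \<le> CM M \<mu> p"
proof -
  have "0 \<le> C_m (M - 1)"
    unfolding wprod_def
  proof (intro sum_nonneg mult_nonneg_nonneg prod_nonneg)
    fix r assume r: "r \<in> {2..M - 1}"
    then have "r \<in> {2..M}" by auto
    from cc_ge[OF this] show "0 \<le> cc M \<mu> p r" by simp
    show "0 \<le> aa \<mu> p j" if "j \<in> {r+1..M-1}" for j using that r by (intro aa_nonneg) auto
  qed
  moreover have "CM M \<mu> p = aa \<mu> p M * C_m (M - 1) + cc M \<mu> p M"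
    using wprod_step[of M "aa \<mu> p" "cc M \<mu> p"] M2 by (simp add: CM_def wprod_def)
  ultimately show ?thesis using cc_ge[of M] aa_nonneg[of M] M2 by (simp add: add_nonneg_pos add_increasing)
qed

end

section \<open>Induction over the phases and the self-consistent bound for phase 1\<close>

context lb_coxian begin

lemma level_ell:
  assumes "expect (\<lambda>x. exp (- \<beta> * ell 1 x)) \<le> exp (- \<beta> * (1 - \<delta>))" and "m \<in> {1..M}"
  shows "expect (\<lambda>x. exp (- \<beta> * ell m x)) \<le> exp (- \<beta> * (1 - \<delta> - 2 * (real m - 1) * e1))"
  using assms(2)
proof (induction m)
  case (Suc m)
  show ?case
  proof (cases "m = 0")
    case True then show ?thesis using assms(1) by simp
  next
    case False
    then have m: "m \<in> {1..M}" "Suc m \<in> {2..M}" using Suc.prems by auto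
    from ell_level_step[OF m(2), of "1 - \<delta> - 2 * (real m - 1) * e1"] Suc.IH[OF m(1)]
    have "expect (\<lambda>x. exp (- \<beta> * ell (Suc m) x)) \<le> exp (- \<beta> * ((1 - \<delta> - 2 * (real m - 1) * e1) - 2 * e1))"
      by simp
    also have "(1 - \<delta> - 2 * (real m - 1) * e1) - 2 * e1 = 1 - \<delta> - 2 * (real (Suc m) - 1) * e1"
      by (simp add: algebra_simps)
    finally show ?thesis .
  qed
qed simp

text \<open>The shortfall of the level of \<open>rr m\<close>, times \<open>Rs m\<close>, when
  \<open>ell 1\<close> has shortfall \<open>\<delta>\<close>. At \<open>m = M\<close> division by
  \<open>v 1\<close> gives \<open>xi\<close> and \<open>\<mu> 1 * CM\<close> as
  coefficients.\<close>

definition FF :: "real \<Rightarrow> nat \<Rightarrow> real" where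
  "FF \<delta> m = v 1 * xi_m m * \<delta> + C_m m * e1"

lemma FF_step:
  assumes m: "m \<in> {2..M}"
  shows "Gm m * (Rs m - FF \<delta> m) \<le> \<mu> m * Rs (m - 1) * (1 - FF \<delta> (m - 1) / Rs (m - 1))
     + (\<Sum>r\<in>{2..m-1}. w r * v r * (1 - \<delta> - 2 * (real r - 1) * e1))
     + p 1 * \<mu> 1 * (\<Sum>r\<in>{m+1..M}. v r * (1 - \<delta> - 2 * (real r - 1) * e1)) - 2 * e1 * Gm m"
proof -
  have m1: "m \<in> {1..M}" "m - 1 \<in> {1..M}" using m by auto
  define S where "S = (\<Sum>r\<in>{m+1..M}. v r)"
  define S' where "S' = (\<Sum>r\<in>{m+1..M}. (real r - 1) * v r)"
  define W' where "W' = (\<Sum>r\<in>{2..m-1}. (real r - 1) * (w r * v r))"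
  define Q where "Q = (\<Sum>r\<in>{2..m-1}. \<mu> r * v r)"
  have GF: "Gm m * FF \<delta> m = \<mu> m * FF \<delta> (m - 1) + \<delta> * (p 1 + p 1 * \<mu> 1 * S - \<mu> m * v m)
     + e1 * (5 * (p 1 * \<mu> 1) * S' + 5 * Q + 5 * (real m - 2) * (\<mu> m * v m) + 5 * Gm m - \<mu> m)"
  proof -
    have "Gm m * FF \<delta> m = (Gm m * aa \<mu> p m) * FF \<delta> (m - 1) + \<delta> * (Gm m * (v 1 * bb M \<mu> p m)) + e1 * (Gm m * cc M \<mu> p m)"
      using m unfolding FF_def by (simp add: wprod_step algebra_simps)
    then show ?thesis unfolding Gm_aa[OF m] Gm_bb[OF m] Gm_cc[OF m] S_def S'_def Q_def .
  qed
  have GR: "Gm m * Rs m = \<mu> m * Rs (m - 1) + (p 1 - \<mu> m * v m) + p 1 * \<mu> 1 * S"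
    using cw_total[OF m] cw_sum[OF m, of 1 "\<lambda>_. 1"] sum_wv[OF m] by (simp add: S_def)
  have s1: "(\<Sum>r\<in>{2..m-1}. w r * v r * (1 - \<delta> - 2 * (real r - 1) * e1)) = (1 - \<delta>) * (p 1 - \<mu> m * v m) - 2 * e1 * W'"
    unfolding sum_wv[OF m, symmetric] W'_def sum_distrib_left sum_subtractf[symmetric]
    by (intro sum.cong) (auto simp: algebra_simps)
  have s2: "(\<Sum>r\<in>{m+1..M}. v r * (1 - \<delta> - 2 * (real r - 1) * e1)) = (1 - \<delta>) * S - 2 * e1 * S'"
    unfolding S_def S'_def sum_distrib_left sum_subtractf[symmetric]
    by (intro sum.cong) (auto simp: algebra_simps)
  have s3: "\<mu> m * Rs (m - 1) * (1 - FF \<delta> (m - 1) / Rs (m - 1)) = \<mu> m * Rs (m - 1) - \<mu> m * FF \<delta> (m - 1)"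
    using Rs_pos[OF m1(2)] by (simp add: field_simps)
  have muv0: "0 \<le> \<mu> m * v m" using mu_pos[OF m1(1)] v_pos[OF m1(1)] by simp
  have W'Q: "W' + (real m - 2) * (\<mu> m * v m) = Q" unfolding W'_def Q_def by (rule sum_rwv[OF m])
  have m2: "0 \<le> (real m - 2) * (\<mu> m * v m)" using m muv0 mult_nonneg_nonneg[of "real m - 2" "\<mu> m * v m"] by simp
  have Q0: "0 \<le> Q" unfolding Q_def using m mu_pos v_pos by (intro sum_nonneg mult_nonneg_nonneg) (auto intro!: less_imp_le)
  have "0 \<le> S'" unfolding S'_def using v_pos by (intro sum_nonneg mult_nonneg_nonneg) (auto intro!: less_imp_le)
  then have S'0: "0 \<le> p 1 * \<mu> 1 * S'" using p1 mu_pos[OF one_in] by simp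
  have muG: "\<mu> m \<le> Gm m" "0 \<le> Gm m" using p1 mu_pos[OF one_in] Gm_pos[OF m1(1)] by (auto simp: Gm_def)
  \<comment> \<open>The \<open>\<delta>\<close> parts agree exactly, so only the noise is compared:
    \<open>cc\<close> supplies coefficients 5 where 2 is required.\<close>
  have "2 * W' + 2 * (p 1 * \<mu> 1 * S') + 2 * Gm m
     \<le> 5 * (p 1 * \<mu> 1) * S' + 5 * Q + 5 * (real m - 2) * (\<mu> m * v m) + 5 * Gm m - \<mu> m"
    using W'Q m2 Q0 S'0 muG by (simp add: algebra_simps)
  then have "e1 * (2 * W' + 2 * (p 1 * \<mu> 1 * S') + 2 * Gm m)
     \<le> e1 * (5 * (p 1 * \<mu> 1) * S' + 5 * Q + 5 * (real m - 2) * (\<mu> m * v m) + 5 * Gm m - \<mu> m)"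
    using e1 by (intro mult_left_mono) auto
  then show ?thesis
    unfolding right_diff_distrib[of "Gm m"] GF GR s1 s2 s3 by (simp add: algebra_simps)
qed

lemma level_rr:
  assumes l1: "expect (\<lambda>x. exp (- \<beta> * ell 1 x)) \<le> exp (- \<beta> * (1 - \<delta>))" and "m \<in> {1..M}"
  shows "expect (\<lambda>x. exp (- \<beta> * rr m x)) \<le> exp (- \<beta> * (1 - FF \<delta> m / Rs m))"
  using assms(2)
proof (induction m)
  case (Suc m)
  show ?case
  proof (cases "m = 0")
    case True
    \<comment> \<open>The block \<open>2..1\<close> is empty, so the induction starts without any
      shortfall.\<close>
    have "rr 1 x = 1" "FF \<delta> 1 = 0" for x
      using wprod_1[of "aa \<mu> p"] by (simp_all add: rr_def T_def Rs_def FF_def)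
    then show ?thesis using True by (simp add: expect_const)
  next
    case False
    define k where "k = Suc m"
    have m: "m \<in> {1..M}" "k \<in> {2..M}" "k - 1 = m" "k \<in> {1..M}" using False Suc.prems by (auto simp: k_def)
    have D: "0 < Gm k * Rs k" using Gm_pos Rs_pos m by simp
    note st = rr_level_step[OF m(2), of "1 - FF \<delta> m / Rs m" "\<lambda>r. 1 - \<delta> - 2 * (real r - 1) * e1"]
    have "expect (\<lambda>x. exp (- \<beta> * rr k x)) \<le> exp (- \<beta> * ((\<mu> k * Rs m * (1 - FF \<delta> m / Rs m)
     + (\<Sum>r\<in>{2..k-1}. w r * v r * (1 - \<delta> - 2 * (real r - 1) * e1))
     + p 1 * \<mu> 1 * (\<Sum>r\<in>{k+1..M}. v r * (1 - \<delta> - 2 * (real r - 1) * e1)) - 2 * e1 * Gm k) / (Gm k * Rs k)))"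
      using st Suc.IH[OF m(1)] level_ell[OF l1] unfolding m(3) by auto
    also have "\<dots> \<le> exp (- \<beta> * (Gm k * (Rs k - FF \<delta> k) / (Gm k * Rs k)))"
    proof -
      have "Gm k * (Rs k - FF \<delta> k) / (Gm k * Rs k) \<le> (\<mu> k * Rs m * (1 - FF \<delta> m / Rs m)
     + (\<Sum>r\<in>{2..k-1}. w r * v r * (1 - \<delta> - 2 * (real r - 1) * e1))
     + p 1 * \<mu> 1 * (\<Sum>r\<in>{k+1..M}. v r * (1 - \<delta> - 2 * (real r - 1) * e1)) - 2 * e1 * Gm k) / (Gm k * Rs k)"
        using FF_step[OF m(2), of \<delta>] D unfolding m(3) by (intro divide_right_mono) auto
      from mult_left_mono_neg[OF this, of "- \<beta>"] show ?thesis using \<beta>_pos by simp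
    qed
    also have "Gm k * (Rs k - FF \<delta> k) / (Gm k * Rs k) = 1 - FF \<delta> k / Rs k"
      using Gm_pos[OF m(4)] Rs_pos[OF m(4)] by (simp add: field_simps)
    finally show ?thesis unfolding k_def .
  qed
qed simp

lemma Rs_M: "Rs M = v 1" using Rs_eq[of M] M_pos by simp

text \<open>Two regimes. With enough idle servers they receive arrivals at rate at least
  \<open>lam - d0\<close> per server, which pulls \<open>ell 1\<close> there. Otherwise the busy
  count gives \<open>rr M x - eps * \<mu> 1 \<le> ell 1 x\<close> in the state itself.\<close>

lemma ell_1_level_step:
  assumes eps: "0 \<le> eps" and d0: "0 \<le> d0"
    and lb: "\<And>x. x \<in> \<Omega> \<Longrightarrow> (\<Sum>m\<in>{1..M}. Z m x) \<le> real N * (1 - eps) \<Longrightarrow> A1 b M rho x \<le> d0"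
  shows "expect (\<lambda>x. exp (- \<beta> * ell 1 x)) \<le> exp (- \<beta> * (lam - d0 - 2 * e1))
     + \<beta> * exp (\<beta> * (eps * \<mu> 1)) * expect (\<lambda>x. exp (- \<beta> * rr M x))"
proof -
  define s where "s = \<beta> / (real N * v 1)"
  have v1p: "0 < v 1" by (rule v_pos[OF one_in])
  have s_pos: "0 < s" using \<beta>_pos N_pos v1p by (simp add: s_def)
  have s_eq: "s = e1 * vb * (vb / v 1)" using N_pos by (simp add: s_def \<beta>_def power2_eq_square)
  have "vb / v 1 \<le> 1" using vb_le[OF one_in] v1p by simp
  then have s_le: "s \<le> e1 * vb"
    unfolding s_eq using e1 vbar_pos by (intro mult_left_le) auto
  have s_le_e: "s \<le> e1"
    using s_le mult_left_le[of vb e1] e1 vb_le_1 by linarith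
  have s_le1: "s \<le> 1" using s_le_e e1 by simp
  let ?n = "real N"
  let ?a = "\<lambda>x. lam * rho x 0 0"
  have a01: "0 \<le> ?a x" "?a x \<le> 1" if "x \<in> \<Omega>" for x
    using rho_nonneg[OF that, of 0 0] rho_00[OF that] A1_nonneg[OF that] lam mult_le_one[of lam "rho x 0 0"] by auto
  have base: "0 \<le> expect (\<lambda>x. exp (- \<beta> * ell 1 x) * (ell 1 x - ?a x + 2 * e1))"
  proof (rule expect_gen_le)
    show "0 < ?n * s" using s_pos N_pos by simp
    fix x assume x: "x \<in> \<Omega>"
    have e: "- (s * Z 1 x) = - \<beta> * ell 1 x" by (simp add: s_def ell_def)
    have A: "\<mu> 1 * Z 1 x = ?n * ell 1 x" using Z_ell[OF one_in] mu1_v1 by (simp add: algebra_simps)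
    have l0: "0 \<le> ell 1 x" by (rule ell_nonneg[OF one_in])
    have n: "s * (ell 1 x + ?a x) \<le> 2 * e1"
    proof -
      have "s * ell 1 x \<le> e1 * vb * ell 1 x" using s_le l0 by (intro mult_right_mono)
      also have "\<dots> \<le> e1" using vb_ell[OF x one_in] e1 by (simp add: mult.assoc mult_left_le)
      finally show ?thesis using mult_mono[of s e1 "?a x" 1] s_le_e s_pos a01[OF x] e1 by (simp add: distrib_left)
    qed
    have "gen (\<lambda>x. exp (- (s * Z 1 x))) x
       \<le> exp (- \<beta> * ell 1 x) * (?n * ell 1 x * (exp s - 1) + ?n * ?a x * (exp (- s) - 1))"
      using gen_exp_Z_1[OF x, of s] s_pos unfolding e A by (simp add: algebra_simps)
    also have "\<dots> \<le> exp (- \<beta> * ell 1 x) * (s * (?n * ell 1 x - ?n * ?a x + s * (?n * ell 1 x + ?n * ?a x)))"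
      using s_pos s_le1 l0 a01[OF x] by (intro mult_left_mono exp_drift_bounds) auto
    also have "\<dots> = exp (- \<beta> * ell 1 x) * (?n * s * (ell 1 x - ?a x + s * (ell 1 x + ?a x)))"
      by (simp add: algebra_simps)
    also have "\<dots> \<le> exp (- \<beta> * ell 1 x) * (?n * s * (ell 1 x - ?a x + 2 * e1))"
      using n s_pos by (intro mult_left_mono) auto
    finally show "gen (\<lambda>x. exp (- (s * Z 1 x))) x
       \<le> ?n * s * (exp (- \<beta> * ell 1 x) * (ell 1 x - ?a x + 2 * e1))"
      by (simp add: mult_ac)
  qed
  define l' where "l' = lam - d0 - 2 * e1"
  have pt: "\<beta> * (exp (- \<beta> * ell 1 x) * (ell 1 x - ?a x + 2 * e1))
     \<le> exp (- \<beta> * l') - exp (- \<beta> * ell 1 x) + \<beta> * exp (\<beta> * (eps * \<mu> 1)) * exp (- \<beta> * rr M x)"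
    if x: "x \<in> \<Omega>" for x
  proof (cases "(\<Sum>m\<in>{1..M}. Z m x) \<le> real N * (1 - eps)")
    case True
    have "lam * (1 - d0) \<le> ?a x"
      using lb[OF x True] rho_00[OF x] lam by (intro mult_left_mono) auto
    moreover have "lam * d0 \<le> d0" using lam d0 by (simp add: mult_left_le_one_le)
    ultimately have "ell 1 x - ?a x + 2 * e1 \<le> ell 1 x - l'"
      by (simp add: l'_def algebra_simps)
    then have "\<beta> * (exp (- \<beta> * ell 1 x) * (ell 1 x - ?a x + 2 * e1)) \<le> \<beta> * (exp (- \<beta> * ell 1 x) * (ell 1 x - l'))"
      using \<beta>_pos by (intro mult_left_mono) auto
    also have "\<dots> = exp (- \<beta> * ell 1 x) * (- \<beta> * l' - (- \<beta> * ell 1 x))" by (simp add: algebra_simps)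
    also have "\<dots> \<le> exp (- \<beta> * l') - exp (- \<beta> * ell 1 x)" by (rule exp_tangent)
    finally show ?thesis using \<beta>_pos by (smt (verit) exp_gt_zero mult_pos_pos)
  next
    case False
    have "(\<Sum>m\<in>{1..M}. Z m x) = Z 1 x + T M x"
      using sum_first_split[of M M "\<lambda>m. Z m x"] M_pos by (simp add: T_def)
    with False have "?n * (1 - eps) \<le> ?n * v 1 * ell 1 x + T M x"
      using Z_ell[OF one_in] by simp
    moreover have "T M x = ?n - ?n * v 1 * rr M x"
      using N_pos v1p by (simp add: rr_def Rs_M field_simps)
    ultimately have "?n * (v 1 * (rr M x - ell 1 x)) \<le> ?n * eps" by (simp add: algebra_simps)
    then have "v 1 * (rr M x - ell 1 x) \<le> eps" using N_pos by simp
    then have "\<mu> 1 * (v 1 * (rr M x - ell 1 x)) \<le> \<mu> 1 * eps"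
      using mu_pos[OF one_in] by (intro mult_left_mono) auto
    then have le: "rr M x - eps * \<mu> 1 \<le> ell 1 x"
      using mu1_v1 by (simp add: mult.assoc[symmetric] mult.commute[of _ eps])
    \<comment> \<open>With nearly all servers busy the arrival term is not controlled; the error of
      at most 1 is charged to \<open>rr M\<close> and causes the extra factor
      \<open>\<beta>\<close>.\<close>
    have "ell 1 x - ?a x + 2 * e1 \<le> (ell 1 x - l') + 1"
      using a01[OF x] lam d0 by (simp add: l'_def)
    then have "\<beta> * (exp (- \<beta> * ell 1 x) * (ell 1 x - ?a x + 2 * e1)) \<le> \<beta> * (exp (- \<beta> * ell 1 x) * ((ell 1 x - l') + 1))"
      using \<beta>_pos by (intro mult_left_mono) auto
    also have "\<dots> = exp (- \<beta> * ell 1 x) * (- \<beta> * l' - (- \<beta> * ell 1 x)) + \<beta> * exp (- \<beta> * ell 1 x)" by (simp add: algebra_simps)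
    also have "\<dots> \<le> exp (- \<beta> * l') - exp (- \<beta> * ell 1 x) + \<beta> * exp (- \<beta> * (rr M x - eps * \<mu> 1))"
      using le \<beta>_pos by (intro add_mono exp_tangent mult_left_mono) auto
    also have "exp (- \<beta> * (rr M x - eps * \<mu> 1)) = exp (\<beta> * (eps * \<mu> 1)) * exp (- \<beta> * rr M x)"
      by (simp add: exp_add[symmetric] algebra_simps)
    finally show ?thesis by simp
  qed
  have "0 \<le> \<beta> * expect (\<lambda>x. exp (- \<beta> * ell 1 x) * (ell 1 x - ?a x + 2 * e1))"
    using base \<beta>_pos by simp
  also have "\<dots> \<le> expect (\<lambda>x. exp (- \<beta> * l') - exp (- \<beta> * ell 1 x) + \<beta> * exp (\<beta> * (eps * \<mu> 1)) * exp (- \<beta> * rr M x))"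
    unfolding expect_cmult[symmetric] by (rule expect_mono) (rule pt)
  also have "\<dots> = exp (- \<beta> * l') - expect (\<lambda>x. exp (- \<beta> * ell 1 x)) + \<beta> * exp (\<beta> * (eps * \<mu> 1)) * expect (\<lambda>x. exp (- \<beta> * rr M x))"
    by (simp only: expect_add expect_diff expect_cmult expect_const)
  finally show ?thesis unfolding l'_def by simp
qed

text \<open>Inserting \<open>level_rr\<close> into the previous bound makes it self-referential in
  the exact shortfall of \<open>ell 1\<close>; since \<open>xi\<close> is below 1 it rules out a
  shortfall above \<open>nu + 4 * e1\<close>.\<close>

lemma level_ell_1:
  assumes eps: "0 \<le> eps" and d0: "0 \<le> d0" "d0 \<le> e1"
    and lb: "\<And>x. x \<in> \<Omega> \<Longrightarrow> (\<Sum>m\<in>{1..M}. Z m x) \<le> real N * (1 - eps) \<Longrightarrow> A1 b M rho x \<le> d0"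
    and nu: "lam = 1 - nu"
    and xi: "xi M \<mu> p < 1"
    and c1: "\<mu> 1 * CM M \<mu> p * e1 \<le> (1 - xi M \<mu> p) / 2 * nu"
    and c2: "eps * \<mu> 1 \<le> (1 - xi M \<mu> p) / 2 * nu"
    and L: "2 \<le> ln (real N)" "(ln (real N))\<^sup>2 \<le> \<beta> * e1" "2 \<le> (1 - xi M \<mu> p) * ln (real N)"
  shows "expect (\<lambda>x. exp (- \<beta> * ell 1 x)) \<le> exp (- \<beta> * (1 - (nu + 4 * e1)))"
proof (rule ccontr)
  let ?x = "expect (\<lambda>x. exp (- \<beta> * ell 1 x))" and ?\<xi> = "xi M \<mu> p"
  let ?L = "ln (real N)"
  assume "\<not> ?thesis"
  then have gt: "exp (- \<beta> * (1 - (nu + 4 * e1))) < ?x" by simp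
  then have xp: "0 < ?x" by (rule less_trans[OF exp_gt_zero])
  \<comment> \<open>The exact shortfall, so \<open>xd\<close> is an equality and
    \<open>level_rr\<close> applies with it.\<close>
  define \<delta> where "\<delta> = 1 + ln ?x / \<beta>"
  have xd: "?x = exp (- \<beta> * (1 - \<delta>))" using xp \<beta>_pos by (simp add: \<delta>_def)
  have d: "nu + 4 * e1 < \<delta>" using gt \<beta>_pos unfolding xd by simp
  have "FF \<delta> M / Rs M = ?\<xi> * \<delta> + \<mu> 1 * CM M \<mu> p * e1"
    using v_pos[OF one_in] mu_pos[OF one_in] unfolding Rs_M
    by (simp add: FF_def xi_def CM_def wprod_def v1 field_simps del: One_nat_def)
  with level_rr[of \<delta> M] M_pos xd
  have rM: "expect (\<lambda>x. exp (- \<beta> * rr M x)) \<le> exp (- \<beta> * (1 - (?\<xi> * \<delta> + \<mu> 1 * CM M \<mu> p * e1)))"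
    by simp
  have "?x \<le> exp (- \<beta> * (lam - d0 - 2 * e1)) + \<beta> * exp (\<beta> * (eps * \<mu> 1)) * expect (\<lambda>x. exp (- \<beta> * rr M x))"
    by (rule ell_1_level_step[OF eps d0(1) lb])
  also have "\<dots> \<le> ?x * exp (- \<beta> * e1) + ?x * (\<beta> * exp (- \<beta> * (4 * (1 - ?\<xi>) * e1)))"
  proof (rule add_mono)
    have "exp (- \<beta> * (lam - d0 - 2 * e1)) \<le> exp (- \<beta> * (1 - \<delta> + e1))"
      using d d0 nu \<beta>_pos by simp
    then show "exp (- \<beta> * (lam - d0 - 2 * e1)) \<le> ?x * exp (- \<beta> * e1)"
      unfolding xd by (simp add: exp_add[symmetric] algebra_simps)
    \<comment> \<open>The two halves of \<open>(1 - ?\<xi>) * nu\<close> pay for the phase noise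
      (\<open>c1\<close>) and for \<open>eps\<close> (\<open>c2\<close>); the gain
      \<open>4 * (1 - ?\<xi>) * e1\<close> remains.\<close>
    have "(1 - ?\<xi>) * (nu + 4 * e1) \<le> (1 - ?\<xi>) * \<delta>" using d xi by (intro mult_left_mono) auto
    then have "eps * \<mu> 1 - (1 - (?\<xi> * \<delta> + \<mu> 1 * CM M \<mu> p * e1)) \<le> - (1 - \<delta> + 4 * (1 - ?\<xi>) * e1)"
      using c1 c2 by (simp add: field_simps)
    then have "\<beta> * (eps * \<mu> 1 - (1 - (?\<xi> * \<delta> + \<mu> 1 * CM M \<mu> p * e1))) \<le> \<beta> * - (1 - \<delta> + 4 * (1 - ?\<xi>) * e1)"
      using \<beta>_pos by (intro mult_left_mono) auto
    then have "exp (\<beta> * (eps * \<mu> 1) + - \<beta> * (1 - (?\<xi> * \<delta> + \<mu> 1 * CM M \<mu> p * e1)))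
        \<le> exp (- \<beta> * (1 - \<delta>) + - \<beta> * (4 * (1 - ?\<xi>) * e1))"
      unfolding exp_le_cancel_iff by (simp add: algebra_simps)
    then have "exp (\<beta> * (eps * \<mu> 1)) * exp (- \<beta> * (1 - (?\<xi> * \<delta> + \<mu> 1 * CM M \<mu> p * e1)))
        \<le> ?x * exp (- \<beta> * (4 * (1 - ?\<xi>) * e1))"
      unfolding xd exp_add .
    moreover have "exp (\<beta> * (eps * \<mu> 1)) * expect (\<lambda>x. exp (- \<beta> * rr M x))
        \<le> exp (\<beta> * (eps * \<mu> 1)) * exp (- \<beta> * (1 - (?\<xi> * \<delta> + \<mu> 1 * CM M \<mu> p * e1)))"
      using rM by (intro mult_left_mono) auto
    ultimately have "exp (\<beta> * (eps * \<mu> 1)) * expect (\<lambda>x. exp (- \<beta> * rr M x)) \<le> ?x * exp (- \<beta> * (4 * (1 - ?\<xi>) * e1))"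
      by linarith
    then have "\<beta> * (exp (\<beta> * (eps * \<mu> 1)) * expect (\<lambda>x. exp (- \<beta> * rr M x))) \<le> \<beta> * (?x * exp (- \<beta> * (4 * (1 - ?\<xi>) * e1)))"
      using \<beta>_pos by (intro mult_left_mono) auto
    then show "\<beta> * exp (\<beta> * (eps * \<mu> 1)) * expect (\<lambda>x. exp (- \<beta> * rr M x)) \<le> ?x * (\<beta> * exp (- \<beta> * (4 * (1 - ?\<xi>) * e1)))"
      by (simp add: mult_ac)
  qed
  finally have "?x * 1 \<le> ?x * (exp (- \<beta> * e1) + \<beta> * exp (- \<beta> * (4 * (1 - ?\<xi>) * e1)))"
    by (simp add: distrib_left)
  then have one: "1 \<le> exp (- \<beta> * e1) + \<beta> * exp (- \<beta> * (4 * (1 - ?\<xi>) * e1))"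
    using xp by (simp only: mult_le_cancel_left_pos)
  \<comment> \<open>Both terms on the right of \<open>one\<close> will be at most
    \<open>exp (- 1)\<close>, so their sum is below 1.\<close>
  have e2: "exp (- 1 :: real) < 1 / 2"
    using exp_lower_Taylor_quadratic[of "1::real"] by (simp add: exp_minus field_simps)
  have "4 \<le> ?L\<^sup>2" using L(1) power_mono[of 2 ?L 2] by simp
  then have "exp (- \<beta> * e1) \<le> exp (- 1)" using L(2) by simp
  moreover have "\<beta> * exp (- \<beta> * (4 * (1 - ?\<xi>) * e1)) \<le> exp (- 1)"
  proof -
    \<comment> \<open>The prefactor \<open>\<beta> \<le> exp ?L\<close> is beaten by the exponent
      \<open>- 8 * ?L\<close>, which comes from multiplying the bounds in \<open>L\<close>.\<close>
    have "\<beta> \<le> real N"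
    proof -
      have "e1 * vb\<^sup>2 \<le> 1" using e1 vb_le_1 vbar_pos by (intro mult_le_one power_le_one) auto
      then have "real N * (e1 * vb\<^sup>2) \<le> real N" using N_pos by (simp add: mult_left_le)
      then show ?thesis by (simp add: \<beta>_def mult_ac)
    qed
    also have "real N = exp ?L" using N_pos by simp
    finally have bN: "\<beta> \<le> exp ?L" .
    have "2 * ?L \<le> (1 - ?\<xi>) * ?L * ?L" using L by (intro mult_right_mono) auto
    also have "\<dots> = (1 - ?\<xi>) * ?L\<^sup>2" by (simp add: power2_eq_square)
    also have "\<dots> \<le> (1 - ?\<xi>) * (\<beta> * e1)" using L(2) xi by (intro mult_left_mono) auto
    finally have "- \<beta> * (4 * (1 - ?\<xi>) * e1) \<le> - 8 * ?L" by (simp add: algebra_simps)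
    then have "\<beta> * exp (- \<beta> * (4 * (1 - ?\<xi>) * e1)) \<le> exp ?L * exp (- 8 * ?L)"
      using bN \<beta>_pos by (intro mult_mono) auto
    also have "\<dots> = exp (- 7 * ?L)" by (simp add: exp_add[symmetric])
    also have "\<dots> \<le> exp (- 1)" using L(1) by simp
    finally show ?thesis .
  qed
  ultimately show False using one e2 by linarith
qed

end

section \<open>Collapse of the queues\<close>

text \<open>Beyond \<open>c\<close> the exponential is continued linearly: on the rare states where the drift is not
  controlled its slope must not exceed a level that their probability can compensate.\<close>
definition elin :: "real \<Rightarrow> real \<Rightarrow> real \<Rightarrow> real" where
  "elin B c u = exp (B * min u c) * (1 + B * (u - min u c))"

text \<open>The derivative of \<open>elin B c\<close>, which stays constant beyond
  \<open>c\<close>.\<close>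

definition elin' :: "real \<Rightarrow> real \<Rightarrow> real \<Rightarrow> real" where
  "elin' B c u = B * exp (B * min u c)"

text \<open>The slope is nondecreasing; an interval containing the kink \<open>c\<close> is cut
  there and the slopes of the pieces are compared.\<close>

lemma elin_convex:
  assumes "0 \<le> B" "u \<le> t"
  shows "elin' B c u * (t - u) \<le> elin B c t - elin B c u"
    and "elin B c t - elin B c u \<le> elin' B c t * (t - u)"
proof -
  have below: "elin' B c u * (t - u) \<le> elin B c t - elin B c u \<and> elin B c t - elin B c u \<le> elin' B c t * (t - u)"
    if "u \<le> t" "t \<le> c" for u t
    using that exp_tangent[of "B * u" "B * t"] exp_tangent[of "B * t" "B * u"]
    by (simp add: elin_def elin'_def algebra_simps)
  have above: "elin' B c u * (t - u) = elin B c t - elin B c u \<and> elin' B c u = elin' B c c \<and> elin' B c t = elin' B c c"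
    if "c \<le> u" "c \<le> t" for u t
    using that by (simp add: elin_def elin'_def algebra_simps)
  have mono: "elin' B c u \<le> elin' B c t" if "u \<le> t" for u t
    unfolding elin'_def using assms(1) that by (intro mult_left_mono) (auto intro: mult_left_mono)
  have "elin' B c u * (t - u) \<le> elin B c t - elin B c u \<and> elin B c t - elin B c u \<le> elin' B c t * (t - u)"
  proof (cases "t \<le> c \<or> c \<le> u")
    case True
    then show ?thesis using below[OF assms(2)] above[of u t] assms(2) by auto
  next
    case False
    then have c: "u \<le> c" "c \<le> t" by auto
    have "elin' B c u * (t - u) = elin' B c u * (t - c) + elin' B c u * (c - u)"
      by (simp add: algebra_simps)
    moreover have "elin' B c u * (t - c) \<le> elin' B c c * (t - c)" using mono[OF c(1)] c by (intro mult_right_mono) auto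
    moreover have "elin' B c t * (t - u) = elin' B c t * (t - c) + elin' B c t * (c - u)"
      by (simp add: algebra_simps)
    moreover have "elin' B c c * (c - u) \<le> elin' B c t * (c - u)" using mono[OF c(2)] c by (intro mult_right_mono) auto
    ultimately show ?thesis using below[OF c(1)] above[of c t] c by simp
  qed
  then show "elin' B c u * (t - u) \<le> elin B c t - elin B c u"
    and "elin B c t - elin B c u \<le> elin' B c t * (t - u)" by auto
qed

lemma elin'_nonneg: "0 \<le> B \<Longrightarrow> 0 \<le> elin' B c u" by (simp add: elin'_def)

lemma elin_mono: "0 \<le> B \<Longrightarrow> u \<le> t \<Longrightarrow> elin B c u \<le> elin B c t"
  using elin_convex(1)[of B u t c] elin'_nonneg[of B c u] mult_nonneg_nonneg[of "elin' B c u" "t - u"] by linarith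

text \<open>Over a distance \<open>h\<close> the slope grows at most by the factor
  \<open>exp (B * h)\<close>, also across the kink.\<close>

lemma elin_up:
  assumes "0 \<le> B" "0 \<le> h"
  shows "elin B c (u + h) - elin B c u \<le> elin' B c u * exp (B * h) * h"
proof -
  have "elin' B c (u + h) \<le> elin' B c u * exp (B * h)"
    unfolding elin'_def mult.assoc exp_add[symmetric] distrib_left[symmetric] using assms
    by (intro mult_left_mono) (auto intro!: mult_left_mono)
  then have "elin' B c (u + h) * h \<le> elin' B c u * exp (B * h) * h" using assms by (intro mult_right_mono)
  then show ?thesis using elin_convex(2)[of B u "u + h" c] assms by simp
qed

lemma elin_down:
  assumes "0 \<le> B" "0 \<le> h"
  shows "elin' B c u * exp (- (B * h)) * h \<le> elin B c u - elin B c (u - h)"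
proof -
  have "elin' B c u * exp (- (B * h)) = B * exp (B * (min u c - h))"
    unfolding elin'_def mult.assoc exp_add[symmetric] by (simp add: algebra_simps)
  also have "\<dots> \<le> elin' B c (u - h)"
    unfolding elin'_def using assms
    by (intro mult_left_mono) (auto intro!: mult_left_mono)
  finally have "elin' B c u * exp (- (B * h)) * h \<le> elin' B c (u - h) * h" using assms by (intro mult_right_mono)
  then show ?thesis using elin_convex(1)[of B "u - h" u c] assms by simp
qed

section \<open>Drifts of waiting jobs, busy servers and total jobs\<close>

context lb_chain begin

text \<open>Jumps from \<open>x\<close> have nonnegative rates, so a function touching
  \<open>F\<close> from above at \<open>x\<close> has the larger drift there. This handles minima
  without differentiability.\<close>

lemma gen_mono:
  assumes "x \<in> \<Omega>" "F x = G x" "\<And>y. F y \<le> G y"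
  shows "gen F x \<le> gen G x"
  unfolding gen_def assms(2)
  using lam assms(3) rho_nonneg[OF assms(1)] mu_pos p_range w_pos
  by (intro add_mono sum_mono mult_left_mono diff_right_mono mult_nonneg_nonneg)
     (auto intro: less_imp_le)

abbreviation "queue \<equiv> lin b M (\<lambda>q _. real q - 1)"
abbreviation "busyc \<equiv> lin b M (\<lambda>_ _. 1)"
abbreviation "jobs \<equiv> lin b M (\<lambda>q _. real q)"

lemma busyc_Z: "busyc x = (\<Sum>m\<in>{1..M}. Z m x)"
  using lin_Z[of "\<lambda>_. 1"] by simp

lemma jobs_eq: "jobs x = queue x + busyc x"
  unfolding lin_def sum.distrib[symmetric] by (intro sum.cong) (auto simp: algebra_simps)

lemma queue_nonneg: "0 \<le> queue x" by (intro lin_nonneg) auto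

lemma jobs_le: assumes "x \<in> \<Omega>" shows "jobs x \<le> real b * real N"
proof -
  have "jobs x \<le> lin b M (\<lambda>_ _. real b * 1) x" by (intro lin_mono) auto
  also have "\<dots> = real b * busyc x" by (simp only: lin_scale)
  also have "\<dots> \<le> real b * real N" using states_lin[OF assms] by (intro mult_left_mono) auto
  finally show ?thesis .
qed

definition dep_total :: "cstate \<Rightarrow> real" where
  "dep_total x = (\<Sum>m\<in>{1..M}. w m * Z m x)"

text \<open>Departures that release a waiting job: they shorten the queue and leave no server
  idle.\<close>

definition dep_queue :: "cstate \<Rightarrow> real" where
  "dep_queue x = (\<Sum>q\<in>{2..b}. \<Sum>m\<in>{1..M}. w m * real (x q m))"

lemma split_1b: "(\<Sum>q\<in>{1..b}. f q) = f 1 + (\<Sum>q\<in>{2..b}. (f q :: real))"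
proof -
  have "{1..b} = insert 1 {2..b}" using b_pos by auto
  then show ?thesis by simp
qed

lemma dep_total_split: "dep_total x = (\<Sum>m\<in>{1..M}. w m * real (x 1 m)) + dep_queue x"
proof -
  have "dep_total x = (\<Sum>q\<in>{1..b}. \<Sum>m\<in>{1..M}. w m * real (x q m))"
    unfolding dep_total_def Z_def sum_distrib_left by (rule sum.swap)
  then show ?thesis unfolding split_1b dep_queue_def .
qed

lemma dep_total_nonneg: "0 \<le> dep_total x"
  unfolding dep_total_def using w_pos Z_nonneg by (intro sum_nonneg mult_nonneg_nonneg) (auto intro: less_imp_le)

text \<open>A server contributes at most \<open>b\<close> waiting jobs, so long queues force many
  servers with a waiting job.\<close>

lemma dep_queue_ge:
  assumes wlo: "0 \<le> wlo" "\<And>m. m \<in> {1..M} \<Longrightarrow> wlo \<le> w m"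
  shows "wlo / real b * queue x \<le> dep_queue x"
proof -
  have "wlo / real b * queue x = (\<Sum>q\<in>{2..b}. \<Sum>m\<in>{1..M}. wlo / real b * ((real q - 1) * real (x q m)))"
    unfolding lin_def sum_distrib_left by (subst split_1b) simp
  also have "\<dots> \<le> dep_queue x"
    unfolding dep_queue_def
  proof (intro sum_mono)
    fix q m assume qm: "q \<in> {2..b}" "m \<in> {1..M}"
    have "wlo / real b * (real q - 1) \<le> wlo / real b * real b" using qm wlo by (intro mult_left_mono) auto
    also have "\<dots> = wlo" using b_pos by simp
    also have "\<dots> \<le> w m" using wlo qm by simp
    finally show "wlo / real b * ((real q - 1) * real (x q m)) \<le> w m * real (x q m)"
      unfolding mult.assoc[symmetric] by (intro mult_right_mono) auto
  qed
  finally show ?thesis .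
qed

lemma rho_sum_le: assumes "x \<in> \<Omega>" shows "(\<Sum>q\<in>{1..<b}. \<Sum>m\<in>{1..M}. rho x q m) \<le> A1 b M rho x"
  unfolding A1_def using rho_nonneg[OF assms] by (intro sum_mono2) (auto intro: sum_nonneg)

text \<open>Only arrivals at busy servers and departures with a waiting job move the queue.
  Discarded arrivals are counted in \<open>A1\<close>, which is harmless because \<open>U\<close> is
  nonnegative.\<close>

lemma gen_queue:
  assumes x: "x \<in> \<Omega>" and n: "n = real N" and u: "u = queue x / n - a"
    and up: "\<phi> (u + 1 / n) - \<phi> u \<le> U" "0 \<le> U" and dn: "D \<le> \<phi> u - \<phi> (u - 1 / n)"
  shows "gen (\<lambda>x. \<phi> (queue x / n - a)) x \<le> lam * n * A1 b M rho x * U - dep_queue x * D"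
proof -
  have n0: "0 < n" using n N_pos by simp
  have e: "(queue x + 1) / n - a = u + 1 / n" "(queue x - 1) / n - a = u - 1 / n"
    by (auto simp: u add_divide_distrib diff_divide_distrib)
  have "gen (\<lambda>x. \<phi> (queue x / n - a)) x =
      (\<Sum>q\<in>{1..<b}. \<Sum>m\<in>{1..M}. lam * n * rho x q m * (\<phi> (u + 1 / n) - \<phi> u))
    + (\<Sum>q\<in>{2..b}. \<Sum>m\<in>{1..M}. real (x q m) * w m * (\<phi> (u - 1 / n) - \<phi> u))"
  proof -
    have d: "(\<Sum>q\<in>{1..b}. \<Sum>m\<in>{1..M}. real (x q m) * w m * (\<phi> ((queue x - (real q - 1) + (if q = 1 then 0 else real (q - 1) - 1)) / n - a) - \<phi> (queue x / n - a)))
      = (\<Sum>q\<in>{2..b}. \<Sum>m\<in>{1..M}. real (x q m) * w m * (\<phi> (u - 1 / n) - \<phi> u))"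
      by (subst split_1b) (auto simp: u[symmetric] e(2)[symmetric] of_nat_diff intro!: sum.cong)
    have a: "(\<Sum>q\<in>{1..<b}. \<Sum>m\<in>{1..M}. lam * n * rho x q m * (\<phi> ((queue x - (real q - 1) + (real (q + 1) - 1)) / n - a) - \<phi> (queue x / n - a)))
      = (\<Sum>q\<in>{1..<b}. \<Sum>m\<in>{1..M}. lam * n * rho x q m * (\<phi> (u + 1 / n) - \<phi> u))"
      by (auto simp: u[symmetric] e(1)[symmetric] intro!: sum.cong)
    show ?thesis
      unfolding gen_lin[OF x, where \<phi> = "\<lambda>u. \<phi> (u / n - a)"] n[symmetric] d a by simp
  qed
  also have "(\<Sum>q\<in>{1..<b}. \<Sum>m\<in>{1..M}. lam * n * rho x q m * (\<phi> (u + 1 / n) - \<phi> u))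
     \<le> (\<Sum>q\<in>{1..<b}. \<Sum>m\<in>{1..M}. lam * n * rho x q m * U)"
    using up lam n0 rho_nonneg[OF x] by (intro sum_mono mult_left_mono) auto
  also have "\<dots> = lam * n * (\<Sum>q\<in>{1..<b}. \<Sum>m\<in>{1..M}. rho x q m) * U"
    by (simp add: sum_distrib_left sum_distrib_right)
  also have "\<dots> \<le> lam * n * A1 b M rho x * U"
    using rho_sum_le[OF x] lam n0 up by (intro mult_right_mono mult_left_mono) auto
  also have "(\<Sum>q\<in>{2..b}. \<Sum>m\<in>{1..M}. real (x q m) * w m * (\<phi> (u - 1 / n) - \<phi> u)) \<le>
     (\<Sum>q\<in>{2..b}. \<Sum>m\<in>{1..M}. real (x q m) * w m * (- D))"
    using dn w_pos by (intro sum_mono mult_left_mono mult_nonneg_nonneg) (auto intro: less_imp_le)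
  also have "\<dots> = - dep_queue x * D"
    by (simp add: dep_queue_def sum_distrib_left sum_distrib_right sum_negf mult_ac)
  finally show ?thesis by simp
qed

text \<open>The deficit of busy servers grows only when a server with a single job finishes, and
  shrinks only when an idle server is chosen.\<close>

lemma gen_idle:
  assumes x: "x \<in> \<Omega>" and n: "n = real N" and u: "u = a - busyc x / n"
    and up: "\<phi> (u + 1 / n) - \<phi> u \<le> U" and dn: "D \<le> \<phi> u - \<phi> (u - 1 / n)"
  shows "gen (\<lambda>x. \<phi> (a - busyc x / n)) x \<le> (dep_total x - dep_queue x) * U - lam * n * (1 - A1 b M rho x) * D"
proof -
  have n0: "0 < n" using n N_pos by simp
  have e: "a - (busyc x - 1) / n = u + 1 / n" "a - (busyc x + 1) / n = u - 1 / n"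
    by (auto simp: u add_divide_distrib diff_divide_distrib)
  have d: "(\<Sum>q\<in>{1..b}. \<Sum>m\<in>{1..M}. real (x q m) * w m * (\<phi> (a - (busyc x - 1 + (if q = 1 then 0 else 1)) / n) - \<phi> (a - busyc x / n)))
      = (\<Sum>m\<in>{1..M}. w m * real (x 1 m)) * (\<phi> (u + 1 / n) - \<phi> u)"
    by (subst split_1b) (auto simp: u[symmetric] e(1)[symmetric] sum_distrib_left sum_distrib_right mult_ac)
  have "gen (\<lambda>x. \<phi> (a - busyc x / n)) x =
      lam * n * rho x 0 0 * (\<phi> (u - 1 / n) - \<phi> u) + (\<Sum>m\<in>{1..M}. w m * real (x 1 m)) * (\<phi> (u + 1 / n) - \<phi> u)"
    unfolding gen_lin[OF x, where \<phi> = "\<lambda>u. \<phi> (a - u / n)"] n[symmetric] d e(2) by (simp add: u[symmetric])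
  also have "\<dots> \<le> lam * n * rho x 0 0 * (- D) + (\<Sum>m\<in>{1..M}. w m * real (x 1 m)) * U"
    using up dn lam n0 rho_nonneg[OF x] w_pos
    by (intro add_mono mult_left_mono mult_nonneg_nonneg sum_nonneg) (auto intro: less_imp_le)
  finally show ?thesis unfolding rho_00[OF x] using dep_total_split[of x] by simp
qed

lemma gen_jobs:
  assumes x: "x \<in> \<Omega>" and n: "n = real N" and u: "u = jobs x / n - a"
    and up: "\<phi> (u + 1 / n) - \<phi> u \<le> U" "0 \<le> U" and dn: "\<phi> (u - 1 / n) - \<phi> u \<le> D"
  shows "gen (\<lambda>x. \<phi> (jobs x / n - a)) x \<le> lam * n * U + dep_total x * D"
proof -
  have n0: "0 < n" using n N_pos by simp
  have e: "(jobs x + 1) / n - a = u + 1 / n" "(jobs x - 1) / n - a = u - 1 / n"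
    by (auto simp: u add_divide_distrib diff_divide_distrib)
  have d: "(\<Sum>q\<in>{1..b}. \<Sum>m\<in>{1..M}. real (x q m) * w m * (\<phi> ((jobs x - real q + (if q = 1 then 0 else real (q - 1))) / n - a) - \<phi> (jobs x / n - a)))
      = dep_total x * (\<phi> (u - 1 / n) - \<phi> u)"
  proof -
    have "(\<Sum>q\<in>{1..b}. \<Sum>m\<in>{1..M}. real (x q m) * w m * (\<phi> ((jobs x - real q + (if q = 1 then 0 else real (q - 1))) / n - a) - \<phi> (jobs x / n - a)))
      = (\<Sum>q\<in>{1..b}. \<Sum>m\<in>{1..M}. w m * real (x q m) * (\<phi> (u - 1 / n) - \<phi> u))"
      by (auto simp: u[symmetric] e(2)[symmetric] of_nat_diff intro!: sum.cong)
    also have "\<dots> = (\<Sum>m\<in>{1..M}. \<Sum>q\<in>{1..b}. w m * real (x q m) * (\<phi> (u - 1 / n) - \<phi> u))"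
      by (rule sum.swap)
    finally show ?thesis by (simp add: dep_total_def Z_def sum_distrib_left sum_distrib_right)
  qed
  have a: "(\<Sum>q\<in>{1..<b}. \<Sum>m\<in>{1..M}. lam * n * rho x q m * (\<phi> ((jobs x - real q + real (q + 1)) / n - a) - \<phi> (jobs x / n - a)))
      = lam * n * (\<Sum>q\<in>{1..<b}. \<Sum>m\<in>{1..M}. rho x q m) * (\<phi> (u + 1 / n) - \<phi> u)"
    by (auto simp: u[symmetric] e(1)[symmetric] sum_distrib_left sum_distrib_right intro!: sum.cong)
  let ?r = "rho x 0 0 + (\<Sum>q\<in>{1..<b}. \<Sum>m\<in>{1..M}. rho x q m)"
  have "gen (\<lambda>x. \<phi> (jobs x / n - a)) x = lam * n * ?r * (\<phi> (u + 1 / n) - \<phi> u) + dep_total x * (\<phi> (u - 1 / n) - \<phi> u)"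
    unfolding gen_lin[OF x, where \<phi> = "\<lambda>u. \<phi> (u / n - a)"] n[symmetric] d a
    by (simp add: u[symmetric] e(1)[symmetric] algebra_simps)
  also have "\<dots> \<le> lam * n * ?r * U + dep_total x * D"
    using up dn lam n0 rho_nonneg[OF x] dep_total_nonneg
    by (intro add_mono mult_left_mono mult_nonneg_nonneg add_nonneg_nonneg sum_nonneg) auto
  also have "lam * n * ?r * U \<le> lam * n * U"
    using rho_sum_le[OF x] rho_00[OF x] lam n0 up by (intro mult_right_mono mult_left_le) auto
  finally show ?thesis by simp
qed

end

section \<open>Departure rates on good states, collapse and mean excess\<close>

context lb_coxian begin

definition good :: "(nat \<Rightarrow> real) \<Rightarrow> cstate \<Rightarrow> bool" where
  "good th x \<longleftrightarrow> (\<forall>m\<in>{1..M}. lam * v m - th m \<le> Z m x / real N)"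

text \<open>On good states every bracket on the left is nonnegative. Choosing
  \<open>\<omega>\<close> below or above all \<open>w m\<close> fixes the sign of the sum and yields
  the two bounds on \<open>dep_total\<close>.\<close>

lemma dep_weighted:
  fixes \<omega> :: real
  shows "(\<Sum>m\<in>{1..M}. (w m - \<omega>) * (Z m x / real N - lam * v m + th m)) =
    dep_total x / real N - lam - \<omega> * (busyc x / real N - lam) + ((\<Sum>m\<in>{1..M}. th m * w m) - \<omega> * (\<Sum>m\<in>{1..M}. th m))"
proof -
  have "(\<Sum>m\<in>{1..M}. (w m - \<omega>) * (Z m x / real N - lam * v m + th m)) =
     (\<Sum>m\<in>{1..M}. w m * Z m x / real N - lam * (w m * v m) - \<omega> * (Z m x / real N - lam * v m) + (th m * w m - \<omega> * th m))"
    by (intro sum.cong) (auto simp: algebra_simps diff_divide_distrib)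
  also have "\<dots> = (\<Sum>m\<in>{1..M}. w m * Z m x / real N) - lam * (\<Sum>m\<in>{1..M}. w m * v m)
     - \<omega> * ((\<Sum>m\<in>{1..M}. Z m x / real N) - lam * (\<Sum>m\<in>{1..M}. v m)) + ((\<Sum>m\<in>{1..M}. th m * w m) - \<omega> * (\<Sum>m\<in>{1..M}. th m))"
    by (simp only: sum.distrib sum_subtractf sum_distrib_left[symmetric])
  finally show ?thesis
    unfolding sum_wv_all v_norm busyc_Z dep_total_def by (simp add: sum_divide_distrib)
qed

lemma goodD: "good th x \<Longrightarrow> m \<in> {1..M} \<Longrightarrow> 0 \<le> Z m x / real N - lam * v m + th m"
  unfolding good_def by (drule (1) bspec) linarith

lemma dep_total_lower:
  assumes "good th x" "\<And>m. m \<in> {1..M} \<Longrightarrow> wlo \<le> w m"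
  shows "lam + wlo * (busyc x / real N - lam) - ((\<Sum>m\<in>{1..M}. th m * w m) - wlo * (\<Sum>m\<in>{1..M}. th m)) \<le> dep_total x / real N"
proof -
  have "0 \<le> (\<Sum>m\<in>{1..M}. (w m - wlo) * (Z m x / real N - lam * v m + th m))"
    using assms by (intro sum_nonneg mult_nonneg_nonneg goodD) auto
  then show ?thesis unfolding dep_weighted by simp
qed

lemma dep_total_upper:
  assumes "good th x" "\<And>m. m \<in> {1..M} \<Longrightarrow> w m \<le> whi"
  shows "dep_total x / real N \<le> lam + whi * (busyc x / real N - lam) + (whi * (\<Sum>m\<in>{1..M}. th m) - (\<Sum>m\<in>{1..M}. th m * w m))"
proof -
  have "(\<Sum>m\<in>{1..M}. (w m - whi) * (Z m x / real N - lam * v m + th m)) \<le> 0"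
    using assms by (intro sum_nonpos mult_nonpos_nonneg goodD) auto
  then show ?thesis unfolding dep_weighted by simp
qed

lemma dep_total_le:
  assumes "x \<in> \<Omega>" "\<And>m. m \<in> {1..M} \<Longrightarrow> w m \<le> whi" "0 \<le> whi"
  shows "dep_total x / real N \<le> whi"
proof -
  have "dep_total x \<le> whi * (\<Sum>m\<in>{1..M}. Z m x)"
    unfolding dep_total_def sum_distrib_left using assms Z_nonneg by (intro sum_mono mult_right_mono) auto
  also have "\<dots> \<le> whi * real N" using Z_sum_le[OF assms(1)] assms by (intro mult_left_mono) auto
  finally show ?thesis using N_pos by (simp add: field_simps)
qed

text \<open>The minimum \<open>V\<close> never exceeds either of its arguments, so its drift is bounded by that of the active one
  and the kink does no harm.\<close>
lemma queue_collapse: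
  fixes \<sigma> a1 a2 :: real
  defines "n \<equiv> real N"
  defines "V \<equiv> \<lambda>x. min (queue x / n - a1) (a2 - busyc x / n)"
  assumes wlo: "0 < wlo" "\<And>m. m \<in> {1..M} \<Longrightarrow> wlo \<le> w m"
    and whi: "1 \<le> whi" "\<And>m. m \<in> {1..M} \<Longrightarrow> w m \<le> whi"
    and \<sigma>: "0 < \<sigma>" "\<sigma> \<le> 1 / 5" and \<Delta>: "\<Delta> = wlo / real b * a1" "16 * \<sigma> \<le> \<Delta>"
    and d0: "0 \<le> d0" "d0 \<le> \<Delta> / 4"
    and a2: "whi * (a2 - lam) + (whi * (\<Sum>m\<in>{1..M}. th m) - (\<Sum>m\<in>{1..M}. th m * w m)) \<le> \<Delta> / 4"
    and lb: "\<And>x. x \<in> \<Omega> \<Longrightarrow> busyc x / n \<le> a2 \<Longrightarrow> A1 b M rho x \<le> d0"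
    and c: "0 < c" and B: "B = n * \<sigma>"
  shows "\<Delta> / 4 * exp (B * c) * expect (\<lambda>x. of_bool (c \<le> V x \<and> good th x))
    \<le> 2 * whi + 2 * whi * exp (B * c) * expect (\<lambda>x. of_bool (\<not> good th x))"
proof -
  have n0: "0 < n" using N_pos by (simp add: n_def)
  have B0: "0 < B" using n0 \<sigma> by (simp add: B)
  have Bn: "B * (1 / n) = \<sigma>" using n0 by (simp add: B)
  have \<Delta>0: "0 < \<Delta>" using \<Delta>(2) \<sigma> by simp
  have exps: "exp \<sigma> \<le> 1 + 2 * \<sigma>" "1 - 2 * \<sigma> \<le> exp (- \<sigma>)"
  proof -
    have "\<sigma>\<^sup>2 \<le> \<sigma>" using \<sigma> by (simp add: power2_eq_square mult_left_le)
    then show "exp \<sigma> \<le> 1 + 2 * \<sigma>" using exp_bound[of \<sigma>] \<sigma> by simp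
    show "1 - 2 * \<sigma> \<le> exp (- \<sigma>)" using exp_ge_add_one_self[of "- \<sigma>"] \<sigma> by linarith
  qed
  \<comment> \<open>While \<open>V x\<close> is positive the long queue forces departures with a
    waiting job at rate at least \<open>\<Delta>\<close>, and few busy servers force
    \<open>A1\<close> below \<open>d0\<close>. Elsewhere a crude bound suffices.\<close>
  have drift: "gen (\<lambda>x. elin B c (V x)) x \<le> elin' B c (V x) * (if 0 < V x \<and> good th x then - \<Delta> / 4 else 2 * whi)"
    if x: "x \<in> \<Omega>" for x
  proof -
    define g where "g = elin' B c (V x)"
    have g0: "0 \<le> g" using elin'_nonneg B0 by (simp add: g_def)
    have up: "elin B c (V x + 1 / n) - elin B c (V x) \<le> g * (1 + 2 * \<sigma>) / n"
    proof -
      have "elin B c (V x + 1 / n) - elin B c (V x) \<le> g * exp \<sigma> * (1 / n)"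
        using elin_up[of B "1 / n" c "V x"] B0 n0 unfolding Bn g_def by simp
      also have "\<dots> \<le> g * (1 + 2 * \<sigma>) * (1 / n)"
        using exps g0 n0 by (intro mult_right_mono mult_left_mono) auto
      finally show ?thesis by simp
    qed
    have dn: "g * (1 - 2 * \<sigma>) / n \<le> elin B c (V x) - elin B c (V x - 1 / n)"
    proof -
      have "g * (1 - 2 * \<sigma>) * (1 / n) \<le> g * exp (- \<sigma>) * (1 / n)"
        using exps g0 n0 by (intro mult_right_mono mult_left_mono) auto
      also have "\<dots> \<le> elin B c (V x) - elin B c (V x - 1 / n)"
        using elin_down[of B "1 / n" c "V x"] B0 n0 unfolding Bn g_def by simp
      finally show ?thesis by simp
    qed
    have U0: "0 \<le> g * (1 + 2 * \<sigma>) / n" using g0 \<sigma> n0 by simp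
    have A1b: "0 \<le> A1 b M rho x" "A1 b M rho x \<le> 1" using A1_nonneg[OF x] A1_le_1[OF x] .
    have dq0: "0 \<le> dep_queue x"
      unfolding dep_queue_def using w_pos by (intro sum_nonneg mult_nonneg_nonneg) (auto intro: less_imp_le)
    have dtq: "0 \<le> dep_total x - dep_queue x"
      unfolding dep_total_split using w_pos by (auto intro!: sum_nonneg mult_nonneg_nonneg intro: less_imp_le)
    have dqD: "\<Delta> \<le> dep_queue x / n" if "0 < V x"
    proof -
      have "a1 \<le> queue x / n" using that by (simp add: V_def)
      then have "\<Delta> \<le> wlo / real b * (queue x / n)"
        unfolding \<Delta>(1) using wlo by (intro mult_left_mono) auto
      also have "\<dots> = (wlo / real b * queue x) / n" by simp
      also have "\<dots> \<le> dep_queue x / n"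
        using dep_queue_ge[of wlo x] wlo n0 by (intro divide_right_mono) auto
      finally show ?thesis .
    qed
    have A1d: "A1 b M rho x \<le> d0" if "0 < V x" using that by (intro lb[OF x]) (simp add: V_def)
    show ?thesis
    proof (cases "queue x / n - a1 \<le> a2 - busyc x / n")
      case True
      then have Vx: "V x = queue x / n - a1" by (simp add: V_def)
      have "gen (\<lambda>x. elin B c (V x)) x \<le> gen (\<lambda>x. elin B c (queue x / n - a1)) x"
        by (rule gen_mono[OF x]) (use Vx B0 in \<open>auto simp: V_def intro!: elin_mono\<close>)
      also have "\<dots> \<le> lam * n * A1 b M rho x * (g * (1 + 2 * \<sigma>) / n) - dep_queue x * (g * (1 - 2 * \<sigma>) / n)"
        by (rule gen_queue[OF x n_def[THEN meta_eq_to_obj_eq] Vx up U0 dn])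
      also have "\<dots> = g * (lam * A1 b M rho x * (1 + 2 * \<sigma>) - dep_queue x / n * (1 - 2 * \<sigma>))"
        using n0 by (simp add: field_simps)
      also have "\<dots> \<le> g * (if 0 < V x \<and> good th x then - \<Delta> / 4 else 2 * whi)"
      proof (rule mult_left_mono[OF _ g0])
        have "lam * A1 b M rho x \<le> A1 b M rho x" using lam A1b by (simp add: mult_left_le_one_le)
        then have l: "lam * A1 b M rho x * (1 + 2 * \<sigma>) \<le> A1 b M rho x * (1 + 2 * \<sigma>)"
          using \<sigma> by (intro mult_right_mono) auto
        show "lam * A1 b M rho x * (1 + 2 * \<sigma>) - dep_queue x / n * (1 - 2 * \<sigma>) \<le> (if 0 < V x \<and> good th x then - \<Delta> / 4 else 2 * whi)"
        proof (cases "0 < V x \<and> good th x")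
          case True
          have "A1 b M rho x * (1 + 2 * \<sigma>) \<le> \<Delta> / 4 * (1 + 2 * \<sigma>)"
            using A1d d0 True \<sigma> by (intro mult_right_mono) auto
          moreover have "\<Delta> * (1 - 2 * \<sigma>) \<le> dep_queue x / n * (1 - 2 * \<sigma>)"
            using dqD True \<sigma> by (intro mult_right_mono) auto
          \<comment> \<open>The choice \<open>\<sigma> \<le> 1 / 5\<close> gives \<open>- 3/4 *
            \<Delta> + 5/2 * \<Delta> * \<sigma> \<le> - \<Delta> / 4\<close>.\<close>
          moreover have "\<Delta> * \<sigma> \<le> \<Delta> * (1 / 5)" using \<sigma> \<Delta>0 by (intro mult_left_mono) auto
          ultimately show ?thesis using True l by (simp add: algebra_simps)
        next
          case False
          have "A1 b M rho x * (1 + 2 * \<sigma>) \<le> 1 * 2" using A1b \<sigma> by (intro mult_mono) auto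
          moreover have "0 \<le> dep_queue x / n * (1 - 2 * \<sigma>)" using dq0 n0 \<sigma> by (intro mult_nonneg_nonneg) auto
          ultimately show ?thesis unfolding if_not_P[OF False] using l whi by linarith
        qed
      qed
      finally show ?thesis unfolding g_def .
    next
      case False
      then have Vx: "V x = a2 - busyc x / n" by (simp add: V_def)
      have "gen (\<lambda>x. elin B c (V x)) x \<le> gen (\<lambda>x. elin B c (a2 - busyc x / n)) x"
        by (rule gen_mono[OF x]) (use Vx B0 in \<open>auto simp: V_def intro!: elin_mono\<close>)
      also have "\<dots> \<le> (dep_total x - dep_queue x) * (g * (1 + 2 * \<sigma>) / n) - lam * n * (1 - A1 b M rho x) * (g * (1 - 2 * \<sigma>) / n)"
        by (rule gen_idle[OF x n_def[THEN meta_eq_to_obj_eq] Vx up dn])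
      also have "\<dots> = g * ((dep_total x - dep_queue x) / n * (1 + 2 * \<sigma>) - lam * (1 - A1 b M rho x) * (1 - 2 * \<sigma>))"
        using n0 by (simp add: field_simps)
      also have "\<dots> \<le> g * (if 0 < V x \<and> good th x then - \<Delta> / 4 else 2 * whi)"
      proof (rule mult_left_mono[OF _ g0])
        let ?r = "(dep_total x - dep_queue x) / n"
        have r0: "0 \<le> ?r" using dtq n0 by simp
        show "?r * (1 + 2 * \<sigma>) - lam * (1 - A1 b M rho x) * (1 - 2 * \<sigma>) \<le> (if 0 < V x \<and> good th x then - \<Delta> / 4 else 2 * whi)"
        proof (cases "0 < V x \<and> good th x")
          case True
          have "whi * (busyc x / n - lam) \<le> whi * (a2 - lam)" using True Vx whi by (intro mult_left_mono) auto
          then have "dep_total x / n \<le> lam + \<Delta> / 4"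
            using dep_total_upper[OF conjunct2[OF True] whi(2)] a2 unfolding n_def by linarith
          \<comment> \<open>Departures with a waiting job create no idle server, so
            \<open>\<Delta>\<close> is subtracted. The final budget
            \<open>- 3/4 * \<Delta> + d0 + 4 * \<sigma>\<close> is at most
            \<open>- \<Delta> / 4\<close> because
            \<open>16 * \<sigma> \<le> \<Delta>\<close>.\<close>
          then have r: "?r \<le> lam - 3 / 4 * \<Delta>" using dqD True by (simp add: diff_divide_distrib)
          then have "?r * \<sigma> \<le> 1 * \<sigma>" using lam \<Delta>0 \<sigma> by (intro mult_right_mono) auto
          moreover have "lam * (1 - d0) * (1 - 2 * \<sigma>) \<le> lam * (1 - A1 b M rho x) * (1 - 2 * \<sigma>)"
            using A1d True \<sigma> lam by (intro mult_right_mono mult_left_mono) auto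
          moreover have "lam - d0 - 2 * \<sigma> \<le> lam * (1 - d0) * (1 - 2 * \<sigma>)"
          proof -
            have "lam * d0 \<le> d0" "lam * \<sigma> \<le> \<sigma>" "0 \<le> lam * d0 * \<sigma>"
              using lam d0 \<sigma> by (auto simp: mult_left_le_one_le)
            then show ?thesis by (simp add: algebra_simps)
          qed
          moreover have "?r * (1 + 2 * \<sigma>) = ?r + 2 * (?r * \<sigma>)"
            unfolding distrib_left by (simp only: mult_1_right mult.left_commute)
          ultimately show ?thesis unfolding if_P[OF True] using r d0(2) \<Delta>(2) by linarith
        next
          case False
          have "?r \<le> dep_total x / n" using dq0 n0 by (simp add: divide_right_mono)
          also have "\<dots> \<le> whi" using dep_total_le[OF x, of whi] whi by (simp add: n_def)
          finally have "?r * (1 + 2 * \<sigma>) \<le> whi * 2" using r0 \<sigma> whi by (intro mult_mono) auto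
          moreover have "0 \<le> lam * (1 - A1 b M rho x) * (1 - 2 * \<sigma>)" using lam A1b \<sigma> by (intro mult_nonneg_nonneg) auto
          ultimately show ?thesis unfolding if_not_P[OF False] by linarith
        qed
      qed
      finally show ?thesis unfolding g_def .
    qed
  qed
  have "0 \<le> expect (\<lambda>x. 2 * whi + 2 * whi * exp (B * c) * of_bool (\<not> good th x) - \<Delta> / 4 * exp (B * c) * of_bool (c \<le> V x \<and> good th x))"
  proof (rule expect_gen_le[OF B0])
    fix x assume x: "x \<in> \<Omega>"
    have "exp (B * min (V x) c) * (if 0 < V x \<and> good th x then - \<Delta> / 4 else 2 * whi)
       \<le> 2 * whi + 2 * whi * exp (B * c) * of_bool (\<not> good th x) - \<Delta> / 4 * exp (B * c) * of_bool (c \<le> V x \<and> good th x)"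
    proof -
      \<comment> \<open>Bad states cost at most the capped slope; nonpositive \<open>V x\<close> has
        slope factor at most 1; between 0 and \<open>c\<close> the negative drift is discarded;
        beyond \<open>c\<close> it is the gain.\<close>
      consider "\<not> good th x" | "good th x" "V x \<le> 0" | "good th x" "0 < V x" "V x < c" | "good th x" "c \<le> V x"
        by linarith
      then show ?thesis
      proof cases
        case 1
        have "exp (B * min (V x) c) * (2 * whi) \<le> 2 * whi * exp (B * c)"
          unfolding mult.commute[of "exp (B * min (V x) c)"]
          using B0 whi by (intro mult_left_mono) (auto intro!: mult_left_mono)
        then have "exp (B * min (V x) c) * (2 * whi) \<le> 2 * whi + 2 * whi * exp (B * c)"
          using whi(1) by linarith
        then show ?thesis using 1 by simp
      next
        case 2
        have "B * min (V x) c \<le> 0" using 2 B0 by (intro mult_nonneg_nonpos) auto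
        then have "exp (B * min (V x) c) \<le> 1" by simp
        then have "exp (B * min (V x) c) * (2 * whi) \<le> 1 * (2 * whi)"
          using whi by (intro mult_right_mono) auto
        then show ?thesis using 2 c by simp
      next
        case 3
        have "0 \<le> exp (B * min (V x) c) * (\<Delta> / 4)" using \<Delta>0 by simp
        then show ?thesis using 3 whi by simp
      next
        case 4
        then show ?thesis using c whi by (simp add: mult.commute)
      qed
    qed
    then have "B * (exp (B * min (V x) c) * (if 0 < V x \<and> good th x then - \<Delta> / 4 else 2 * whi))
       \<le> B * (2 * whi + 2 * whi * exp (B * c) * of_bool (\<not> good th x) - \<Delta> / 4 * exp (B * c) * of_bool (c \<le> V x \<and> good th x))"
      using B0 by (intro mult_left_mono) auto
    then show "gen (\<lambda>x. elin B c (V x)) x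
      \<le> B * (2 * whi + 2 * whi * exp (B * c) * of_bool (\<not> good th x) - \<Delta> / 4 * exp (B * c) * of_bool (c \<le> V x \<and> good th x))"
      using drift[OF x] by (simp add: elin'_def mult.assoc)
  qed
  then show ?thesis by (simp only: expect_add expect_diff expect_cmult expect_const)
qed

text \<open>A quadratic test function: on \<open>Q\<close> its drift is proportional to
  \<open>- \<sigma>\<close> times the excess, up to a second-order term of order
  \<open>1 / N\<close>. Off \<open>Q\<close> the excess is at most \<open>b\<close> and the drift
  fails by at most 2.\<close>

lemma excess_bound:
  assumes \<sigma>: "0 < \<sigma>" "\<sigma> \<le> 1" and \<eta>: "0 \<le> \<eta>"
    and whi: "0 \<le> whi" "\<And>m. m \<in> {1..M} \<Longrightarrow> w m \<le> whi"
    and Q: "\<And>x. x \<in> \<Omega> \<Longrightarrow> Q x \<Longrightarrow> \<eta> < jobs x / real N \<Longrightarrow> lam + \<sigma> \<le> dep_total x / real N"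
  shows "\<sigma> * expect (\<lambda>x. max 0 (jobs x / real N - \<eta>)) \<le> (1 + whi) / (2 * real N) + 2 * real b * expect (\<lambda>x. of_bool (\<not> Q x))"
proof -
  define n where "n = real N"
  have n0: "0 < n" using N_pos by (simp add: n_def)
  let ?u = "\<lambda>x. max 0 (jobs x / n - \<eta>)"
  have "0 \<le> expect (\<lambda>x. (1 + whi) / (2 * n) + 2 * real b * of_bool (\<not> Q x) - \<sigma> * ?u x)"
  proof (rule expect_gen_le)
    show "(0::real) < 2" by simp
    fix x assume x: "x \<in> \<Omega>"
    let ?\<phi> = "\<lambda>t::real. (max 0 t)\<^sup>2"
    have up: "?\<phi> (t + 1 / n) - ?\<phi> t \<le> 2 * max 0 t / n + 1 / n\<^sup>2" for t
    proof -
      have "?\<phi> (t + 1 / n) \<le> (max 0 t + 1 / n)\<^sup>2" using n0 by (intro power_mono) auto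
      then show ?thesis by (simp add: power2_eq_square algebra_simps)
    qed
    have dn: "?\<phi> (t - 1 / n) - ?\<phi> t \<le> - 2 * max 0 t / n + 1 / n\<^sup>2" for t
    proof -
      have "?\<phi> (t - 1 / n) \<le> (max 0 t - 1 / n)\<^sup>2"
      proof (cases "t \<le> 1 / n")
        case False
        moreover have "0 < 1 / n" using n0 by simp
        ultimately show ?thesis by simp
      qed auto
      then show ?thesis by (simp add: power2_eq_square algebra_simps)
    qed
    have dt: "0 \<le> dep_total x / n" "dep_total x / n \<le> whi"
      using dep_total_nonneg n0 dep_total_le[OF x, of whi] whi by (auto simp: n_def)
    have "gen (\<lambda>x. ?\<phi> (jobs x / n - \<eta>)) x \<le> lam * n * (2 * ?u x / n + 1 / n\<^sup>2) + dep_total x * (- 2 * ?u x / n + 1 / n\<^sup>2)"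
      using up n0 by (intro gen_jobs[OF x n_def refl] dn) auto
    also have "\<dots> = 2 * (?u x * (lam - dep_total x / n)) + (lam + dep_total x / n) / n"
      using n0 by (simp add: field_simps power2_eq_square)
    also have "\<dots> \<le> 2 * (2 * real b * of_bool (\<not> Q x) - \<sigma> * ?u x) + (1 + whi) / n"
    proof (intro add_mono mult_left_mono divide_right_mono)
      show "?u x * (lam - dep_total x / n) \<le> 2 * real b * of_bool (\<not> Q x) - \<sigma> * ?u x"
      proof (cases "Q x")
        case True
        show ?thesis
        proof (cases "\<eta> < jobs x / n")
          case up: True
          have "?u x * (lam - dep_total x / n) \<le> ?u x * (- \<sigma>)"
            using Q[OF x True] up by (intro mult_left_mono) (auto simp: n_def)
          then show ?thesis using True by (simp add: mult.commute)
        qed (use True in simp)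
      next
        case False
        have "jobs x / n \<le> real b" using jobs_le[OF x] n0 by (simp add: n_def field_simps)
        then have ub: "0 \<le> ?u x" "?u x \<le> real b" using \<eta> by auto
        have "?u x * (lam - dep_total x / n + \<sigma>) \<le> ?u x * 2"
          using ub lam dt \<sigma> by (intro mult_left_mono) auto
        also have "\<dots> \<le> real b * 2" using ub by simp
        finally show ?thesis using False by (simp add: algebra_simps)
      qed
    qed (use n0 lam dt in auto)
    finally show "gen (\<lambda>x. ?\<phi> (jobs x / n - \<eta>)) x \<le> 2 * ((1 + whi) / (2 * n) + 2 * real b * of_bool (\<not> Q x) - \<sigma> * ?u x)"
      by argo
  qed
  then show ?thesis unfolding n_def by (simp only: expect_add expect_diff expect_cmult expect_const)
qed

text \<open>Markov's inequality for the exponential, with the level of \<open>ell m\<close>.\<close>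

lemma tail_ell:
  assumes "expect (\<lambda>x. exp (- \<beta> * ell 1 x)) \<le> exp (- \<beta> * (1 - \<delta>))" and m: "m \<in> {1..M}"
  shows "expect (\<lambda>x. of_bool (ell m x < \<tau>)) \<le> exp (\<beta> * (\<tau> - (1 - \<delta> - 2 * (real m - 1) * e1)))"
proof -
  have "expect (\<lambda>x. of_bool (ell m x < \<tau>)) \<le> expect (\<lambda>x. exp (\<beta> * \<tau>) * exp (- \<beta> * ell m x))"
    using \<beta>_pos by (intro expect_mono) (auto simp: exp_add[symmetric])
  also have "\<dots> \<le> exp (\<beta> * \<tau>) * exp (- \<beta> * (1 - \<delta> - 2 * (real m - 1) * e1))"
    unfolding expect_cmult using level_ell[OF assms] by (intro mult_left_mono) auto
  finally show ?thesis by (simp add: exp_add[symmetric] algebra_simps)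
qed

end

section \<open>The constants and the waiting probability\<close>

context lb_phases begin

lemma wl_le: "m \<in> {1..M} \<Longrightarrow> wl M \<mu> p \<le> w m"
  unfolding wl_def by (intro Min_le) auto

lemma wu_ge: "m \<in> {1..M} \<Longrightarrow> w m \<le> wu M \<mu> p"
  unfolding wu_def by (intro Max_ge) auto

lemma wl_pos: "0 < wl M \<mu> p"
  unfolding wl_def using M_pos w_pos by (subst Min_gr_iff) auto

text \<open>The mean of the departure rates under the weights \<open>v\<close> is 1, so 1 lies
  between the extreme rates.\<close>

lemma wl_le_1: "wl M \<mu> p \<le> 1"
proof -
  have "wl M \<mu> p * (\<Sum>m\<in>{1..M}. v m) \<le> (\<Sum>m\<in>{1..M}. w m * v m)"
    unfolding sum_distrib_left using wl_le v_pos by (intro sum_mono mult_right_mono) (auto intro: less_imp_le)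
  then show ?thesis using v_norm sum_wv_all by simp
qed

lemma wu_ge_1: "1 \<le> wu M \<mu> p"
proof -
  have "(\<Sum>m\<in>{1..M}. w m * v m) \<le> wu M \<mu> p * (\<Sum>m\<in>{1..M}. v m)"
    unfolding sum_distrib_left using wu_ge v_pos by (intro sum_mono mult_right_mono) (auto intro: less_imp_le)
  then show ?thesis using v_norm sum_wv_all by simp
qed

lemma wu_le_mumax: "wu M \<mu> p \<le> mumax M \<mu>"
proof -
  have "w m \<le> mumax M \<mu>" if m: "m \<in> {1..M}" for m
  proof -
    have "0 \<le> (if m < M then \<mu> m * p m else 0)" using p_range[of m] mu_pos[OF m] m by auto
    then have "w m \<le> \<mu> m" using w_split[OF m] by linarith
    also have "\<dots> \<le> mumax M \<mu>" unfolding mumax_def using m by (intro Max_ge) auto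
    finally show ?thesis .
  qed
  then show ?thesis unfolding wu_def using M_pos by (subst Max_le_iff) auto
qed

lemma theta_nonneg: "0 \<le> Cc M \<mu> p \<Longrightarrow> m \<in> {1..M} \<Longrightarrow> 0 \<le> theta M \<mu> p m"
  unfolding theta_def using mu_pos[OF one_in] v_pos[of m]
  by (intro divide_nonneg_nonneg add_nonneg_nonneg mult_nonneg_nonneg) auto

abbreviation "\<Theta> \<equiv> \<Sum>m\<in>{1..M}. theta M \<mu> p m"

text \<open>The left side is the drain rate forced by a queue excess \<open>zeta\<close>. The
  constant is chosen so that a quarter of it is the surplus of departures tolerated in the collapse
  argument.\<close>

lemma wl_zeta:
  "wl M \<mu> p * zeta b M \<mu> p / real b =
     4 * wu M \<mu> p * ((1 / wl M \<mu> p - 1 / wu M \<mu> p) * thw M \<mu> p + 1 / wl M \<mu> p + 6)"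
  unfolding zeta_def using wl_pos b_pos by simp

text \<open>The part of the job excess that must sit in busy servers once the queue accounts for
  \<open>zeta\<close>.\<close>

lemma kk_minus_zeta: "kk b M \<mu> p - zeta b M \<mu> p = thw M \<mu> p / wl M \<mu> p - \<Theta> + 1 / wl M \<mu> p + 6"
proof -
  have "wl M \<mu> p / (4 * wu M \<mu> p * real b) * zeta b M \<mu> p
      = (1 / wl M \<mu> p - 1 / wu M \<mu> p) * thw M \<mu> p + 1 / wl M \<mu> p + 6"
    unfolding zeta_def using wl_pos wu_ge_1 b_pos by simp
  then show ?thesis unfolding kk_def distrib_right by (simp add: algebra_simps)
qed

lemma wl_zeta_ge:
  assumes "0 \<le> Cc M \<mu> p"
  shows "28 * wu M \<mu> p \<le> wl M \<mu> p * zeta b M \<mu> p / real b"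
proof -
  have "0 \<le> thw M \<mu> p"
    unfolding thw_def using theta_nonneg[OF assms] w_pos by (intro sum_nonneg mult_nonneg_nonneg) (auto intro: less_imp_le)
  moreover have "1 / wu M \<mu> p \<le> 1" "1 \<le> 1 / wl M \<mu> p" using wu_ge_1 wl_pos wl_le_1 by auto
  ultimately have "7 \<le> (1 / wl M \<mu> p - 1 / wu M \<mu> p) * thw M \<mu> p + 1 / wl M \<mu> p + 6"
    using mult_nonneg_nonneg[of "1 / wl M \<mu> p - 1 / wu M \<mu> p" "thw M \<mu> p"] by linarith
  then have "4 * wu M \<mu> p * 7 \<le> 4 * wu M \<mu> p * ((1 / wl M \<mu> p - 1 / wu M \<mu> p) * thw M \<mu> p + 1 / wl M \<mu> p + 6)"
    using wu_ge_1 by (intro mult_left_mono) auto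
  then show ?thesis unfolding wl_zeta by simp
qed

lemma zeta_ge:
  assumes "0 \<le> Cc M \<mu> p"
  shows "28 * real b \<le> zeta b M \<mu> p"
proof -
  have "28 * 1 \<le> wl M \<mu> p * zeta b M \<mu> p / real b" using wl_zeta_ge[OF assms] wu_ge_1 by linarith
  then have h: "28 * real b \<le> wl M \<mu> p * zeta b M \<mu> p" using b_pos by (simp add: field_simps)
  then have "0 \<le> zeta b M \<mu> p" using wl_pos b_pos by (smt (verit) mult_less_0_iff of_nat_0_le_iff)
  then have "wl M \<mu> p * zeta b M \<mu> p \<le> zeta b M \<mu> p" using wl_le_1 wl_pos by (intro mult_left_le_one_le) auto
  then show ?thesis using h by linarith
qed

lemma kk_ge:
  assumes "0 \<le> Cc M \<mu> p"
  shows "zeta b M \<mu> p + 7 \<le> kk b M \<mu> p"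
proof -
  have "wl M \<mu> p * \<Theta> \<le> thw M \<mu> p"
    unfolding thw_def sum_distrib_left mult.commute[of "theta M \<mu> p _"]
    using wl_le theta_nonneg[OF assms] by (intro sum_mono mult_right_mono) auto
  then have "\<Theta> \<le> thw M \<mu> p / wl M \<mu> p" using wl_pos by (simp add: field_simps)
  moreover have "1 \<le> 1 / wl M \<mu> p" using wl_pos wl_le_1 by simp
  ultimately show ?thesis using kk_minus_zeta by linarith
qed

end

section \<open>Probability of bad states and of routing to a busy server\<close>

context lb_coxian begin

text \<open>With this \<open>e1\<close> the denominator \<open>Cc\<close> of \<open>theta\<close>
  cancels, and \<open>Cc \<le> vb\<close> gives \<open>L^2 \<le> \<beta> * e1\<close>. A union bound
  over the phases follows.\<close>

lemma not_good_bound: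
  fixes L :: real
  assumes C: "0 < Cc M \<mu> p" "Cc M \<mu> p \<le> vb" and e1_eq: "e1 = L / sqrt (real N) / Cc M \<mu> p"
    and L: "L = ln (real N)" "2 \<le> L"
    and nu: "lam = 1 - nu" and xi: "xi M \<mu> p < 1"
    and c1: "\<mu> 1 * CM M \<mu> p * e1 \<le> (1 - xi M \<mu> p) / 2 * nu"
    and c2: "nu / L * \<mu> 1 \<le> (1 - xi M \<mu> p) / 2 * nu" "0 \<le> nu"
    and c3: "2 \<le> (1 - xi M \<mu> p) * L"
    and lb: "\<And>x. x \<in> \<Omega> \<Longrightarrow> busyc x / real N \<le> 1 - nu / L \<Longrightarrow> A1 b M rho x \<le> 1 / sqrt (real N)"
  shows "expect (\<lambda>x. of_bool (\<not> good (\<lambda>m. theta M \<mu> p m * (L / sqrt (real N))) x)) \<le> sqrt (real N) * exp (- 2 * L\<^sup>2)"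
proof -
  let ?n = "real N" and ?C = "Cc M \<mu> p" and ?\<sigma> = "L / sqrt (real N)"
  have n0: "0 < ?n" "0 < sqrt ?n" using N_pos by auto
  have \<sigma>C: "?\<sigma> = e1 * ?C" using C by (simp add: e1_eq)
  have \<beta>e: "L\<^sup>2 \<le> \<beta> * e1"
  proof -
    have "L\<^sup>2 = e1\<^sup>2 * ?n * ?C\<^sup>2" using n0 C unfolding e1_eq by (simp add: power_divide power_mult_distrib)
    also have "\<dots> \<le> e1\<^sup>2 * ?n * vb\<^sup>2" using C n0 by (intro mult_left_mono power_mono) auto
    also have "\<dots> = \<beta> * e1" by (simp add: \<beta>_def power2_eq_square)
    finally show ?thesis .
  qed
  have lev: "expect (\<lambda>x. exp (- \<beta> * ell 1 x)) \<le> exp (- \<beta> * (1 - (nu + 4 * e1)))"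
  proof (rule level_ell_1[where ?d0.0 = "1 / sqrt ?n" and eps = "nu / L"])
    have "?C \<le> L" using C vb_le_1 L by linarith
    then show "1 / sqrt ?n \<le> e1" using n0 C by (simp add: e1_eq field_simps)
    show "A1 b M rho x \<le> 1 / sqrt ?n" if "x \<in> \<Omega>" "(\<Sum>m\<in>{1..M}. Z m x) \<le> ?n * (1 - nu / L)" for x
    proof (rule lb[OF that(1)])
      have "busyc x / ?n \<le> (?n * (1 - nu / L)) / ?n"
        using that(2) n0 unfolding busyc_Z by (intro divide_right_mono) auto
      then show "busyc x / ?n \<le> 1 - nu / L" using n0 by simp
    qed
  qed (use assms \<beta>e in auto)
  define \<tau> where "\<tau> m = lam - (6 * \<mu> 1 + 5 * (real m - 1)) * e1" for m
  have "expect (\<lambda>x. of_bool (\<not> good (\<lambda>m. theta M \<mu> p m * ?\<sigma>) x)) \<le> expect (\<lambda>x. \<Sum>m\<in>{1..M}. of_bool (ell m x < \<tau> m))"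
  proof (rule expect_mono)
    fix x
    show "of_bool (\<not> good (\<lambda>m. theta M \<mu> p m * ?\<sigma>) x) \<le> (\<Sum>m\<in>{1..M}. of_bool (ell m x < \<tau> m) :: real)"
    proof (cases "good (\<lambda>m. theta M \<mu> p m * ?\<sigma>) x")
      case False
      then obtain m where m: "m \<in> {1..M}" "Z m x / ?n < lam * v m - theta M \<mu> p m * ?\<sigma>"
        by (auto simp: good_def not_le)
      have "theta M \<mu> p m * ?\<sigma> = v m * ((6 * \<mu> 1 + 5 * (real m - 1)) * e1)"
        unfolding theta_def \<sigma>C using C by (simp add: field_simps)
      then have "v m * ell m x < v m * \<tau> m"
        using m(2) Z_ell[OF m(1), of x] n0 by (simp add: \<tau>_def algebra_simps)
      then have "ell m x < \<tau> m" using v_pos[OF m(1)] by simp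
      then have "1 = (of_bool (ell m x < \<tau> m) :: real)" by simp
      also have "\<dots> \<le> (\<Sum>m\<in>{1..M}. of_bool (ell m x < \<tau> m))" using m(1) by (intro member_le_sum) auto
      finally show ?thesis using False by simp
    qed (auto intro: sum_nonneg)
  qed
  also have "\<dots> = (\<Sum>m\<in>{1..M}. expect (\<lambda>x. of_bool (ell m x < \<tau> m)))" by (rule expect_sum)
  also have "\<dots> \<le> (\<Sum>m\<in>{1..M}. exp (- 2 * L\<^sup>2))"
  proof (rule sum_mono)
    fix m assume m: "m \<in> {1..M}"
    have "expect (\<lambda>x. of_bool (ell m x < \<tau> m)) \<le> exp (\<beta> * (\<tau> m - (1 - (nu + 4 * e1) - 2 * (real m - 1) * e1)))"
      by (rule tail_ell[OF lev m])
    also have "\<dots> \<le> exp (- 2 * L\<^sup>2)"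
    proof -
      \<comment> \<open>The coefficient \<open>6 * \<mu> 1 + 5 * (m - 1)\<close> in
        \<open>theta\<close> exceeds the level loss \<open>4 + 2 * (m - 1)\<close> by at least 2,
        since \<open>1 \<le> \<mu> 1\<close>.\<close>
      have "\<tau> m - (1 - (nu + 4 * e1) - 2 * (real m - 1) * e1) = (4 - 6 * \<mu> 1 - 3 * (real m - 1)) * e1"
        by (simp add: \<tau>_def nu algebra_simps)
      also have "\<dots> \<le> - 2 * e1" using mu1_ge_1 m e1 by (intro mult_right_mono) auto
      finally have "\<beta> * (\<tau> m - (1 - (nu + 4 * e1) - 2 * (real m - 1) * e1)) \<le> \<beta> * (- 2 * e1)"
        using \<beta>_pos by (intro mult_left_mono) auto
      then show ?thesis using \<beta>e by simp
    qed
    finally show "expect (\<lambda>x. of_bool (ell m x < \<tau> m)) \<le> exp (- 2 * L\<^sup>2)" .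
  qed
  also have "\<dots> = real M * exp (- 2 * L\<^sup>2)" by simp
  also have "\<dots> \<le> sqrt ?n * exp (- 2 * L\<^sup>2)"
  proof (rule mult_right_mono)
    \<comment> \<open>The union over the phases costs at most \<open>sqrt N\<close>:
      \<open>e1 \<le> 1\<close> means \<open>L \<le> ?C * sqrt ?n\<close>, and \<open>M\<close>
      copies of \<open>vb\<close> fit into the total mass 1.\<close>
    have "real M * vb \<le> 1" using sum_mono[of "{1..M}" "\<lambda>_. vb" v] vb_le v_norm by simp
    then have MC: "real M * ?C \<le> 1" using mult_left_mono[OF C(2), of "real M"] by simp
    have "L \<le> ?C * sqrt ?n" using e1(2) n0 C unfolding e1_eq by (simp add: field_simps)
    then have "real M * L \<le> real M * (?C * sqrt ?n)" by (intro mult_left_mono) auto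
    also have "\<dots> = (real M * ?C) * sqrt ?n" by simp
    also have "\<dots> \<le> 1 * sqrt ?n" using MC n0 by (intro mult_right_mono) auto
    finally have "real M * L \<le> sqrt ?n" by simp
    moreover have "real M * 1 \<le> real M * L" using L by (intro mult_left_mono) auto
    ultimately show "real M \<le> sqrt ?n" by simp
  qed simp
  finally show ?thesis .
qed

text \<open>Rarity of bad states feeds the collapse, both feed the mean excess of jobs, and Markov's
  inequality turns this into a bound for leaving the region where \<open>lb\<close> applies.\<close>

lemma waiting_bound:
  fixes L :: real
  defines "n \<equiv> real N"
  defines "\<sigma> \<equiv> L / sqrt n"
  assumes C: "0 < Cc M \<mu> p" "Cc M \<mu> p \<le> vb" and e1_eq: "e1 = \<sigma> / Cc M \<mu> p"
    and L: "L = ln n" "4 \<le> L"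
    and nu: "lam = 1 - nu" "0 < nu" and xi: "xi M \<mu> p < 1"
    and c1: "\<mu> 1 * CM M \<mu> p * e1 \<le> (1 - xi M \<mu> p) / 2 * nu"
    and c2: "2 * \<mu> 1 \<le> (1 - xi M \<mu> p) * L"
    and c3: "4 * real b / (wl M \<mu> p * zeta b M \<mu> p) \<le> L"
    and k\<sigma>: "kk b M \<mu> p * \<sigma> \<le> nu / 2"
    and lb: "\<And>x. x \<in> \<Omega> \<Longrightarrow> busyc x / n \<le> 1 - nu / L \<Longrightarrow> A1 b M rho x \<le> 1 / sqrt n"
  shows "expect (A1 b M rho) \<le> 1 / sqrt n + (4 + 2 * wu M \<mu> p) / (sqrt n * nu * L)"
proof -
  let ?wl = "wl M \<mu> p" and ?wu = "wu M \<mu> p" and ?\<zeta> = "zeta b M \<mu> p" and ?k = "kk b M \<mu> p" and ?tw = "thw M \<mu> p"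
  define th where "th m = theta M \<mu> p m * \<sigma>" for m
  have n0: "0 < n" "0 < sqrt n" using N_pos by (auto simp: n_def)
  have n1: "1 \<le> n" using N_pos by (simp add: n_def)
  have \<sigma>0: "0 < \<sigma>" unfolding \<sigma>_def using L(2) n0 by (intro divide_pos_pos) auto
  have nu1: "nu \<le> 1" using nu lam by simp
  have Cn: "0 \<le> Cc M \<mu> p" using C by simp
  have \<zeta>: "28 * real b \<le> ?\<zeta>" by (rule zeta_ge[OF Cn])
  have k: "?\<zeta> + 7 \<le> ?k" by (rule kk_ge[OF Cn])
  define s where "s = ?k - ?\<zeta>"
  have s: "s = ?tw / ?wl - \<Theta> + 1 / ?wl + 6" "7 \<le> s" using kk_minus_zeta k by (auto simp: s_def)
  define \<Delta> where "\<Delta> = ?wl / real b * (?\<zeta> * \<sigma>)"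
  have \<Delta>: "\<Delta> = ?wl * ?\<zeta> / real b * \<sigma>" by (simp add: \<Delta>_def)
  have \<Delta>28: "28 * ?wu * \<sigma> \<le> \<Delta>" unfolding \<Delta> using wl_zeta_ge[OF Cn] \<sigma>0 by (intro mult_right_mono) auto
  have \<Delta>0: "0 < \<Delta>" using \<Delta>28 wu_ge_1 \<sigma>0 mult_pos_pos[of "28 * ?wu" \<sigma>] by linarith
  have k35: "35 \<le> ?k" using k \<zeta> b_pos by simp
  have s\<sigma>: "s * \<sigma> \<le> nu / 2"
  proof -
    have "s * \<sigma> \<le> ?k * \<sigma>" using \<zeta> \<sigma>0 by (intro mult_right_mono) (auto simp: s_def)
    then show ?thesis using k\<sigma> by linarith
  qed
  have \<sigma>70: "70 * \<sigma> \<le> 1" using mult_right_mono[OF k35 less_imp_le[OF \<sigma>0]] k\<sigma> nu1 by linarith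
  have nuL: "nu / L \<le> nu / 4" using L nu by (intro divide_left_mono) auto
  have th_sum: "(\<Sum>m\<in>{1..M}. th m) = \<Theta> * \<sigma>" by (simp add: th_def sum_distrib_right)
  have thw_sum: "(\<Sum>m\<in>{1..M}. th m * w m) = ?tw * \<sigma>"
    by (simp add: th_def thw_def sum_distrib_left mult_ac)
  define E where "E = exp (- L\<^sup>2)"
  define pb where "pb = expect (\<lambda>x. of_bool (\<not> good th x))"
  have pb: "pb \<le> sqrt n * E\<^sup>2"
  proof -
    have "pb \<le> sqrt n * exp (- 2 * L\<^sup>2)"
      unfolding pb_def th_def \<sigma>_def n_def
    proof (rule not_good_bound[where nu = nu])
      have "nu * (2 * \<mu> 1) \<le> nu * ((1 - xi M \<mu> p) * L)" using c2 nu by (intro mult_left_mono) auto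
      then show "nu / L * \<mu> 1 \<le> (1 - xi M \<mu> p) / 2 * nu" using L by (simp add: field_simps)
      show "2 \<le> (1 - xi M \<mu> p) * L" using c2 mu1_ge_1 by linarith
    qed (use assms in \<open>auto simp: n_def\<close>)
    also have "exp (- 2 * L\<^sup>2) = E\<^sup>2" by (simp add: E_def power2_eq_square exp_add[symmetric])
    finally show ?thesis .
  qed
  define V where "V x = min (queue x / n - ?\<zeta> * \<sigma>) (lam + s * \<sigma> - busyc x / n)" for x
  define pv where "pv = expect (\<lambda>x. of_bool (\<sigma> \<le> V x \<and> good th x))"
  \<comment> \<open>Slope \<open>n * \<sigma>\<close> and cap \<open>\<sigma>\<close> give the
    weight \<open>exp (L^2)\<close>: large against 1, yet small against the inverse of
    \<open>E^2\<close> in the bound on \<open>pb\<close>.\<close>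
  have "\<Delta> / 4 * exp (n * \<sigma> * \<sigma>) * pv \<le> 2 * ?wu + 2 * ?wu * exp (n * \<sigma> * \<sigma>) * pb"
    unfolding pv_def pb_def V_def n_def
  proof (rule queue_collapse[where wlo = ?wl and ?d0.0 = "1 / sqrt n"])
    show "16 * \<sigma> \<le> \<Delta>" using \<Delta>28 wu_ge_1 mult_right_mono[of 28 "28 * ?wu" \<sigma>] \<sigma>0 by linarith
    show "1 / sqrt n \<le> \<Delta> / 4"
    proof -
      have "0 < ?wl * ?\<zeta>" using wl_pos \<zeta> b_pos by simp
      then have "4 * real b \<le> L * (?wl * ?\<zeta>)" using c3 by (simp add: field_simps)
      then have "4 * real b / (4 * real b) \<le> L * (?wl * ?\<zeta>) / (4 * real b)" by (intro divide_right_mono) auto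
      then have "1 \<le> L * (?wl * ?\<zeta>) / (4 * real b)" using b_pos by simp
      then have "1 / sqrt n \<le> (L * (?wl * ?\<zeta>) / (4 * real b)) / sqrt n" using n0 by (intro divide_right_mono) auto
      also have "\<dots> = \<Delta> / 4" by (simp add: \<Delta> \<sigma>_def mult_ac)
      finally show ?thesis .
    qed
    show "?wu * (lam + s * \<sigma> - lam) + (?wu * (\<Sum>m\<in>{1..M}. th m) - (\<Sum>m\<in>{1..M}. th m * w m)) \<le> \<Delta> / 4"
    proof -
      \<comment> \<open>This hypothesis of the collapse holds with equality, by the choice of
        \<open>zeta\<close>.\<close>
      have "?wu * s + ?wu * \<Theta> - ?tw = ?wu * ((1 / ?wl - 1 / ?wu) * ?tw + 1 / ?wl + 6)"
        unfolding s(1) using wu_ge_1 by (simp add: algebra_simps)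
      also have "\<dots> = (?wl * ?\<zeta> / real b) / 4" unfolding wl_zeta by simp
      finally have "(?wu * s + ?wu * \<Theta> - ?tw) * \<sigma> = \<Delta> / 4" unfolding \<Delta> by simp
      then show ?thesis unfolding th_sum thw_sum by (simp add: algebra_simps)
    qed
    \<comment> \<open>The level \<open>lam + s * \<sigma> \<le> 1 - nu / 2\<close> stays below the
      policy threshold \<open>1 - nu / L\<close> because \<open>4 \<le> L\<close>.\<close>
    show "A1 b M rho x \<le> 1 / sqrt n" if "x \<in> \<Omega>" "busyc x / real N \<le> lam + s * \<sigma>" for x
      using that(2) s\<sigma> nuL nu by (intro lb[OF that(1)]) (simp add: n_def)
  qed (use wl_pos wl_le wu_ge wu_ge_1 \<sigma>0 \<sigma>70 n0 in \<open>auto simp: \<Delta>_def\<close>)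
  moreover have "n * \<sigma> * \<sigma> = L\<^sup>2" using n0 by (simp add: \<sigma>_def power2_eq_square)
  ultimately have "\<Delta> / 4 * exp (L\<^sup>2) * pv \<le> 2 * ?wu + 2 * ?wu * exp (L\<^sup>2) * pb" by simp
  then have "(\<Delta> / 4 * exp (L\<^sup>2) * pv) * E \<le> (2 * ?wu + 2 * ?wu * exp (L\<^sup>2) * pb) * E"
    by (intro mult_right_mono) (auto simp: E_def)
  moreover have EE: "exp (L\<^sup>2) * E = 1" by (simp add: E_def exp_add[symmetric])
  moreover have "(\<Delta> / 4 * exp (L\<^sup>2) * pv) * E = \<Delta> / 4 * pv * (exp (L\<^sup>2) * E)" by (simp only: mult_ac)
  moreover have "(2 * ?wu + 2 * ?wu * exp (L\<^sup>2) * pb) * E = 2 * ?wu * E + 2 * ?wu * pb * (exp (L\<^sup>2) * E)"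
    unfolding distrib_right by (simp only: mult_ac)
  ultimately have "\<Delta> / 4 * pv \<le> 2 * ?wu * E + 2 * ?wu * pb"
    by (simp only: EE mult_1_right)
  then have pv1: "\<Delta> * pv \<le> 8 * ?wu * (E + pb)" by (simp add: algebra_simps)
  have pb0: "0 \<le> pb" "0 \<le> pv" unfolding pb_def pv_def by (auto intro!: expect_nonneg)
  have E0: "0 < E" by (simp add: E_def)
  have pv: "pv \<le> sqrt n * (E + pb)"
  proof -
    have "28 * ?wu * \<sigma> * pv \<le> 8 * ?wu * (E + pb)"
      using mult_right_mono[OF \<Delta>28 pb0(2)] pv1 by linarith
    then have "?wu * (28 * \<sigma> * pv) \<le> ?wu * (8 * (E + pb))" by (simp only: mult_ac)
    then have "28 * \<sigma> * pv \<le> 8 * (E + pb)" using wu_ge_1 by simp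
    then have "28 * (sqrt n * \<sigma>) * pv \<le> 8 * (sqrt n * (E + pb))"
      using mult_left_mono[of "28 * \<sigma> * pv" "8 * (E + pb)" "sqrt n"] n0 by (simp only: mult_ac less_imp_le)
    moreover have "sqrt n * \<sigma> = L" using n0 by (simp add: \<sigma>_def)
    moreover have "8 * pv \<le> 28 * L * pv" using L pb0 by (intro mult_right_mono) auto
    ultimately show ?thesis by (smt (verit))
  qed
  define Q where "Q x \<longleftrightarrow> good th x \<and> \<not> \<sigma> \<le> V x" for x
  have pQ: "expect (\<lambda>x. of_bool (\<not> Q x)) \<le> pb + pv"
    unfolding pb_def pv_def expect_add[symmetric] by (intro expect_mono) (auto simp: Q_def)
  \<comment> \<open>Here \<open>2 * b \<le> n\<close>, the probability is at most
    \<open>3 * n * E\<close>, and \<open>4 \<le> L\<close> gives \<open>E \<le> n^(-4)\<close>; the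
    constant 6 that arises is absorbed by one power of \<open>n\<close>.\<close>
  have rare: "2 * real b * expect (\<lambda>x. of_bool (\<not> Q x)) \<le> 1 / (2 * n)"
  proof -
    have sq: "sqrt n * sqrt n = n" using n0 by simp
    have "1 \<le> sqrt n" using n1 by simp
    then have rn: "1 \<le> sqrt n" "sqrt n \<le> n" "sqrt n * sqrt n = n"
      using mult_left_mono[of 1 "sqrt n" "sqrt n"] sq n0 by auto
    have n12: "12 \<le> n"
    proof -
      have "70 * L \<le> sqrt n" using \<sigma>70 n0 by (simp add: \<sigma>_def field_simps)
      then show ?thesis using rn L by linarith
    qed
    have bn: "2 * real b \<le> n"
    proof -
      have "28 * real b \<le> ?k" using \<zeta> k by linarith
      then have "28 * real b * \<sigma> \<le> nu / 2" using k\<sigma> \<sigma>0 mult_right_mono[of "28 * real b" ?k \<sigma>] by linarith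
      then have "28 * real b * \<sigma> \<le> 1" using nu1 by linarith
      then have "28 * real b * L \<le> sqrt n" using n0 by (simp add: \<sigma>_def field_simps)
      moreover have "28 * real b * 1 \<le> 28 * real b * L" using L by (intro mult_left_mono) auto
      ultimately show ?thesis using rn by linarith
    qed
    have E4: "E * n ^ 4 \<le> 1"
    proof -
      have "4 * L \<le> L\<^sup>2" using L by (simp add: power2_eq_square)
      then have "E \<le> exp (- (4 * L))" by (simp add: E_def)
      also have "\<dots> = inverse (n ^ 4)"
        using n0 by (simp add: exp_minus L(1) exp_of_nat_mult[of 4 "ln n", simplified])
      finally show ?thesis using n0 by (simp add: field_simps)
    qed
    have E1: "E \<le> 1" by (simp add: E_def)
    have EEn: "E\<^sup>2 \<le> E" using E1 E0 by (simp add: power2_eq_square mult_left_le)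
    have "pb \<le> n * E"
      using pb mult_mono[of "sqrt n" n "E\<^sup>2" E] rn EEn n0 by simp
    moreover have "pv \<le> 2 * (n * E)"
    proof -
      have "sqrt n * pb \<le> sqrt n * (sqrt n * E\<^sup>2)" using pb n0 by (intro mult_left_mono) auto
      also have "\<dots> = n * E\<^sup>2" using rn by (simp add: mult.assoc[symmetric])
      also have "\<dots> \<le> n * E" using EEn n0 by simp
      finally have "sqrt n * pb \<le> n * E" .
      moreover have "sqrt n * E \<le> n * E" using rn E0 by simp
      ultimately show ?thesis using pv by (simp add: distrib_left)
    qed
    ultimately have pQ3: "expect (\<lambda>x. of_bool (\<not> Q x)) \<le> 3 * (n * E)" using pQ by linarith
    have "2 * real b * expect (\<lambda>x. of_bool (\<not> Q x)) \<le> n * (3 * (n * E))"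
      using bn pQ3 n0 by (intro mult_mono) (auto intro!: expect_nonneg)
    moreover have "n * (3 * (n * E)) * (2 * n) \<le> 1"
    proof -
      have "n * (3 * (n * E)) * (2 * n) = 6 * (E * n ^ 3)" by (simp add: power3_eq_cube)
      also have "\<dots> \<le> n * (E * n ^ 3)" using n12 E0 n0 by (intro mult_right_mono) auto
      also have "\<dots> = E * n ^ 4" by (simp add: power4_eq_xxxx power3_eq_cube)
      finally show ?thesis using E4 by linarith
    qed
    ultimately have "2 * real b * expect (\<lambda>x. of_bool (\<not> Q x)) * (2 * n) \<le> 1"
      using mult_right_mono[of "2 * real b * expect (\<lambda>x. of_bool (\<not> Q x))" "n * (3 * (n * E))" "2 * n"] n0 by linarith
    moreover have "0 < 2 * n" using n0 by simp
    ultimately show ?thesis by (simp only: pos_le_divide_eq)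
  qed
  define \<eta> where "\<eta> = lam + ?k * \<sigma>"
  have excess: "\<sigma> * expect (\<lambda>x. max 0 (jobs x / n - \<eta>)) \<le> (1 + ?wu) / (2 * n) + 2 * real b * expect (\<lambda>x. of_bool (\<not> Q x))"
    unfolding n_def
  proof (rule excess_bound)
    show "0 \<le> \<eta>" using lam k35 \<sigma>0 by (simp add: \<eta>_def)
    fix x assume x: "x \<in> \<Omega>" "Q x" and gt: "\<eta> < jobs x / real N"
    \<comment> \<open>Either the queue excess or the deficit of busy servers is below
      \<open>\<sigma>\<close>; with more than \<open>\<eta>\<close> jobs both cases give the same
      lower bound on busy servers.\<close>
    have "jobs x / n = queue x / n + busyc x / n" by (simp add: jobs_eq add_divide_distrib)
    moreover have "?k * \<sigma> = s * \<sigma> + ?\<zeta> * \<sigma>" by (simp add: s_def algebra_simps)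
    ultimately have "lam + s * \<sigma> - \<sigma> < busyc x / n"
      using x(2) gt by (auto simp: Q_def V_def \<eta>_def n_def not_le)
    then have "s * \<sigma> - \<sigma> \<le> busyc x / n - lam" by linarith
    then have "?wl * (s * \<sigma> - \<sigma>) \<le> ?wl * (busyc x / n - lam)" using wl_pos by (intro mult_left_mono) auto
    moreover have "lam + ?wl * (busyc x / n - lam) - (?tw * \<sigma> - ?wl * (\<Theta> * \<sigma>)) \<le> dep_total x / n"
      using dep_total_lower[of th x ?wl] x(2) wl_le unfolding th_sum thw_sum n_def by (auto simp: Q_def)
    \<comment> \<open>The summand \<open>1 / wl\<close> of \<open>s\<close> yields the drift
      \<open>\<sigma>\<close>; one of its six further units is spent on the collapse margin.\<close>
    moreover have "?wl * (s * \<sigma> - \<sigma>) - (?tw * \<sigma> - ?wl * (\<Theta> * \<sigma>)) = \<sigma> + 5 * ?wl * \<sigma>"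
      unfolding s(1) using wl_pos by (simp add: field_simps)
    moreover have "0 \<le> 5 * ?wl * \<sigma>" using wl_pos \<sigma>0 by simp
    ultimately show "lam + \<sigma> \<le> dep_total x / real N" unfolding n_def by linarith
  qed (use \<sigma>0 \<sigma>70 wu_ge wu_ge_1 in auto)
  \<comment> \<open>Subtracting \<open>nu / 2\<close> and \<open>nu / 4\<close> leaves a quarter of
    \<open>nu\<close> between \<open>\<eta>\<close> and the policy threshold.\<close>
  have ge: "nu / 4 \<le> 1 - nu / L - \<eta>" using nuL k\<sigma> nu by (simp add: \<eta>_def)
  define ph where "ph = expect (\<lambda>x. of_bool (\<not> busyc x / n \<le> 1 - nu / L))"
  have "ph * (nu / 4) = expect (\<lambda>x. nu / 4 * of_bool (\<not> busyc x / n \<le> 1 - nu / L))"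
    unfolding ph_def expect_cmult by (rule mult.commute)
  also have "\<dots> \<le> expect (\<lambda>x. max 0 (jobs x / n - \<eta>))"
  proof (rule expect_mono)
    fix x
    have "busyc x / n \<le> jobs x / n" using queue_nonneg n0 by (intro divide_right_mono) (auto simp: jobs_eq)
    then have "\<not> busyc x / n \<le> 1 - nu / L \<Longrightarrow> nu / 4 \<le> max 0 (jobs x / n - \<eta>)"
      using ge by linarith
    then show "nu / 4 * of_bool (\<not> busyc x / n \<le> 1 - nu / L) \<le> max 0 (jobs x / n - \<eta>)"
      by (cases "busyc x / n \<le> 1 - nu / L") simp_all
  qed
  finally have "\<sigma> * (ph * (nu / 4)) \<le> \<sigma> * expect (\<lambda>x. max 0 (jobs x / n - \<eta>))"
    using \<sigma>0 by (intro mult_left_mono) auto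
  also have "\<dots> \<le> (1 + ?wu) / (2 * n) + 1 / (2 * n)" using excess rare by linarith
  also have "\<dots> = (2 + ?wu) / (2 * n)" by (simp add: add_divide_distrib[symmetric])
  finally have ph1: "\<sigma> * (ph * (nu / 4)) \<le> (2 + ?wu) / (2 * n)" .
  have ph: "ph \<le> (4 + 2 * ?wu) / (sqrt n * nu * L)"
  proof -
    have "n * \<sigma> = n / sqrt n * L" by (simp add: \<sigma>_def)
    then have n\<sigma>: "n * \<sigma> = sqrt n * L" using n0 by (simp add: real_div_sqrt)
    have "4 * n * (\<sigma> * (ph * (nu / 4))) \<le> 4 * n * ((2 + ?wu) / (2 * n))" using ph1 n0 by (intro mult_left_mono) auto
    also have "\<dots> = 4 + 2 * ?wu" using n0 by simp
    also have "4 * n * (\<sigma> * (ph * (nu / 4))) = ph * ((n * \<sigma>) * nu)" by simp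
    finally have "ph * (sqrt n * nu * L) \<le> 4 + 2 * ?wu" unfolding n\<sigma> by (simp add: mult_ac)
    moreover have "0 < sqrt n * nu * L" using n0 nu(2) L(2) by (intro mult_pos_pos) auto
    ultimately show ?thesis by (simp add: pos_le_divide_eq)
  qed
  have "expect (A1 b M rho) \<le> expect (\<lambda>x. 1 / sqrt n + of_bool (\<not> busyc x / n \<le> 1 - nu / L))"
  proof (rule expect_mono)
    fix x assume x: "x \<in> \<Omega>"
    show "A1 b M rho x \<le> 1 / sqrt n + of_bool (\<not> busyc x / n \<le> 1 - nu / L)"
      using lb[OF x] A1_le_1[OF x] n0 by (cases "busyc x / n \<le> 1 - nu / L") (auto intro: add_increasing)
  qed
  also have "\<dots> = 1 / sqrt n + ph" by (simp add: expect_add expect_const ph_def)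
  finally show ?thesis using ph by linarith
qed

end

section \<open>Verification of the side conditions on the constants\<close>

theorem theorem2:
  fixes N b M :: nat and \<alpha> :: real and \<mu> p :: "nat \<Rightarrow> real"
    and rho :: "cstate \<Rightarrow> nat \<Rightarrow> nat \<Rightarrow> real" and \<pi> :: "cstate \<Rightarrow> real"
  assumes b: "b \<ge> 1" and M: "M \<ge> 1"
    and \<alpha>: "0 < \<alpha>" "\<alpha> < 1/2"
    and \<mu>_pos: "\<forall>m\<in>{1..M}. \<mu> m > 0"
    and p_range: "\<forall>m\<in>{1..<M}. 0 \<le> p m \<and> p m < 1"
    and v_norm: "(\<Sum>m\<in>{1..M}. vv \<mu> p m) = 1"
    and xi_range: "0 < xi M \<mu> p" "xi M \<mu> p < 1"
    and policy: "valid_policy N b M rho"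
    and lbzero: "LB_zero N b M \<alpha> rho"
    and irred: "irreducible N b M \<mu> p (1 - real N powr (-\<alpha>)) rho"
    and stat: "stationary N b M \<mu> p (1 - real N powr (-\<alpha>)) rho \<pi>"
    and upper: "min (1 / (2 * kk b M \<mu> p))
                  (min (\<Sum>m\<in>{1..M}. theta M \<mu> p m)
                       (Cc M \<mu> p * (1 - xi M \<mu> p) / (2 * \<mu> 1 * CM M \<mu> p)))
                * real N powr (1/2 - \<alpha>) \<ge> ln (real N)"
    and lower: "ln (real N) \<ge> max (ln (1 / xi M \<mu> p))
                  (max (2 * \<mu> 1 / (1 - xi M \<mu> p))
                    (max (4 * real b / (wl M \<mu> p * zeta b M \<mu> p))
                      (max (Cc M \<mu> p / \<mu> 1) 2)))"
  shows "(\<Sum>x\<in>states N b M. \<pi> x * A1 b M rho x)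
         \<le> 1 / sqrt (real N) + (10 * mumax M \<mu> + 4) / (real N powr (1/2 - \<alpha>) * ln (real N))"
proof -
  let ?n = "real N" and ?\<xi> = "xi M \<mu> p" and ?k = "kk b M \<mu> p" and ?C = "Cc M \<mu> p"
  define L where "L = ln ?n"
  define nu where "nu = ?n powr (- \<alpha>)"
  define nh where "nh = ?n powr (1 / 2 - \<alpha>)"
  define lam where "lam = 1 - nu"
  have lower': "2 * \<mu> 1 / (1 - ?\<xi>) \<le> L" "4 * real b / (wl M \<mu> p * zeta b M \<mu> p) \<le> L" "2 \<le> L"
    using lower unfolding L_def by simp_all
  \<comment> \<open>\<open>ln 0\<close> is 0 by convention, against
    \<open>2 \<le> L\<close>.\<close>
  have N_pos: "0 < N" using lower'(3) by (cases "N = 0") (auto simp: L_def)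
  then have n1: "1 \<le> ?n" "0 < ?n" by simp_all
  have nu0: "0 < nu" "nu \<le> 1" using n1 \<alpha> powr_mono[of "- \<alpha>" 0 ?n] by (auto simp: nu_def)
  have nh0: "0 < nh" using n1 by (simp add: nh_def)
  have nh_eq: "nh = sqrt ?n * nu"
    using n1 by (simp add: nh_def nu_def powr_half_sqrt[symmetric] powr_add[symmetric])
  have upper': "L \<le> 1 / (2 * ?k) * nh" "L \<le> ?C * (1 - ?\<xi>) / (2 * \<mu> 1 * CM M \<mu> p) * nh"
  proof -
    have le: "min u (min t r) * nh \<le> u * nh" "min u (min t r) * nh \<le> r * nh" for u t r
      using nh0 by (auto intro!: mult_right_mono)
    show "L \<le> 1 / (2 * ?k) * nh" "L \<le> ?C * (1 - ?\<xi>) / (2 * \<mu> 1 * CM M \<mu> p) * nh"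
      using upper unfolding nh_def[symmetric] L_def[symmetric] by (blast intro: order_trans le)+
  qed
  \<comment> \<open>For smaller \<open>M\<close> the sum \<open>xi\<close> is empty, hence
    0.\<close>
  have M2: "2 \<le> M" using xi_range(1) by (cases "2 \<le> M") (auto simp: xi_def)
  interpret lb_chain N b M lam \<mu> p rho \<pi>
    using b M N_pos \<mu>_pos p_range nu0 policy stat by unfold_locales (auto simp: lam_def nu_def)
  have v_nonneg: "0 \<le> vv \<mu> p m" if m: "m \<in> {1..M}" for m
    unfolding vv_def using m p_range mu_pos[OF m] by (intro divide_nonneg_nonneg prod_nonneg) auto
  have vbar_nonneg: "0 \<le> vbar M \<mu> p"
    unfolding vbar_def using M v_nonneg by (subst Min_ge_iff) auto
  define l where "l = ln (1 / ?\<xi>)"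
  have l0: "0 < l" using xi_range by (simp add: l_def)
  define d where "d = 3 * real M + (3 * real M + 4) * l"
  have d: "2 * l \<le> d" "0 < d"
  proof -
    have "4 * l \<le> (3 * real M + 4) * l" using l0 by (intro mult_right_mono) auto
    then show "2 * l \<le> d" "0 < d" using l0 unfolding d_def by linarith+
  qed
  have C_eq: "?C = sqrt ((vbar M \<mu> p)\<^sup>2 * (2 * l / d))" by (simp add: Cc_def d_def l_def mult_ac)
  have C0: "0 \<le> ?C" unfolding C_eq using l0 d by simp
  \<comment> \<open>Some \<open>p m\<close> may be 0, so \<open>vbar\<close> could vanish a priori.
    If \<open>?C\<close> were 0, \<open>upper'\<close> would give \<open>L \<le> 0\<close>;
    positivity of \<open>?C\<close> then passes to \<open>vbar\<close>.\<close>
  have "?C \<noteq> 0" using upper'(2) lower'(3) by auto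
  then have C: "0 < ?C" using C0 by simp
  have vbar_pos: "0 < vbar M \<mu> p" using C vbar_nonneg unfolding C_eq by (cases "vbar M \<mu> p = 0") auto
  have C_le: "?C \<le> vbar M \<mu> p"
  proof -
    have "(vbar M \<mu> p)\<^sup>2 * (2 * l / d) \<le> (vbar M \<mu> p)\<^sup>2" using d l0 by (intro mult_left_le) auto
    then have "?C \<le> sqrt ((vbar M \<mu> p)\<^sup>2)" unfolding C_eq by (rule real_sqrt_le_mono)
    then show ?thesis using vbar_nonneg by simp
  qed
  interpret lb_phases N b M lam \<mu> p rho \<pi>
    using v_norm M2 vbar_pos by unfold_locales
  have mu1: "0 < \<mu> 1" "1 \<le> \<mu> 1" using mu1_ge_1 by auto
  define e1 where "e1 = L / sqrt ?n / ?C"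
  have c1: "\<mu> 1 * CM M \<mu> p * e1 \<le> (1 - ?\<xi>) / 2 * nu"
  proof -
    have D: "0 < 2 * \<mu> 1 * CM M \<mu> p" using mu1 CM_ge by simp
    then have "2 * \<mu> 1 * CM M \<mu> p * L \<le> ?C * (1 - ?\<xi>) * (sqrt ?n * nu)"
      using upper'(2) unfolding nh_eq by (simp add: field_simps)
    then show ?thesis using C n1 unfolding e1_def by (simp add: field_simps)
  qed
  have e1: "0 < e1" "e1 \<le> 1"
  proof -
    show "0 < e1" using C n1 lower'(3) unfolding e1_def by (intro divide_pos_pos) auto
    have "4 * 1 \<le> CM M \<mu> p * \<mu> 1" using CM_ge mu1 by (intro mult_mono) auto
    then have "1 * e1 \<le> \<mu> 1 * CM M \<mu> p * e1" using \<open>0 < e1\<close> by (intro mult_right_mono) (auto simp: mult.commute)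
    moreover have "(1 - ?\<xi>) / 2 * nu \<le> 1 * 1" using xi_range nu0 by (intro mult_mono) auto
    ultimately show "e1 \<le> 1" using c1 by linarith
  qed
  interpret lb_coxian N b M lam \<mu> p rho \<pi> e1
    using e1 by unfold_locales
  have k35: "35 \<le> ?k" using kk_ge[OF C0] zeta_ge[OF C0] b by simp
  have kL: "?k * L \<le> sqrt ?n * nu / 2"
    using upper'(1) k35 unfolding nh_eq by (simp add: field_simps)
  \<comment> \<open>The bound \<open>2 \<le> L\<close> improves itself: with
    \<open>35 \<le> ?k\<close> it gives \<open>140 \<le> sqrt ?n\<close>, and
    \<open>exp 4 \<le> 81\<close>.\<close>
  have L4: "4 \<le> L"
  proof -
    have "35 * 2 \<le> ?k * L" using k35 lower'(3) by (intro mult_mono) auto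
    moreover have "sqrt ?n * nu \<le> sqrt ?n" using nu0 by (intro mult_left_le) auto
    ultimately have "140 \<le> sqrt ?n" using kL by linarith
    moreover have "sqrt ?n \<le> ?n" using n1 mult_left_mono[of 1 "sqrt ?n" "sqrt ?n"] by simp
    moreover have "exp (4 :: real) \<le> 3 ^ 4"
      using exp_le power_mono[of "exp 1" "3 :: real" 4] by (simp add: exp_of_nat_mult[of 4 "1 :: real", simplified])
    ultimately have "exp 4 \<le> ?n" by simp
    then show ?thesis using n1 by (simp add: L_def ln_ge_iff)
  qed
  have S1_eq: "S1 N b M x = busyc x / ?n" for x
    unfolding S1_def Sfrac_def busyc_Z Z_def by (simp add: sum_divide_distrib)
  have "expect (A1 b M rho) \<le> 1 / sqrt ?n + (4 + 2 * wu M \<mu> p) / (sqrt ?n * nu * L)"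
  proof (rule waiting_bound[OF C C_le])
    show "2 * \<mu> 1 \<le> (1 - ?\<xi>) * L" using lower'(1) xi_range by (simp add: field_simps)
    show "?k * (L / sqrt ?n) \<le> nu / 2" using kL n1 by (simp add: field_simps)
    show "A1 b M rho x \<le> 1 / sqrt ?n" if "x \<in> states N b M" "busyc x / ?n \<le> 1 - nu / L" for x
    proof -
      have "1 / (?n powr \<alpha> * ln ?n) = nu / L" by (simp add: nu_def L_def powr_minus field_simps)
      then show ?thesis using lbzero that unfolding LB_zero_def S1_eq by simp
    qed
  qed (use nu0 xi_range c1 L4 lower' in \<open>auto simp: e1_def L_def lam_def\<close>)
  also have "(4 + 2 * wu M \<mu> p) / (sqrt ?n * nu * L) \<le> (10 * mumax M \<mu> + 4) / (sqrt ?n * nu * L)"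
    using wu_le_mumax wu_ge_1 n1 nu0 L4 by (intro divide_right_mono) auto
  finally show ?thesis
    unfolding expect_def nh_eq[symmetric] nh_def L_def by simp
qed

end
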